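(* Assume that the limit $\ell:=\lim_{s\uparrow+\infty}-\frac1s\ln\mathbb{P}[S_1>s]$ exists in $[0,+\infty]$. The absolute area $F_t:=\int_0^t|Z_\tau|\,d\tau$ of the reset Brownian motion satisfies a full large deviation principle with the rate function $I(w):=\sup_{k\in\mathbb{R}}\{wk+\varphi(k)\}$, $w\in\mathbb{R}$, for any resetting protocol (i.e. any law of the waiting times as in the context). Moreover, its asymptotic logarithmic moment generating function $g(k):=\lim_{t\uparrow+\infty}\frac1t\ln\mathbb{E}[e^{kF_t}]$ exists for every $k\in\mathbb{R}$ (as an extended real number) and $g=-\varphi$.
   Context: Let $(\Omega,\mathcal{F},\mathbb{P})$ be a probability space with expectation $\mathbb{E}$. Let $S_1,S_2,\ldots$ (waiting times) be i.i.d. non-negative real random variables with $\mathbb{P}[S_1=0]<1$; put $T_0:=0$, $T_n:=S_1+\cdots+S_n$, and $N_t:=\sup\{n\ge 0:T_n\le t\}$ for $t\ge 0$ (almost surely finite for all $t$). Let $\{B_{1,t}\}_{t\ge 0},\{B_{2,t}\}_{t\ge 0},\ldots$ be independent standard Brownian motions (started at $0$), independent of the waiting times. The reset Brownian motion is $Z_t:=B_{N_t+1,\,t-T_{N_t}}$, $t\ge 0$. Set $X_1:=\int_0^{S_1}|B_{1,\tau}|\,d\tau$ and, for $k\in\mathbb{R}$, $$\varphi(k):=\sup\Big\{\zeta\in\mathbb{R}:\ \mathbb{E}\big[e^{\zeta S_1+kX_1}\big]\le 1\Big\}$$ (extended real valued, $\sup\emptyset=-\infty$). Also $\ln 0=-\infty$,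 $\ln(+\infty)=+\infty$, $\inf\emptyset=+\infty$. $F_t$ satisfies a full large deviation principle with rate function $I$ if $I$ is lower semicontinuous on $\mathbb{R}$ and $\liminf_{t\uparrow+\infty}\frac1t\ln\mathbb{P}[F_t/t\in G]\ge-\inf_{w\in G}I(w)$ for each open $G\subseteq\mathbb{R}$, and $\limsup_{t\uparrow+\infty}\frac1t\ln\mathbb{P}[F_t/t\in K]\le-\inf_{w\in K}I(w)$ for each closed $K\subseteq\mathbb{R}$. *)

theory Defs
  imports "HOL-Probability.Probability"
begin

definition eln :: "ennreal \<Rightarrow> ereal" where
  "eln x = (if x = 0 then - \<infinity> else if x = \<infinity> then \<infinity> else ereal (ln (enn2real x)))"

definition lower_semicontinuous :: "(real \<Rightarrow> ereal) \<Rightarrow> bool" where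
  "lower_semicontinuous I \<longleftrightarrow> (\<forall>x. I x \<le> Liminf (at x) I)"

definition full_LDP :: "'a measure \<Rightarrow> (real \<Rightarrow> 'a \<Rightarrow> real) \<Rightarrow> (real \<Rightarrow> ereal) \<Rightarrow> bool" where
  "full_LDP M F I \<longleftrightarrow>
     lower_semicontinuous I \<and>
     (\<forall>G. open G \<longrightarrow>
        Liminf at_top (\<lambda>t. ereal (1 / t) * eln (emeasure M {\<omega> \<in> space M. F t \<omega> / t \<in> G}))
          \<ge> - (INF w\<in>G. I w)) \<and>
     (\<forall>K. closed K \<longrightarrow>
        Limsup at_top (\<lambda>t. ereal (1 / t) * eln (emeasure M {\<omega> \<in> space M. F t \<omega> / t \<in> K}))
          \<le> - (INF w\<in>K. I w))"

text \<open>
  All paths are required to be continuous (rather than almost all), so that time integrals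
  of the paths are random variables also when the probability space is not complete.
\<close>

definition standard_brownian_motion :: "'a measure \<Rightarrow> (real \<Rightarrow> 'a \<Rightarrow> real) \<Rightarrow> bool" where
  "standard_brownian_motion M W \<longleftrightarrow>
     (\<forall>t\<ge>0. W t \<in> borel_measurable M) \<and>
     (\<forall>\<omega>\<in>space M. W 0 \<omega> = 0) \<and>
     (\<forall>\<omega>\<in>space M. continuous_on {0..} (\<lambda>t. W t \<omega>)) \<and>
     (\<forall>s t. 0 \<le> s \<longrightarrow> s < t \<longrightarrow>
        distributed M lborel (\<lambda>\<omega>. W t \<omega> - W s \<omega>) (normal_density 0 (sqrt (t - s)))) \<and>
     (\<forall>n (\<tau> :: nat \<Rightarrow> real). 0 \<le> \<tau> 0 \<longrightarrow> mono_on {..n} \<tau> \<longrightarrow>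
        prob_space.indep_vars M (\<lambda>_. borel) (\<lambda>i \<omega>. W (\<tau> (Suc i)) \<omega> - W (\<tau> i) \<omega>) {..<n})"

text \<open>
  The waiting times \<open>S n\<close> and the Brownian motions \<open>B n\<close> are indexed by \<open>n \<ge> 1\<close>;
  \<open>S 0\<close>, \<open>B 0\<close> and values of \<open>B n\<close> at negative times play no role. The last assumption
  says that the sigma-algebra generated by all waiting times is independent of the one
  generated by all Brownian motions.
\<close>

locale brownian_resetting = prob_space M
  for M :: "'a measure" and S :: "nat \<Rightarrow> 'a \<Rightarrow> real" and B :: "nat \<Rightarrow> real \<Rightarrow> 'a \<Rightarrow> real" +
  assumes waiting_nonneg: "\<And>n \<omega>. n \<ge> 1 \<Longrightarrow> \<omega> \<in> space M \<Longrightarrow> 0 \<le> S n \<omega>"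
    and waiting_indep: "indep_vars (\<lambda>_. borel) S {1..}"
    and waiting_ident: "\<And>n. n \<ge> 1 \<Longrightarrow> distr M borel (S n) = distr M borel (S 1)"
    and waiting_nonzero: "prob {\<omega> \<in> space M. S 1 \<omega> = 0} < 1"
    and brownian: "\<And>n. n \<ge> 1 \<Longrightarrow> standard_brownian_motion M (B n)"
    and brownian_indep:
      "indep_vars (\<lambda>_. Pi\<^sub>M {0..} (\<lambda>_. borel)) (\<lambda>n \<omega>. \<lambda>t\<in>{0..}. B n t \<omega>) {1..}"
    and waiting_brownian_indep:
      "indep_set
         (sets (vimage_algebra (space M) (\<lambda>\<omega>. \<lambda>n\<in>{1..}. S n \<omega>) (Pi\<^sub>M {1..} (\<lambda>_. borel))))
         (sets (vimage_algebra (space M) (\<lambda>\<omega>. \<lambda>p\<in>{1..} \<times> {0..}. B (fst p) (snd p) \<omega>)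
           (Pi\<^sub>M ({1..} \<times> {0..}) (\<lambda>_. borel))))"

definition reset_time :: "(nat \<Rightarrow> 'a \<Rightarrow> real) \<Rightarrow> nat \<Rightarrow> 'a \<Rightarrow> real" where
  "reset_time S n \<omega> = (\<Sum>i=1..n. S i \<omega>)"

text \<open>
  On the null event that infinitely many resets occur before time \<open>t\<close>, the supremum below
  is that of \<open>UNIV\<close>, an unspecified fixed natural number.
\<close>

definition reset_count :: "(nat \<Rightarrow> 'a \<Rightarrow> real) \<Rightarrow> real \<Rightarrow> 'a \<Rightarrow> nat" where
  "reset_count S t \<omega> = Sup {n. reset_time S n \<omega> \<le> t}"

definition reset_brownian_motion ::
    "(nat \<Rightarrow> 'a \<Rightarrow> real) \<Rightarrow> (nat \<Rightarrow> real \<Rightarrow> 'a \<Rightarrow> real) \<Rightarrow> real \<Rightarrow> 'a \<Rightarrow> real" where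
  "reset_brownian_motion S B t \<omega> =
     B (reset_count S t \<omega> + 1) (t - reset_time S (reset_count S t \<omega>) \<omega>) \<omega>"

definition absolute_area ::
    "(nat \<Rightarrow> 'a \<Rightarrow> real) \<Rightarrow> (nat \<Rightarrow> real \<Rightarrow> 'a \<Rightarrow> real) \<Rightarrow> real \<Rightarrow> 'a \<Rightarrow> real" where
  "absolute_area S B t \<omega> = (LINT \<tau>:{0..t}|lborel. \<bar>reset_brownian_motion S B \<tau> \<omega>\<bar>)"

definition first_cycle_area ::
    "(nat \<Rightarrow> 'a \<Rightarrow> real) \<Rightarrow> (nat \<Rightarrow> real \<Rightarrow> 'a \<Rightarrow> real) \<Rightarrow> 'a \<Rightarrow> real" where
  "first_cycle_area S B \<omega> = (LINT \<tau>:{0..S 1 \<omega>}|lborel. \<bar>B 1 \<tau> \<omega>\<bar>)"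

definition cycle_exponent ::
    "'a measure \<Rightarrow> (nat \<Rightarrow> 'a \<Rightarrow> real) \<Rightarrow> (nat \<Rightarrow> real \<Rightarrow> 'a \<Rightarrow> real) \<Rightarrow> real \<Rightarrow> ereal" where
  "cycle_exponent M S B k =
     (SUP \<zeta>\<in>{\<zeta> :: real.
        (\<integral>\<^sup>+\<omega>. ennreal (exp (\<zeta> * S 1 \<omega> + k * first_cycle_area S B \<omega>)) \<partial>M) \<le> 1}. ereal \<zeta>)"

definition area_rate ::
    "'a measure \<Rightarrow> (nat \<Rightarrow> 'a \<Rightarrow> real) \<Rightarrow> (nat \<Rightarrow> real \<Rightarrow> 'a \<Rightarrow> real) \<Rightarrow> real \<Rightarrow> ereal" where
  "area_rate M S B w = (SUP k. ereal (w * k) + cycle_exponent M S B k)"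

end

theory Submission
  imports Defs
begin

text \<open>
  A cycle has a length \<open>S\<close> and an area \<open>X\<close>, and the pairs of different cycles are independent
  and identically distributed. Call \<open>(\<zeta>, k)\<close> feasible if \<open>E exp (\<zeta> S + k X) \<le> 1\<close>. The exponent
  \<open>\<phi> k\<close> is the supremum of the \<open>\<zeta>\<close> that are feasible with \<open>k\<close>, so that \<open>I w\<close> is the supremum of
  \<open>\<zeta> + k w\<close> over all feasible pairs. Both halves of the theorem are proved from this description.

  Upper bounds. Split \<open>E exp (k F\<^sub>t)\<close> according to the number \<open>n\<close> of cycles completed by time \<open>t\<close>. If
  \<open>(\<zeta>, k)\<close> is feasible and \<open>z < \<zeta>\<close>, then \<open>q = E exp (z S + k X) < 1\<close>, and the \<open>n\<close> completed cycles
  contribute \<open>q ^ n\<close> after the factor \<open>exp (- z t)\<close> has been taken out. What is left is one interrupted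
  cycle: \<open>m u * P (S > u)\<close> has to be at most of order \<open>exp (- z u)\<close>, where \<open>m u = E exp (k A\<^sub>u)\<close> and
  \<open>A\<^sub>u\<close> is the absolute area of one Brownian path up to time \<open>u\<close> (\<open>interrupted_cycle_bound\<close>). The
  reason is that \<open>m\<close> is submultiplicative for \<open>k \<le> 0\<close> and supermultiplicative for \<open>k \<ge> 0\<close>: among all
  starting points, a Brownian path collects the least absolute area, in the exponential sense, when it
  starts at \<open>0\<close>. For \<open>k \<le> 0\<close> the function \<open>m\<close> therefore decays at a definite exponential rate, or faster
  than every exponential; a definite rate of \<open>m\<close> makes feasibility a bound on \<open>P (S > u)\<close> with the
  complementary rate, by Markov's inequality. For \<open>k > 0\<close> the
  function \<open>m\<close> grows faster than every exponential, so the prolongation of an interrupted cycle to its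
  full length costs at most a constant factor. Summing the geometric series gives
  \<open>moment_upper_bound\<close>; Markov's inequality turns it into bounds for half-lines, and a closed set on
  which \<open>I\<close> exceeds a level is covered by two half-lines controlled at this level
  (\<open>closed_upper_bound\<close>).

  Lower bounds. Let \<open>W\<close> be \<open>exp (\<zeta> S + k X)\<close>, truncated to bounded \<open>S\<close> and \<open>X\<close>, with \<open>E W = 1\<close>. Under the
  law with density \<open>W\<close> for every cycle, \<open>F\<^sub>t / t\<close> concentrates at \<open>w = E (W X) / E (W S)\<close>, and undoing the
  change of measure costs \<open>exp (- t (\<zeta> + k w))\<close> (\<open>tilted_lower_bound\<close>). It remains to find, close to a
  given slope \<open>w\<close>, such a tilt with \<open>\<zeta> + k w\<close> not much larger than \<open>I w\<close> (\<open>exists_tilt\<close>). Maximise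
  \<open>c - \<epsilon> k\<^sup>2\<close>, where \<open>c = \<zeta> + k w\<close>, under the truncated constraint. The penalty makes the problem compact
  for every \<open>w\<close>, also for extreme slopes; at a maximiser the Lagrange condition says that the tilted
  slope is \<open>w - 2 \<epsilon> k\<close>; and comparison of the penalties \<open>\<epsilon>\<close> and \<open>\<epsilon> / 2\<close> shows that this shift is small.
  Fatou's lemma removes the truncation. For the lower bound of \<open>E exp (k F\<^sub>t)\<close> the number \<open>k\<close> is fixed, and
  the intermediate value theorem provides the tilt (\<open>exists_tilt_exponent\<close>).
\<close>

(* Cycles are indexed from 1, and 1 should not be rewritten to Suc 0. *)
declare One_nat_def [simp del]

section \<open>Exponential rates of nonnegative quantities\<close>

lemma eln_mono:
  assumes "x \<le> y" shows "eln x \<le> eln y"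
proof -
  consider "x = 0" | "y = \<infinity>" | "x \<noteq> 0" "y \<noteq> \<infinity>" by auto
  then show ?thesis
  proof cases
    case 3
    obtain a where a: "x = ennreal a" "0 \<le> a" using 3 assms by (cases x) (auto simp: top_unique)
    obtain b where b: "y = ennreal b" "0 \<le> b" using 3 assms by (cases y) auto
    have "0 < a" "a \<le> b" using 3 assms a b by (auto simp: ennreal_eq_0_iff not_le)
    then show ?thesis using a b by (simp add: eln_def ennreal_eq_0_iff)
  qed (auto simp: eln_def)
qed

lemma eln_mult_exp:
  assumes "0 < C"
  shows "eln (ennreal (C * exp a)) = ereal (ln C + a)"
  using assms by (simp add: eln_def ennreal_eq_0_iff not_le ln_mult)

lemma tendsto_rate_exp:
  assumes "0 < C"
  shows "((\<lambda>t::real. ereal (1 / t) * eln (ennreal (C * exp (a * t)))) \<longlongrightarrow> ereal a) at_top"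
proof -
  have "((\<lambda>t::real. ln C * (1 / t) + a) \<longlongrightarrow> ln C * 0 + a) at_top"
    by (intro tendsto_intros tendsto_divide_0[OF tendsto_const] filterlim_at_top_imp_at_infinity filterlim_ident)
  then have "((\<lambda>t::real. ereal (ln C * (1 / t) + a)) \<longlongrightarrow> ereal a) at_top" by simp
  moreover have "\<forall>\<^sub>F t in at_top. ereal (ln C * (1 / t) + a) = ereal (1 / t) * eln (ennreal (C * exp (a * t)))"
    using eventually_gt_at_top[of 0]
    by eventually_elim (simp add: eln_mult_exp[OF assms] field_simps)
  ultimately show ?thesis by (rule Lim_transform_eventually)
qed

lemma rate_mono:
  assumes "x \<le> y" "0 < t"
  shows "ereal (1 / t) * eln x \<le> ereal (1 / t) * eln y"
  using assms by (intro ereal_mult_left_mono eln_mono) auto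

lemma Limsup_rate_le:
  assumes "0 < C" "\<forall>\<^sub>F t in at_top. f t \<le> ennreal (C * exp (a * t))"
  shows "Limsup at_top (\<lambda>t. ereal (1 / t) * eln (f t)) \<le> ereal a"
proof -
  have "Limsup at_top (\<lambda>t. ereal (1 / t) * eln (f t))
      \<le> Limsup at_top (\<lambda>t. ereal (1 / t) * eln (ennreal (C * exp (a * t))))"
    by (intro Limsup_mono eventually_mono[OF eventually_conj[OF assms(2) eventually_gt_at_top[of 0]]])
      (auto intro: rate_mono)
  also have "\<dots> = ereal a"
    by (intro lim_imp_Limsup tendsto_rate_exp assms) simp
  finally show ?thesis .
qed

lemma Liminf_rate_ge:
  assumes "0 < C" "\<forall>\<^sub>F t in at_top. ennreal (C * exp (a * t)) \<le> f t"
  shows "ereal a \<le> Liminf at_top (\<lambda>t. ereal (1 / t) * eln (f t))"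
proof -
  have "ereal a = Liminf at_top (\<lambda>t. ereal (1 / t) * eln (ennreal (C * exp (a * t))))"
    by (intro lim_imp_Liminf[symmetric] tendsto_rate_exp assms) simp
  also have "\<dots> \<le> Liminf at_top (\<lambda>t. ereal (1 / t) * eln (f t))"
    by (intro Liminf_mono eventually_mono[OF eventually_conj[OF assms(2) eventually_gt_at_top[of 0]]])
      (auto intro: rate_mono)
  finally show ?thesis .
qed

section \<open>Truncated exponential tilts\<close>

text \<open>
  The truncation at level \<open>L\<close> makes all integrals against a tilt finite and lets dominated convergence
  and Chernoff bounds apply without any assumption on the law of \<open>(S, X)\<close>.
\<close>

definition tilt :: "real \<Rightarrow> real \<Rightarrow> real \<Rightarrow> real \<Rightarrow> real \<Rightarrow> real" where
  "tilt \<zeta> k L s x = (if s \<le> L \<and> \<bar>x\<bar> \<le> L then exp (\<zeta> * s + k * x) else 0)"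

lemma tilt_nonneg [simp]: "0 \<le> tilt \<zeta> k L s x"
  by (simp add: tilt_def)

lemma tilt_le_exp: "tilt \<zeta> k L s x \<le> exp (\<zeta> * s + k * x)"
  by (simp add: tilt_def)

lemma measurable_tilt [measurable]:
  assumes [measurable]: "f \<in> borel_measurable M" "g \<in> borel_measurable M"
  shows "(\<lambda>\<omega>. tilt \<zeta> k L (f \<omega>) (g \<omega>)) \<in> borel_measurable M"
  unfolding tilt_def by measurable

lemma tilt_le_bound:
  assumes "0 \<le> s" shows "tilt \<zeta> k L s x \<le> exp (\<bar>\<zeta>\<bar> * \<bar>L\<bar> + \<bar>k\<bar> * \<bar>L\<bar>)"
proof -
  have "\<zeta> * s \<le> \<bar>\<zeta>\<bar> * \<bar>L\<bar>" if "s \<le> L" 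
    using mult_mono[of "\<bar>\<zeta>\<bar>" "\<bar>\<zeta>\<bar>" "\<bar>s\<bar>" "\<bar>L\<bar>"] abs_ge_self[of "\<zeta> * s"] that assms by (auto simp: abs_mult)
  moreover have "k * x \<le> \<bar>k\<bar> * \<bar>L\<bar>" if "\<bar>x\<bar> \<le> L"
    using mult_mono[of "\<bar>k\<bar>" "\<bar>k\<bar>" "\<bar>x\<bar>" "\<bar>L\<bar>"] abs_ge_self[of "k * x"] that by (auto simp: abs_mult)
  ultimately show ?thesis by (auto simp: tilt_def add_mono)
qed

text \<open>
  The only expansion of the exponential that is needed: integrated against a tilt, it replaces
  differentiation under the integral sign in the Lagrange and Chernoff arguments.
\<close>

lemma exp_le_quadratic:
  fixes x :: real assumes "\<bar>x\<bar> \<le> 1" shows "exp x \<le> 1 + x + x\<^sup>2"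
proof (cases "0 \<le> x")
  case True then show ?thesis using exp_bound[of x] assms by simp
next
  case False
  have "1 - x + x\<^sup>2 / 2 \<le> exp (- x)"
    using exp_lower_Taylor_quadratic[of "-x"] False by simp
  then have "exp x \<le> 1 / (1 - x + x\<^sup>2/2)"
    using False le_imp_inverse_le[of "1 - x + x\<^sup>2/2" "exp (-x)"]
    by (simp add: exp_minus inverse_eq_divide add_pos_nonneg)
  also have "\<dots> \<le> 1 + x + x\<^sup>2"
  proof -
    have p: "0 < 1 - x + x\<^sup>2/2" using False by (simp add: add_pos_nonneg)
    have "(1 + x + x\<^sup>2) * (1 - x + x\<^sup>2/2) = 1 + x\<^sup>2/2 - x^3/2 + x^4/2"
      by (simp add: field_simps power2_eq_square power3_eq_cube power4_eq_xxxx)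
    moreover have "0 \<le> x^4" by simp
    moreover have "0 \<le> - (x^3)" using False by (simp add: power3_eq_cube mult_nonneg_nonpos2 mult_nonpos_nonpos mult_le_0_iff zero_le_mult_iff)
    ultimately have "1 \<le> (1 + x + x\<^sup>2) * (1 - x + x\<^sup>2/2)"
      using zero_le_power2[of x] by linarith
    then show ?thesis using p by (simp add: divide_le_eq mult.commute)
  qed
  finally show ?thesis .
qed

lemma (in prob_space) nn_integral_le_one_limit:
  assumes [measurable]: "\<And>n::nat. f n \<in> borel_measurable M"
    and lim: "\<And>\<omega>. \<omega> \<in> space M \<Longrightarrow> (\<lambda>n. f n \<omega>) \<longlonglongrightarrow> g \<omega>"
    and le: "\<And>n. (\<integral>\<^sup>+\<omega>. f n \<omega> \<partial>M) \<le> (1::ennreal)"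
  shows "(\<integral>\<^sup>+\<omega>. g \<omega> \<partial>M) \<le> 1"
proof -
  have "(\<integral>\<^sup>+\<omega>. g \<omega> \<partial>M) = (\<integral>\<^sup>+\<omega>. liminf (\<lambda>n. f n \<omega>) \<partial>M)"
    by (intro nn_integral_cong lim_imp_Liminf[symmetric, OF sequentially_bot] lim)
  also have "\<dots> \<le> liminf (\<lambda>n. \<integral>\<^sup>+\<omega>. f n \<omega> \<partial>M)"
    by (intro nn_integral_liminf assms(1))
  also have "\<dots> \<le> liminf (\<lambda>n. 1::ennreal)"
    by (intro Liminf_mono always_eventually allI le)
  also have "\<dots> = 1" by (intro Liminf_const) simp
  finally show ?thesis .
qed

text \<open>
  Since \<open>S\<close> is not almost surely zero, it is bounded away from zero, with \<open>X\<close> bounded, on some event of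
  positive probability; this event prevents the constraint \<open>E exp (\<zeta> S + k X) \<le> 1\<close> from being vacuous.
\<close>

lemma (in prob_space) bounded_part_positive:
  assumes [measurable]: "S \<in> borel_measurable M" "X \<in> borel_measurable M"
    and nonneg: "\<And>\<omega>. \<omega> \<in> space M \<Longrightarrow> 0 \<le> S \<omega>"
    and nz: "prob {\<omega> \<in> space M. S \<omega> = 0} < 1"
  obtains s L where "0 < (s::real)" "0 < (L::real)" "0 < prob {\<omega> \<in> space M. s \<le> S \<omega> \<and> S \<omega> \<le> L \<and> \<bar>X \<omega>\<bar> \<le> L}"
proof -
  define A where "A n = {\<omega> \<in> space M. 1 / Suc n \<le> S \<omega> \<and> S \<omega> \<le> Suc n \<and> \<bar>X \<omega>\<bar> \<le> Suc n}" for n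
  have A_meas [measurable]: "A n \<in> sets M" for n
    unfolding A_def by measurable
  have "\<exists>n. 0 < prob (A n)"
  proof (rule ccontr)
    assume "\<not> ?thesis"
    then have "A n \<in> null_sets M" for n
      using A_meas by (auto simp: zero_less_measure_iff emeasure_eq_measure)
    then have "AE \<omega> in M. \<omega> \<notin> A n" for n by (rule AE_not_in)
    then have "AE \<omega> in M. \<forall>n. \<omega> \<notin> A n"
      by (simp add: AE_all_countable)
    then have "AE \<omega> in M. S \<omega> = 0"
      using AE_space
    proof eventually_elim
      case (elim \<omega>)
      show "S \<omega> = 0"
      proof (rule ccontr)
        assume "S \<omega> \<noteq> 0"
        then have pos: "0 < S \<omega>" using nonneg[OF elim(2)] by simp
        obtain n where n: "max (1 / S \<omega>) (max (S \<omega>) \<bar>X \<omega>\<bar>) < real n" using reals_Archimedean2 by blast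
        then have "1 / S \<omega> < Suc n" "S \<omega> \<le> Suc n" "\<bar>X \<omega>\<bar> \<le> Suc n" by auto
        then have "1 / Suc n \<le> S \<omega>" using pos by (simp add: field_simps)
        with \<open>S \<omega> \<le> Suc n\<close> \<open>\<bar>X \<omega>\<bar> \<le> Suc n\<close> elim(2) have "\<omega> \<in> A n" by (simp add: A_def)
        with elim(1) show False by blast
      qed
    qed
    then have "prob {\<omega> \<in> space M. S \<omega> = 0} = 1"
      by (subst prob_Collect_eq_1) auto
    with nz show False by simp
  qed
  then obtain n where "0 < prob (A n)" ..
  then show ?thesis unfolding A_def by (intro that[of "1 / Suc n" "Suc n"]) auto
qed

lemma (in prob_space) integrable_bounded_on:
  assumes "f \<in> borel_measurable M" "\<And>\<omega>. \<omega> \<in> space M \<Longrightarrow> \<bar>f \<omega>\<bar> \<le> (C::real)"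
  shows "integrable M f"
  using assms by (intro integrable_const_bound[of _ C]) auto

text \<open>
  The supremum of \<open>\<zeta> + k w\<close> over feasible pairs need not be attained, and if it is attained the law may be
  too heavy-tailed to have a mean slope. A quadratic penalty in \<open>k\<close> and a truncation of \<open>(S, X)\<close> cure both
  defects at the price of moving \<open>w\<close> slightly. The penalty, rather than a restriction on \<open>w\<close>, provides
  compactness, so slopes on the boundary of the range of \<open>X / S\<close> are covered as well.
\<close>

lemma (in prob_space) exists_tilt:
  fixes S X :: "'a \<Rightarrow> real"
  assumes [measurable]: "S \<in> borel_measurable M" "X \<in> borel_measurable M"
    and nonneg: "\<And>\<omega>. \<omega> \<in> space M \<Longrightarrow> 0 \<le> S \<omega>"
    and nz: "prob {\<omega> \<in> space M. S \<omega> = 0} < 1"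
    and rate: "\<And>\<zeta> k. (\<integral>\<^sup>+\<omega>. ennreal (exp (\<zeta> * S \<omega> + k * X \<omega>)) \<partial>M) \<le> 1 \<Longrightarrow> \<zeta> + k * w \<le> \<alpha>"
    and pos: "0 < \<delta>" "0 < \<eta>"
  obtains \<zeta> k L w' where "\<bar>w' - w\<bar> < \<delta>" "\<zeta> + k * w' \<le> \<alpha> + \<eta>"
    "expectation (\<lambda>\<omega>. tilt \<zeta> k L (S \<omega>) (X \<omega>)) = 1"
    "0 < expectation (\<lambda>\<omega>. tilt \<zeta> k L (S \<omega>) (X \<omega>) * S \<omega>)"
    "expectation (\<lambda>\<omega>. tilt \<zeta> k L (S \<omega>) (X \<omega>) * X \<omega>)
       = w' * expectation (\<lambda>\<omega>. tilt \<zeta> k L (S \<omega>) (X \<omega>) * S \<omega>)"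
proof -
  (* With c = zeta + k w the exponent is c S + k (X - w S), and c is the quantity to maximise. *)
  define U where "U c k L \<omega> = tilt (c - k * w) k L (S \<omega>) (X \<omega>)" for c k L \<omega>
  define J where "J c k L = expectation (U c k L)" for c k L
  have U_meas [measurable]: "U c k L \<in> borel_measurable M" for c k L
    unfolding U_def by measurable
  have U_nonneg: "0 \<le> U c k L \<omega>" for c k L \<omega> by (simp add: U_def)
  have U_bound: "\<exists>C. \<forall>\<omega>\<in>space M. U c k L \<omega> \<le> C" for c k L
    unfolding U_def using tilt_le_bound nonneg by blast
  have U_int: "integrable M (U c k L)" for c k L
  proof -
    obtain C where "\<forall>\<omega>\<in>space M. U c k L \<omega> \<le> C" using U_bound by blast
    then have "\<bar>U c k L \<omega>\<bar> \<le> C" if "\<omega> \<in> space M" for \<omega> using U_nonneg[of c k L \<omega>] that by simp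
    then show ?thesis by (intro integrable_bounded_on U_meas)
  qed
  have J_nn: "(\<integral>\<^sup>+\<omega>. ennreal (U c k L \<omega>) \<partial>M) = ennreal (J c k L)" for c k L
    unfolding J_def by (intro nn_integral_eq_integral U_int AE_I2 U_nonneg)
  have J_le: "J c k L \<le> 1 \<longleftrightarrow> (\<integral>\<^sup>+\<omega>. ennreal (U c k L \<omega>) \<partial>M) \<le> 1" for c k L
    unfolding J_nn by simp
  obtain s L0 where sL: "0 < s" "0 < L0"
    and p: "0 < prob {\<omega> \<in> space M. s \<le> S \<omega> \<and> S \<omega> \<le> L0 \<and> \<bar>X \<omega>\<bar> \<le> L0}"
    by (rule bounded_part_positive[OF assms(1,2) nonneg nz])
  define A where "A = {\<omega> \<in> space M. s \<le> S \<omega> \<and> S \<omega> \<le> L0 \<and> \<bar>X \<omega>\<bar> \<le> L0}"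
  have [measurable]: "A \<in> sets M" unfolding A_def by measurable
  define p where "p = prob A"
  have p_pos: "0 < p" using p by (simp add: p_def A_def)
  define C where "C = L0 + \<bar>w\<bar> * L0"
  have C_pos: "0 < C" using sL by (simp add: C_def add_pos_nonneg)
  have growth: "c * s \<le> \<bar>k\<bar> * C - ln p" if c: "0 \<le> c" and L: "L0 \<le> L" and J: "J c k L \<le> 1" for c k L
  proof -
    have *: "exp (c * s - \<bar>k\<bar> * C) \<le> U c k L \<omega>" if "\<omega> \<in> A" for \<omega>
    proof -
      have a: "s \<le> S \<omega>" "S \<omega> \<le> L0" "\<bar>X \<omega>\<bar> \<le> L0" using that by (auto simp: A_def)
      have "c * s \<le> c * S \<omega>" using c a by (intro mult_left_mono) auto
      moreover have "\<bar>X \<omega> - w * S \<omega>\<bar> \<le> C"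
      proof -
        have "\<bar>w * S \<omega>\<bar> \<le> \<bar>w\<bar> * L0" using a sL by (auto simp: abs_mult intro!: mult_left_mono)
        then show ?thesis unfolding C_def using a by linarith
      qed
      then have "\<bar>k * (X \<omega> - w * S \<omega>)\<bar> \<le> \<bar>k\<bar> * C" by (auto simp: abs_mult intro: mult_left_mono)
      ultimately have "c * s - \<bar>k\<bar> * C \<le> c * S \<omega> + k * (X \<omega> - w * S \<omega>)" by linarith
      then show ?thesis using a L by (auto simp: U_def tilt_def algebra_simps)
    qed
    have "p * exp (c * s - \<bar>k\<bar> * C) = expectation (\<lambda>\<omega>. indicator A \<omega> * exp (c * s - \<bar>k\<bar> * C))"
      by (simp add: p_def)
    also have "\<dots> \<le> J c k L"
      unfolding J_def
    proof (intro integral_mono U_int)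
      show "integrable M (\<lambda>\<omega>. indicator A \<omega> * exp (c * s - \<bar>k\<bar> * C))"
        by (intro integrable_bounded_on[of _ "exp (c * s - \<bar>k\<bar> * C)"]) (auto simp: indicator_def)
      show "indicator A \<omega> * exp (c * s - \<bar>k\<bar> * C) \<le> U c k L \<omega>" for \<omega>
        using *[of \<omega>] U_nonneg[of c k L \<omega>] by (simp add: indicator_def)
    qed
    finally have "p * exp (c * s - \<bar>k\<bar> * C) \<le> 1" using J by (rule order_trans)
    then have "ln (p * exp (c * s - \<bar>k\<bar> * C)) \<le> ln 1"
      using p_pos by (intro ln_mono mult_pos_pos exp_gt_zero) auto
    also have "ln (p * exp (c * s - \<bar>k\<bar> * C)) = ln p + (c * s - \<bar>k\<bar> * C)"
      using p_pos by (simp add: ln_mult)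
    finally show ?thesis by simp
  qed
  (* The constraint bounds c linearly in |k|, whereas c is at least eps k^2: hence both are bounded,
     uniformly in the truncation level. *)
  have k_bound: "\<exists>R. \<forall>c k L. L0 \<le> L \<longrightarrow> J c k L \<le> 1 \<longrightarrow> 0 \<le> c - \<epsilon> * k\<^sup>2 \<longrightarrow> \<bar>k\<bar> \<le> R \<and> \<bar>c\<bar> \<le> R"
    if eps: "0 < \<epsilon>" for \<epsilon>
  proof -
    define R0 where "R0 = 1 + (C + \<bar>ln p\<bar>) / (\<epsilon> * s)"
    define R where "R = R0 + (R0 * C + \<bar>ln p\<bar>) / s"
    have R0_pos: "0 < R0" unfolding R0_def using eps sL C_pos by (intro add_pos_nonneg divide_nonneg_nonneg) auto
    have "\<bar>k\<bar> \<le> R \<and> \<bar>c\<bar> \<le> R" if L: "L0 \<le> L" and J: "J c k L \<le> 1" and c: "0 \<le> c - \<epsilon> * k\<^sup>2" for c k L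
    proof -
      have c0: "0 \<le> c" using c eps by (smt (verit) mult_nonneg_nonneg zero_le_power2)
      have g: "c * s \<le> \<bar>k\<bar> * C + \<bar>ln p\<bar>" using growth[OF c0 L J] by linarith
      have "\<bar>k\<bar> \<le> R0"
      proof (cases "\<bar>k\<bar> \<le> 1")
        case False
        have "\<epsilon> * k\<^sup>2 * s \<le> c * s" using c sL by (intro mult_right_mono) auto
        also have "\<dots> \<le> \<bar>k\<bar> * (C + \<bar>ln p\<bar>)" using g False mult_right_mono[of 1 "\<bar>k\<bar>" "\<bar>ln p\<bar>"] by (simp add: algebra_simps)
        finally have "\<bar>k\<bar> * (\<bar>k\<bar> * (\<epsilon> * s)) \<le> \<bar>k\<bar> * (C + \<bar>ln p\<bar>)"
          by (simp add: power2_eq_square algebra_simps flip: abs_mult) 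
        then have "\<bar>k\<bar> * (\<epsilon> * s) \<le> C + \<bar>ln p\<bar>" using False by (subst (asm) mult_le_cancel_left_pos) auto
        then have "\<bar>k\<bar> \<le> (C + \<bar>ln p\<bar>) / (\<epsilon> * s)" using eps sL by (simp add: pos_le_divide_eq)
        then show ?thesis by (simp add: R0_def)
      qed (use eps sL C_pos in \<open>auto simp: R0_def intro!: add_increasing2\<close>)
      moreover have "c \<le> (R0 * C + \<bar>ln p\<bar>) / s"
      proof -
        have "c * s \<le> R0 * C + \<bar>ln p\<bar>" using g mult_right_mono[OF \<open>\<bar>k\<bar> \<le> R0\<close>, of C] C_pos by linarith
        then show ?thesis using sL by (simp add: pos_le_divide_eq)
      qed
      ultimately show ?thesis using c0 R0_pos unfolding R_def by auto
    qed
    then show ?thesis by blast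
  qed
  have U_exp: "U c k L \<omega> = (if S \<omega> \<le> L \<and> \<bar>X \<omega>\<bar> \<le> L then exp (c * S \<omega> + k * (X \<omega> - w * S \<omega>)) else 0)" for c k L \<omega>
    by (simp add: U_def tilt_def algebra_simps)
  (* Otherwise a limit point of near-maximisers for increasing truncation levels would, by Fatou's
     lemma, be feasible without truncation and have a value above alpha. *)
  have eventually_small: "\<exists>L1\<ge>L0. \<forall>L\<ge>L1. \<forall>c k. J c k L \<le> 1 \<longrightarrow> 0 \<le> c - \<epsilon> * k\<^sup>2 \<longrightarrow> c - \<epsilon> * k\<^sup>2 < \<alpha> + \<eta>"
    if eps: "0 < \<epsilon>" for \<epsilon>
  proof (rule ccontr)
    assume neg: "\<not> ?thesis"
    have "\<exists>L c k. L0 + real n \<le> L \<and> J c k L \<le> 1 \<and> 0 \<le> c - \<epsilon> * k\<^sup>2 \<and> \<alpha> + \<eta> \<le> c - \<epsilon> * k\<^sup>2" for n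
    proof -
      have "L0 \<le> L0 + real n" by simp
      with neg show ?thesis by (meson not_le)
    qed
    then obtain L c k where seq: "\<And>n. L0 + real n \<le> L n" "\<And>n. J (c n) (k n) (L n) \<le> 1"
      "\<And>n. 0 \<le> c n - \<epsilon> * (k n)\<^sup>2" "\<And>n. \<alpha> + \<eta> \<le> c n - \<epsilon> * (k n)\<^sup>2"
      by metis
    obtain R where R: "\<bar>k n\<bar> \<le> R \<and> \<bar>c n\<bar> \<le> R" for n
    proof -
      have "L0 \<le> L n" for n using seq(1)[of n] by simp
      then show ?thesis using k_bound[OF eps] seq(2,3) that by meson
    qed
    have "compact ({-R..R} \<times> {-R..R})" by (intro compact_Times compact_Icc)
    moreover have "\<forall>n. (c n, k n) \<in> {-R..R} \<times> {-R..R}" using R by (auto simp: abs_le_iff minus_le_iff)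
    ultimately obtain l r where r: "strict_mono (r :: nat \<Rightarrow> nat)" and lim: "((\<lambda>n. (c n, k n)) \<circ> r) \<longlonglongrightarrow> l"
      unfolding compact_def by meson
    obtain c' k' where l: "l = (c', k')" by (cases l)
    have lim_c: "(\<lambda>n. c (r n)) \<longlonglongrightarrow> c'" and lim_k: "(\<lambda>n. k (r n)) \<longlonglongrightarrow> k'"
      using tendsto_fst[OF lim] tendsto_snd[OF lim] by (auto simp: l comp_def)
    have "(\<integral>\<^sup>+\<omega>. ennreal (exp ((c' - k' * w) * S \<omega> + k' * X \<omega>)) \<partial>M) \<le> 1"
    proof (rule nn_integral_le_one_limit[where f = "\<lambda>n \<omega>. ennreal (U (c (r n)) (k (r n)) (L (r n)) \<omega>)"])
      fix \<omega> assume "\<omega> \<in> space M"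
      have "(\<lambda>n. exp ((c (r n) - k (r n) * w) * S \<omega> + k (r n) * X \<omega>)) \<longlonglongrightarrow> exp ((c' - k' * w) * S \<omega> + k' * X \<omega>)"
        by (intro tendsto_intros lim_c lim_k)
      moreover have "\<forall>\<^sub>F n in sequentially. exp ((c (r n) - k (r n) * w) * S \<omega> + k (r n) * X \<omega>) = U (c (r n)) (k (r n)) (L (r n)) \<omega>"
      proof -
        obtain N where N: "max (S \<omega>) \<bar>X \<omega>\<bar> < real N" using reals_Archimedean2 by blast
        show ?thesis using eventually_ge_at_top[of N]
        proof eventually_elim
          case (elim n)
          have "real N \<le> real (r n)" using elim seq_suble[OF r, of n] by simp
          then have "max (S \<omega>) \<bar>X \<omega>\<bar> \<le> L (r n)" using seq(1)[of "r n"] N sL by linarith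
          then show ?case by (simp add: U_def tilt_def)
        qed
      qed
      ultimately show "(\<lambda>n. ennreal (U (c (r n)) (k (r n)) (L (r n)) \<omega>)) \<longlonglongrightarrow> ennreal (exp ((c' - k' * w) * S \<omega> + k' * X \<omega>))"
        by (intro tendsto_ennrealI) (rule Lim_transform_eventually)
    next
      fix n show "(\<integral>\<^sup>+\<omega>. ennreal (U (c (r n)) (k (r n)) (L (r n)) \<omega>) \<partial>M) \<le> 1"
        using seq(2) J_le by blast
    qed measurable
    from rate[OF this] have "c' \<le> \<alpha>" by (simp add: algebra_simps)
    moreover have "\<alpha> + \<eta> \<le> c' - \<epsilon> * k'\<^sup>2"
    proof (rule LIMSEQ_le_const)
      show "(\<lambda>n. c (r n) - \<epsilon> * (k (r n))\<^sup>2) \<longlonglongrightarrow> c' - \<epsilon> * k'\<^sup>2"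
        by (intro tendsto_intros lim_c lim_k)
    qed (use seq(4) in auto)
    moreover have "0 \<le> \<epsilon> * k'\<^sup>2" using eps by simp
    ultimately show False using pos by linarith
  qed
  have alpha_nonneg: "0 \<le> \<alpha>"
    using rate[of 0 0] by (simp add: emeasure_space_1)
  define \<beta> where "\<beta> = \<alpha> + \<eta>"
  have beta_pos: "0 < \<beta>" using alpha_nonneg pos by (simp add: \<beta>_def)
  (* The bound for the penalty eps / 2 gives eps k^2 < 2 beta at the maximiser for eps; then
     (2 eps k)^2 < 8 eps beta = delta^2 / 2 for this choice. *)
  define \<epsilon> where "\<epsilon> = \<delta>\<^sup>2 / (16 * \<beta>)"
  have eps: "0 < \<epsilon>" using pos beta_pos by (simp add: \<epsilon>_def)
  obtain L1 L2 where L1: "L0 \<le> L1" "\<And>L c k. L1 \<le> L \<Longrightarrow> J c k L \<le> 1 \<Longrightarrow> 0 \<le> c - \<epsilon> * k\<^sup>2 \<Longrightarrow> c - \<epsilon> * k\<^sup>2 < \<beta>"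
    and L2: "\<And>L c k. L2 \<le> L \<Longrightarrow> J c k L \<le> 1 \<Longrightarrow> 0 \<le> c - \<epsilon>/2 * k\<^sup>2 \<Longrightarrow> c - \<epsilon>/2 * k\<^sup>2 < \<beta>"
    unfolding \<beta>_def using eventually_small[OF eps] eventually_small[of "\<epsilon>/2"] eps by (metis half_gt_zero)
  define L where "L = max L1 L2"
  have L: "L0 \<le> L" "L1 \<le> L" "L2 \<le> L" using L1 by (auto simp: L_def)
  define K where "K = {(c, k). J c k L \<le> 1 \<and> 0 \<le> c - \<epsilon> * k\<^sup>2}"
  have K0: "(0, 0) \<in> K"
  proof -
    have "J 0 0 L \<le> expectation (\<lambda>_. 1)"
      unfolding J_def by (intro integral_mono U_int) (auto simp: U_exp)
    then show ?thesis by (simp add: K_def prob_space)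
  qed
  have "compact K"
  proof (subst compact_eq_bounded_closed, intro conjI)
    obtain R where R: "\<And>c k. (c, k) \<in> K \<Longrightarrow> \<bar>k\<bar> \<le> R \<and> \<bar>c\<bar> \<le> R"
      using k_bound[OF eps] L(1) unfolding K_def by blast
    have "K \<subseteq> {-R..R} \<times> {-R..R}" using R by (auto simp: abs_le_iff minus_le_iff)
    then show "bounded K" by (rule bounded_subset[rotated]) (intro bounded_Times bounded_closed_interval)
    show "closed K" unfolding closed_sequential_limits
    proof (intro allI impI, elim conjE)
      fix x l assume x: "\<forall>n. x n \<in> K" and lim: "x \<longlonglongrightarrow> l"
      obtain c' k' where l: "l = (c', k')" by (cases l)
      have lim_c: "(\<lambda>n. fst (x n)) \<longlonglongrightarrow> c'" and lim_k: "(\<lambda>n. snd (x n)) \<longlonglongrightarrow> k'"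
        using tendsto_fst[OF lim] tendsto_snd[OF lim] by (auto simp: l)
      have "(\<integral>\<^sup>+\<omega>. ennreal (U c' k' L \<omega>) \<partial>M) \<le> 1"
      proof (rule nn_integral_le_one_limit[where f = "\<lambda>n \<omega>. ennreal (U (fst (x n)) (snd (x n)) L \<omega>)"])
        fix \<omega> show "(\<lambda>n. ennreal (U (fst (x n)) (snd (x n)) L \<omega>)) \<longlonglongrightarrow> ennreal (U c' k' L \<omega>)"
          unfolding U_exp by (cases "S \<omega> \<le> L \<and> \<bar>X \<omega>\<bar> \<le> L") (auto intro!: tendsto_intros lim_c lim_k)
      next
        fix n show "(\<integral>\<^sup>+\<omega>. ennreal (U (fst (x n)) (snd (x n)) L \<omega>) \<partial>M) \<le> 1"
          using x[rule_format, of n] J_le by (auto simp: K_def)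
      qed measurable
      moreover have "0 \<le> c' - \<epsilon> * k'\<^sup>2"
      proof (rule LIMSEQ_le_const)
        show "(\<lambda>n. fst (x n) - \<epsilon> * (snd (x n))\<^sup>2) \<longlonglongrightarrow> c' - \<epsilon> * k'\<^sup>2"
          by (intro tendsto_intros lim_c lim_k)
      qed (use x in \<open>auto simp: K_def split_beta\<close>)
      ultimately show "l \<in> K" by (simp add: K_def l J_le)
    qed
  qed
  moreover have "continuous_on K (\<lambda>x. fst x - \<epsilon> * (snd x)\<^sup>2)" by (intro continuous_intros)
  ultimately obtain x where x: "x \<in> K" "\<And>y. y \<in> K \<Longrightarrow> fst y - \<epsilon> * (snd y)\<^sup>2 \<le> fst x - \<epsilon> * (snd x)\<^sup>2"
    using continuous_attains_sup[of K "\<lambda>x. fst x - \<epsilon> * (snd x)\<^sup>2"] K0 by blast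
  obtain c k where ck: "x = (c, k)" by (cases x)
  have J1: "J c k L \<le> 1" and v0: "0 \<le> c - \<epsilon> * k\<^sup>2" using x(1) by (auto simp: ck K_def)
  (* Maximality in terms of increments (a, b) of (c, k). *)
  have max: "a - 2 * \<epsilon> * k * b - \<epsilon> * b\<^sup>2 \<le> 0" if "J (c + a) (k + b) L \<le> 1" for a b
  proof (rule ccontr)
    assume a: "\<not> ?thesis"
    have "(c + a) - \<epsilon> * (k + b)\<^sup>2 = (c - \<epsilon> * k\<^sup>2) + (a - 2 * \<epsilon> * k * b - \<epsilon> * b\<^sup>2)"
      by (simp add: power2_eq_square algebra_simps)
    then have "(c + a, k + b) \<in> K" "c - \<epsilon> * k\<^sup>2 < (c + a) - \<epsilon> * (k + b)\<^sup>2" using a that v0 by (auto simp: K_def)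
    with x(2)[of "(c + a, k + b)"] show False by (simp add: ck)
  qed
  define P where "P = expectation (\<lambda>\<omega>. U c k L \<omega> * S \<omega>)"
  define Q where "Q = expectation (\<lambda>\<omega>. U c k L \<omega> * (X \<omega> - w * S \<omega>))"
  define D where "D = \<bar>L\<bar> + \<bar>w\<bar> * \<bar>L\<bar>"
  have D0: "0 \<le> D" by (simp add: D_def)
  have supp: "S \<omega> \<le> D \<and> \<bar>X \<omega> - w * S \<omega>\<bar> \<le> D" if "U c k L \<omega> \<noteq> 0" "\<omega> \<in> space M" for \<omega>
  proof -
    have a: "S \<omega> \<le> L" "\<bar>X \<omega>\<bar> \<le> L" using that by (auto simp: U_exp split: if_splits)
    have "\<bar>w * S \<omega>\<bar> \<le> \<bar>w\<bar> * \<bar>L\<bar>" using a nonneg[OF that(2)] by (auto simp: abs_mult intro!: mult_left_mono)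
    moreover have "0 \<le> \<bar>w\<bar> * \<bar>L\<bar>" by simp
    ultimately show ?thesis using a unfolding D_def by linarith
  qed
  obtain CU where CU: "\<And>\<omega>. \<omega> \<in> space M \<Longrightarrow> U c k L \<omega> \<le> CU" using U_bound by blast
  have intS: "integrable M (\<lambda>\<omega>. U c k L \<omega> * S \<omega>)"
  proof (rule integrable_bounded_on)
    fix \<omega> assume "\<omega> \<in> space M"
    then show "\<bar>U c k L \<omega> * S \<omega>\<bar> \<le> CU * D"
      using supp[of \<omega>] CU[of \<omega>] U_nonneg[of c k L \<omega>] nonneg[of \<omega>] D0
      by (cases "U c k L \<omega> = 0") (auto simp: abs_mult intro!: mult_mono)
  qed measurable
  have intY: "integrable M (\<lambda>\<omega>. U c k L \<omega> * (X \<omega> - w * S \<omega>))"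
  proof (rule integrable_bounded_on)
    fix \<omega> assume "\<omega> \<in> space M"
    then show "\<bar>U c k L \<omega> * (X \<omega> - w * S \<omega>)\<bar> \<le> CU * D"
      using supp[of \<omega>] CU[of \<omega>] U_nonneg[of c k L \<omega>] nonneg[of \<omega>] D0
      by (cases "U c k L \<omega> = 0") (auto simp: abs_mult intro!: mult_mono)
  qed measurable
  have expand: "J (c + a) (k + b) L \<le> J c k L + a * P + b * Q + ((\<bar>a\<bar> + \<bar>b\<bar>) * D)\<^sup>2"
    if small: "(\<bar>a\<bar> + \<bar>b\<bar>) * D \<le> 1" for a b
  proof -
    have "J (c + a) (k + b) L \<le> expectation (\<lambda>\<omega>. U c k L \<omega> * (1 + ((\<bar>a\<bar> + \<bar>b\<bar>) * D)\<^sup>2)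
        + a * (U c k L \<omega> * S \<omega>) + b * (U c k L \<omega> * (X \<omega> - w * S \<omega>)))"
      unfolding J_def
    proof (intro integral_mono Bochner_Integration.integrable_add integrable_mult_right integrable_mult_left U_int intS intY)
      fix \<omega> assume om: "\<omega> \<in> space M"
      let ?z = "a * S \<omega> + b * (X \<omega> - w * S \<omega>)"
      have "U (c + a) (k + b) L \<omega> = U c k L \<omega> * exp ?z"
        by (simp add: U_exp exp_add[symmetric] algebra_simps)
      also have "\<dots> \<le> U c k L \<omega> * (1 + ((\<bar>a\<bar> + \<bar>b\<bar>) * D)\<^sup>2 + ?z)"
      proof (cases "U c k L \<omega> = 0")
        case False
        have "\<bar>a * S \<omega>\<bar> \<le> \<bar>a\<bar> * D" "\<bar>b * (X \<omega> - w * S \<omega>)\<bar> \<le> \<bar>b\<bar> * D"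
          using supp[OF False om] nonneg[OF om] by (auto simp: abs_mult intro!: mult_left_mono)
        then have z: "\<bar>?z\<bar> \<le> (\<bar>a\<bar> + \<bar>b\<bar>) * D" by (simp add: algebra_simps)
        then have "?z\<^sup>2 \<le> ((\<bar>a\<bar> + \<bar>b\<bar>) * D)\<^sup>2" using power_mono[of "\<bar>?z\<bar>" "(\<bar>a\<bar> + \<bar>b\<bar>) * D" 2] by simp
        moreover have "exp ?z \<le> 1 + ?z + ?z\<^sup>2" using z small by (intro exp_le_quadratic) auto
        ultimately have "exp ?z \<le> 1 + ((\<bar>a\<bar> + \<bar>b\<bar>) * D)\<^sup>2 + ?z" by linarith
        then show ?thesis using U_nonneg by (intro mult_left_mono) auto
      qed simp
      also have "\<dots> = U c k L \<omega> * (1 + ((\<bar>a\<bar> + \<bar>b\<bar>) * D)\<^sup>2)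
        + a * (U c k L \<omega> * S \<omega>) + b * (U c k L \<omega> * (X \<omega> - w * S \<omega>))"
        by (simp add: algebra_simps)
      finally show "U (c + a) (k + b) L \<omega> \<le> \<dots>" .
    qed
    also have "\<dots> = J c k L * (1 + ((\<bar>a\<bar> + \<bar>b\<bar>) * D)\<^sup>2) + a * P + b * Q"
      using U_int[of c k L] intS intY by (simp add: J_def P_def Q_def)
    also have "\<dots> \<le> J c k L + a * P + b * Q + ((\<bar>a\<bar> + \<bar>b\<bar>) * D)\<^sup>2"
      using mult_right_mono[OF J1, of "((\<bar>a\<bar> + \<bar>b\<bar>) * D)\<^sup>2"] by (simp add: algebra_simps)
    finally show ?thesis .
  qed
  (* A step tau so small that the second-order terms are dominated by the first-order gain q tau. *)
  have small_ev: "\<exists>\<tau>>0. (\<bar>a\<bar> * \<tau> + \<bar>b\<bar> * \<tau>\<^sup>2 + \<tau>) * D \<le> 1 \<and> ((\<bar>a\<bar> * \<tau> + \<bar>b\<bar> * \<tau>\<^sup>2 + \<tau>) * D)\<^sup>2 + h * \<tau>\<^sup>2 \<le> q * \<tau>"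
    if "0 < q" for a b h q :: real
  proof -
    have "((\<lambda>\<tau>. (\<bar>a\<bar> * \<tau> + \<bar>b\<bar> * \<tau>\<^sup>2 + \<tau>) * D) \<longlongrightarrow> (\<bar>a\<bar> * 0 + \<bar>b\<bar> * 0\<^sup>2 + 0) * D) (at_right 0)"
      by (intro tendsto_intros)
    then have 1: "\<forall>\<^sub>F \<tau> in at_right 0. (\<bar>a\<bar> * \<tau> + \<bar>b\<bar> * \<tau>\<^sup>2 + \<tau>) * D < 1"
      by (rule order_tendstoD) simp
    have "((\<lambda>\<tau>. ((\<bar>a\<bar> + \<bar>b\<bar> * \<tau> + 1) * D)\<^sup>2 * \<tau> + h * \<tau>) \<longlongrightarrow> ((\<bar>a\<bar> + \<bar>b\<bar> * 0 + 1) * D)\<^sup>2 * 0 + h * 0) (at_right 0)"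
      by (intro tendsto_intros)
    then have 2: "\<forall>\<^sub>F \<tau> in at_right 0. ((\<bar>a\<bar> + \<bar>b\<bar> * \<tau> + 1) * D)\<^sup>2 * \<tau> + h * \<tau> < q"
      by (rule order_tendstoD) (use that in simp)
    have "\<forall>\<^sub>F \<tau> in at_right (0::real). 0 < \<tau>" by (simp add: eventually_at_right_less)
    with 1 2 have "\<forall>\<^sub>F \<tau> in at_right 0. 0 < \<tau> \<and> (\<bar>a\<bar> * \<tau> + \<bar>b\<bar> * \<tau>\<^sup>2 + \<tau>) * D < 1
      \<and> ((\<bar>a\<bar> + \<bar>b\<bar> * \<tau> + 1) * D)\<^sup>2 * \<tau> + h * \<tau> < q" by eventually_elim auto
    then obtain \<tau> where t: "0 < \<tau>" "(\<bar>a\<bar> * \<tau> + \<bar>b\<bar> * \<tau>\<^sup>2 + \<tau>) * D < 1"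
      "((\<bar>a\<bar> + \<bar>b\<bar> * \<tau> + 1) * D)\<^sup>2 * \<tau> + h * \<tau> < q"
      using eventually_happens trivial_limit_at_right_real by blast
    have "((\<bar>a\<bar> * \<tau> + \<bar>b\<bar> * \<tau>\<^sup>2 + \<tau>) * D)\<^sup>2 + h * \<tau>\<^sup>2 = (((\<bar>a\<bar> + \<bar>b\<bar> * \<tau> + 1) * D)\<^sup>2 * \<tau> + h * \<tau>) * \<tau>"
      by (simp add: power2_eq_square algebra_simps)
    also have "\<dots> \<le> q * \<tau>" using t by (intro mult_right_mono) auto
    finally show ?thesis using t by (intro exI[of _ \<tau>]) auto
  qed
  have P_pos: "0 < P"
  proof -
    define d where "d = exp (c * 0 - (\<bar>c\<bar> + \<bar>k\<bar>) * D) * s"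
    have "d > 0" using sL by (simp add: d_def)
    have "p * d = expectation (\<lambda>\<omega>. indicator A \<omega> * d)" by (simp add: p_def)
    also have "\<dots> \<le> P" unfolding P_def
    proof (intro integral_mono intS)
      fix \<omega> assume om: "\<omega> \<in> space M"
      show "indicator A \<omega> * d \<le> U c k L \<omega> * S \<omega>"
      proof (cases "\<omega> \<in> A")
        case True
        then have a: "s \<le> S \<omega>" "S \<omega> \<le> L0" "\<bar>X \<omega>\<bar> \<le> L0" by (auto simp: A_def)
        then have U: "U c k L \<omega> = exp (c * S \<omega> + k * (X \<omega> - w * S \<omega>))" using L(1) by (simp add: U_exp)
        then have "U c k L \<omega> \<noteq> 0" by simp
        from supp[OF this om] have "\<bar>c * S \<omega>\<bar> \<le> \<bar>c\<bar> * D" "\<bar>k * (X \<omega> - w * S \<omega>)\<bar> \<le> \<bar>k\<bar> * D"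
          using nonneg[OF om] by (auto simp: abs_mult intro!: mult_left_mono)
        then have "c * 0 - (\<bar>c\<bar> + \<bar>k\<bar>) * D \<le> c * S \<omega> + k * (X \<omega> - w * S \<omega>)" by (simp add: algebra_simps)
        then show ?thesis using True a sL unfolding d_def U by (auto intro!: mult_mono)
      qed (use U_nonneg nonneg om in auto)
    next
      show "integrable M (\<lambda>\<omega>. indicator A \<omega> * d)"
        using \<open>0 < d\<close> by (intro integrable_bounded_on[of _ d]) (auto simp: indicator_def)
    qed
    finally show ?thesis using \<open>0 < d\<close> p_pos by (metis less_le_trans mult_pos_pos)
  qed
  have J_one: "J c k L = 1"
  proof (rule ccontr)
    assume "J c k L \<noteq> 1"
    then have lt: "J c k L < 1" using J1 by simp
    have "((\<lambda>a. J c k L + a * P + (a * D)\<^sup>2) \<longlongrightarrow> J c k L + 0 * P + (0 * D)\<^sup>2) (at_right 0)"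
      by (intro tendsto_intros)
    then have 1: "\<forall>\<^sub>F a in at_right 0. J c k L + a * P + (a * D)\<^sup>2 < 1"
      by (rule order_tendstoD) (use lt in simp)
    have "((\<lambda>a. a * D) \<longlongrightarrow> 0 * D) (at_right 0)" by (intro tendsto_intros)
    then have 2: "\<forall>\<^sub>F a in at_right 0. a * D < 1" by (rule order_tendstoD) simp
    have "\<forall>\<^sub>F a in at_right (0::real). 0 < a" by (simp add: eventually_at_right_less)
    with 1 2 have "\<forall>\<^sub>F a in at_right 0. 0 < a \<and> J c k L + a * P + (a * D)\<^sup>2 < 1 \<and> a * D < 1" by eventually_elim auto
    then obtain a where a: "0 < a" "J c k L + a * P + (a * D)\<^sup>2 < 1" "a * D < 1"
      using eventually_happens trivial_limit_at_right_real by blast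
    then have "J (c + a) (k + 0) L \<le> 1" using expand[of a 0] by simp
    from max[OF this] a show False by simp
  qed
  have lagrange: "Q + 2 * \<epsilon> * k * P = 0"
  proof (rule ccontr)
    assume ne: "Q + 2 * \<epsilon> * k * P \<noteq> 0"
    define h where "h = (\<epsilon> + 1) * P"
    obtain \<tau> where t: "0 < \<tau>" "(\<bar>2 * \<epsilon> * k\<bar> * \<tau> + \<bar>\<epsilon> + 1\<bar> * \<tau>\<^sup>2 + \<tau>) * D \<le> 1"
       "((\<bar>2 * \<epsilon> * k\<bar> * \<tau> + \<bar>\<epsilon> + 1\<bar> * \<tau>\<^sup>2 + \<tau>) * D)\<^sup>2 + h * \<tau>\<^sup>2 \<le> \<bar>Q + 2 * \<epsilon> * k * P\<bar> * \<tau>"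
      using small_ev[of "\<bar>Q + 2 * \<epsilon> * k * P\<bar>" "2 * \<epsilon> * k" "\<epsilon> + 1" h] ne by auto
    define b where "b = - sgn (Q + 2 * \<epsilon> * k * P) * \<tau>"
    (* The step b goes against the sign of Q + 2 eps k P, which makes the constraint slack; the
       increment a is chosen just large enough (by b^2) to increase the penalised objective. *)
    define a where "a = 2 * \<epsilon> * k * b + (\<epsilon> + 1) * b\<^sup>2"
    have b: "\<bar>b\<bar> = \<tau>" "b\<^sup>2 = \<tau>\<^sup>2" using ne t by (auto simp: b_def abs_mult power_mult_distrib sgn_if)
    have ab: "\<bar>a\<bar> + \<bar>b\<bar> \<le> \<bar>2 * \<epsilon> * k\<bar> * \<tau> + \<bar>\<epsilon> + 1\<bar> * \<tau>\<^sup>2 + \<tau>"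
    proof -
      have "\<bar>a\<bar> \<le> \<bar>2 * \<epsilon> * k * b\<bar> + \<bar>(\<epsilon> + 1) * b\<^sup>2\<bar>" unfolding a_def by (rule abs_triangle_ineq)
      also have "\<dots> = \<bar>2 * \<epsilon> * k\<bar> * \<tau> + \<bar>\<epsilon> + 1\<bar> * \<tau>\<^sup>2" using b by (simp add: abs_mult)
      finally show ?thesis using b by simp
    qed
    then have abD: "(\<bar>a\<bar> + \<bar>b\<bar>) * D \<le> (\<bar>2 * \<epsilon> * k\<bar> * \<tau> + \<bar>\<epsilon> + 1\<bar> * \<tau>\<^sup>2 + \<tau>) * D" using D0 by (rule mult_right_mono)
    have "b * (Q + 2 * \<epsilon> * k * P) = - (\<bar>Q + 2 * \<epsilon> * k * P\<bar> * \<tau>)" by (simp add: b_def abs_sgn mult.commute)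
    moreover have "a * P + b * Q = b * (Q + 2 * \<epsilon> * k * P) + h * \<tau>\<^sup>2" unfolding a_def h_def b(2)[symmetric] by (simp add: algebra_simps)
    moreover have "((\<bar>a\<bar> + \<bar>b\<bar>) * D)\<^sup>2 \<le> ((\<bar>2 * \<epsilon> * k\<bar> * \<tau> + \<bar>\<epsilon> + 1\<bar> * \<tau>\<^sup>2 + \<tau>) * D)\<^sup>2"
      using abD D0 by (intro power_mono) auto
    moreover have "J (c + a) (k + b) L \<le> J c k L + a * P + b * Q + ((\<bar>a\<bar> + \<bar>b\<bar>) * D)\<^sup>2"
      using abD t by (intro expand) linarith
    ultimately have "J (c + a) (k + b) L \<le> 1" using J1 t(3) by linarith
    from max[OF this] have "b\<^sup>2 \<le> 0" by (simp add: a_def algebra_simps)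
    with b t show False by simp
  qed
  have Q: "Q = - (2 * \<epsilon> * k) * P" using lagrange by (simp add: eq_neg_iff_add_eq_0)
  have EX: "expectation (\<lambda>\<omega>. U c k L \<omega> * X \<omega>) = (w - 2 * \<epsilon> * k) * P"
  proof -
    have "expectation (\<lambda>\<omega>. U c k L \<omega> * X \<omega>) = expectation (\<lambda>\<omega>. U c k L \<omega> * (X \<omega> - w * S \<omega>) + w * (U c k L \<omega> * S \<omega>))"
      by (intro Bochner_Integration.integral_cong) (auto simp: algebra_simps)
    also have "\<dots> = Q + w * P" using intS intY by (simp add: P_def Q_def)
    finally show ?thesis by (simp add: Q algebra_simps)
  qed
  show ?thesis
  proof (rule that[of "w - 2 * \<epsilon> * k" "c - k * w" k L])
    have "0 \<le> \<epsilon> * k\<^sup>2" using eps by simp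
    then have "0 \<le> c - \<epsilon>/2 * k\<^sup>2" using v0 by (simp; linarith)
    then have "c - \<epsilon>/2 * k\<^sup>2 < \<beta>" by (rule L2[OF L(3) J1])
    then have ek: "\<epsilon> * k\<^sup>2 < 2 * \<beta>" using v0 by (simp add: algebra_simps)
    have "(2 * \<epsilon> * k)\<^sup>2 = 4 * \<epsilon> * (\<epsilon> * k\<^sup>2)" by (simp add: power2_eq_square)
    also have "\<dots> < 4 * \<epsilon> * (2 * \<beta>)" using ek eps by (intro mult_strict_left_mono) auto
    also have "\<dots> = \<delta>\<^sup>2 / 2" using beta_pos by (simp add: \<epsilon>_def)
    also have "\<dots> \<le> \<delta>\<^sup>2" by simp
    finally have "\<bar>2 * \<epsilon> * k\<bar> < \<delta>" using pos by (metis abs_le_square_iff abs_of_pos not_le)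
    then show "\<bar>w - 2 * \<epsilon> * k - w\<bar> < \<delta>" by simp
    have "c - \<epsilon> * k\<^sup>2 < \<beta>" by (intro L1(2)[OF L(2) J1] v0)
    moreover have "0 \<le> \<epsilon> * k\<^sup>2" using eps by simp
    ultimately show "c - k * w + k * (w - 2 * \<epsilon> * k) \<le> \<alpha> + \<eta>"
      unfolding \<beta>_def by (simp add: algebra_simps power2_eq_square)
  qed (use J_one P_pos EX in \<open>simp_all add: J_def U_def[abs_def] P_def\<close>)
qed

text \<open>
  As \<open>\<zeta>\<close> tends to \<open>- \<infinity>\<close> the truncated mass tends to at most \<open>P (S = 0) < 1\<close>, because \<open>X\<close> vanishes where \<open>S\<close>
  does; a large truncation level keeps the mass at the given \<open>\<zeta>\<close> above \<open>1\<close>. In between it equals \<open>1\<close>.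
\<close>

lemma (in prob_space) exists_tilt_exponent:
  fixes S X :: "'a \<Rightarrow> real"
  assumes [measurable]: "S \<in> borel_measurable M" "X \<in> borel_measurable M"
    and nonneg: "\<And>\<omega>. \<omega> \<in> space M \<Longrightarrow> 0 \<le> S \<omega>"
    and zero: "\<And>\<omega>. \<omega> \<in> space M \<Longrightarrow> S \<omega> = 0 \<Longrightarrow> X \<omega> = 0"
    and nz: "prob {\<omega> \<in> space M. S \<omega> = 0} < 1"
    and gt: "1 < (\<integral>\<^sup>+\<omega>. ennreal (exp (\<zeta> * S \<omega> + k * X \<omega>)) \<partial>M)"
  obtains \<zeta>' L where "\<zeta>' \<le> \<zeta>"
    "expectation (\<lambda>\<omega>. tilt \<zeta>' k L (S \<omega>) (X \<omega>)) = 1"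
    "0 < expectation (\<lambda>\<omega>. tilt \<zeta>' k L (S \<omega>) (X \<omega>) * S \<omega>)"
proof -
  define G where "G L z = expectation (\<lambda>\<omega>. tilt z k L (S \<omega>) (X \<omega>))" for L z
  have int: "integrable M (\<lambda>\<omega>. tilt z k L (S \<omega>) (X \<omega>))" for z L
    by (rule integrable_bounded_on[where C = "exp (\<bar>z\<bar> * \<bar>L\<bar> + \<bar>k\<bar> * \<bar>L\<bar>)"])
      (use tilt_le_bound nonneg in auto)
  have G_nn: "(\<integral>\<^sup>+\<omega>. ennreal (tilt z k L (S \<omega>) (X \<omega>)) \<partial>M) = ennreal (G L z)" for z L
    unfolding G_def by (intro nn_integral_eq_integral int AE_I2 tilt_nonneg)
  have dominated: "(\<lambda>n. G L (z n)) \<longlonglongrightarrow> expectation h"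
    if bound: "\<And>n. z n \<le> b" and h [measurable]: "h \<in> borel_measurable M"
      and lim: "\<And>\<omega>. \<omega> \<in> space M \<Longrightarrow> (\<lambda>n. tilt (z n) k L (S \<omega>) (X \<omega>)) \<longlonglongrightarrow> h \<omega>"
    for z :: "nat \<Rightarrow> real" and b h L
    unfolding G_def
  proof (rule integral_dominated_convergence[where w = "\<lambda>_. exp (\<bar>b\<bar> * \<bar>L\<bar> + \<bar>k\<bar> * \<bar>L\<bar>)"])
    fix n show "AE \<omega> in M. norm (tilt (z n) k L (S \<omega>) (X \<omega>)) \<le> exp (\<bar>b\<bar> * \<bar>L\<bar> + \<bar>k\<bar> * \<bar>L\<bar>)"
    proof (rule AE_I2)
      fix \<omega> assume om: "\<omega> \<in> space M"
      have "tilt (z n) k L (S \<omega>) (X \<omega>) \<le> tilt b k L (S \<omega>) (X \<omega>)"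
        using bound[of n] nonneg[OF om] by (auto simp: tilt_def intro: mult_right_mono)
      also have "\<dots> \<le> exp (\<bar>b\<bar> * \<bar>L\<bar> + \<bar>k\<bar> * \<bar>L\<bar>)" by (rule tilt_le_bound[OF nonneg[OF om]])
      finally show "norm (tilt (z n) k L (S \<omega>) (X \<omega>)) \<le> exp (\<bar>b\<bar> * \<bar>L\<bar> + \<bar>k\<bar> * \<bar>L\<bar>)" by simp
    qed
  qed (use lim in auto)
  have "\<exists>n::nat. 1 < G (real n) \<zeta>"
  proof (rule ccontr)
    assume "\<not> ?thesis"
    then have le: "G (real n) \<zeta> \<le> 1" for n by (simp add: not_less)
    have "(\<integral>\<^sup>+\<omega>. ennreal (exp (\<zeta> * S \<omega> + k * X \<omega>)) \<partial>M) \<le> 1"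
    proof (rule nn_integral_le_one_limit[where f = "\<lambda>n \<omega>. ennreal (tilt \<zeta> k (real n) (S \<omega>) (X \<omega>))"])
      fix \<omega>
      obtain N where N: "max (S \<omega>) \<bar>X \<omega>\<bar> < real N" using reals_Archimedean2 by blast
      have "\<forall>\<^sub>F n in sequentially. ennreal (exp (\<zeta> * S \<omega> + k * X \<omega>)) = ennreal (tilt \<zeta> k (real n) (S \<omega>) (X \<omega>))"
        using eventually_ge_at_top[of N] by eventually_elim (use N in \<open>auto simp: tilt_def\<close>)
      then show "(\<lambda>n. ennreal (tilt \<zeta> k (real n) (S \<omega>) (X \<omega>))) \<longlonglongrightarrow> ennreal (exp (\<zeta> * S \<omega> + k * X \<omega>))"
        by (rule Lim_transform_eventually[OF tendsto_const])
    next
      fix n :: nat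
      show "(\<integral>\<^sup>+\<omega>. ennreal (tilt \<zeta> k (real n) (S \<omega>) (X \<omega>)) \<partial>M) \<le> 1"
        unfolding G_nn using le[of n] by simp
    qed measurable
    with gt show False by simp
  qed
  then obtain L where L: "1 < G L \<zeta>" by blast
  have h_le: "expectation (indicator {\<omega> \<in> space M. S \<omega> = 0}) = prob {\<omega> \<in> space M. S \<omega> = 0}"
    by simp
  have "(\<lambda>n. G L (\<zeta> - real n)) \<longlonglongrightarrow> expectation (\<lambda>\<omega>. if S \<omega> = 0 \<and> 0 \<le> L then 1 else 0)"
  proof (rule dominated[of _ \<zeta>])
    fix \<omega> assume om: "\<omega> \<in> space M"
    show "(\<lambda>n. tilt (\<zeta> - real n) k L (S \<omega>) (X \<omega>)) \<longlonglongrightarrow> (if S \<omega> = 0 \<and> 0 \<le> L then 1 else 0)"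
    proof (cases "S \<omega> = 0")
      case True then show ?thesis using zero[OF om] by (simp add: tilt_def)
    next
      case False
      then have pos: "0 < S \<omega>" using nonneg[OF om] by simp
      have "filterlim (\<lambda>n. S \<omega> * real n) at_top sequentially"
        by (intro filterlim_tendsto_pos_mult_at_top[OF tendsto_const pos filterlim_real_sequentially])
      then have "filterlim (\<lambda>n. - (\<zeta> * S \<omega> + k * X \<omega>) + S \<omega> * real n) at_top sequentially"
        by (rule filterlim_tendsto_add_at_top[OF tendsto_const])
      then have "filterlim (\<lambda>n. - (- (\<zeta> * S \<omega> + k * X \<omega>) + S \<omega> * real n)) at_bot sequentially"
        unfolding filterlim_uminus_at_bot minus_minus .
      then have "(\<lambda>n. exp (- (- (\<zeta> * S \<omega> + k * X \<omega>) + S \<omega> * real n))) \<longlonglongrightarrow> 0"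
        by (rule filterlim_compose[OF exp_at_bot])
      then have "(\<lambda>n. exp ((\<zeta> - real n) * S \<omega> + k * X \<omega>)) \<longlonglongrightarrow> 0" by (simp add: algebra_simps)
      then show ?thesis using False
        unfolding tilt_def by (cases "S \<omega> \<le> L \<and> \<bar>X \<omega>\<bar> \<le> L") auto
    qed
  qed auto
  moreover have "expectation (\<lambda>\<omega>. if S \<omega> = 0 \<and> 0 \<le> L then 1 else 0 :: real) < 1"
  proof -
    have "expectation (\<lambda>\<omega>. if S \<omega> = 0 \<and> 0 \<le> L then 1 else 0 :: real) \<le> expectation (indicator {\<omega> \<in> space M. S \<omega> = 0})"
      by (intro integral_mono integrable_bounded_on[of _ 1]) (auto simp: indicator_def)
    with h_le nz show ?thesis by simp
  qed
  ultimately have "\<forall>\<^sub>F n in sequentially. G L (\<zeta> - real n) < 1" by (rule order_tendstoD(2))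
  then obtain n where n: "G L (\<zeta> - real n) < 1" by (meson eventually_sequentially order_refl)
  have "continuous_on {\<zeta> - real n..\<zeta>} (G L)"
    unfolding continuous_on_sequentially comp_def
  proof (intro ballI allI impI, elim conjE)
    fix x a assume "a \<in> {\<zeta> - real n..\<zeta>}" and a: "\<forall>i. x i \<in> {\<zeta> - real n..\<zeta>}" "x \<longlonglongrightarrow> a"
    show "(\<lambda>n. G L (x n)) \<longlonglongrightarrow> G L a"
      unfolding G_def[of L a]
    proof (rule dominated[of _ \<zeta>])
      fix \<omega> show "(\<lambda>n. tilt (x n) k L (S \<omega>) (X \<omega>)) \<longlonglongrightarrow> tilt a k L (S \<omega>) (X \<omega>)"
        unfolding tilt_def by (cases "S \<omega> \<le> L \<and> \<bar>X \<omega>\<bar> \<le> L") (auto intro!: tendsto_intros a(2))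
    qed (use a(1) in auto)
  qed
  then obtain z where z: "\<zeta> - real n \<le> z" "z \<le> \<zeta>" "G L z = 1"
    using IVT'[of "G L" "\<zeta> - real n" 1 \<zeta>] n L by auto
  show ?thesis
  proof (rule that[OF z(2)])
    show "expectation (\<lambda>\<omega>. tilt z k L (S \<omega>) (X \<omega>)) = 1" using z(3) by (simp add: G_def)
    have intS: "integrable M (\<lambda>\<omega>. tilt z k L (S \<omega>) (X \<omega>) * S \<omega>)"
    proof (rule integrable_bounded_on)
      fix \<omega> assume om: "\<omega> \<in> space M"
      have "tilt z k L (S \<omega>) (X \<omega>) * S \<omega> \<le> exp (\<bar>z\<bar> * \<bar>L\<bar> + \<bar>k\<bar> * \<bar>L\<bar>) * \<bar>L\<bar>"
      proof (cases "S \<omega> \<le> L")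
        case True then show ?thesis using nonneg[OF om] by (intro mult_mono tilt_le_bound) auto
      qed (simp add: tilt_def)
      then show "\<bar>tilt z k L (S \<omega>) (X \<omega>) * S \<omega>\<bar> \<le> exp (\<bar>z\<bar> * \<bar>L\<bar> + \<bar>k\<bar> * \<bar>L\<bar>) * \<bar>L\<bar>"
        using nonneg[OF om] by (simp add: abs_mult)
    qed measurable
    show "0 < expectation (\<lambda>\<omega>. tilt z k L (S \<omega>) (X \<omega>) * S \<omega>)"
    proof (rule ccontr)
      assume "\<not> ?thesis"
      moreover have "0 \<le> expectation (\<lambda>\<omega>. tilt z k L (S \<omega>) (X \<omega>) * S \<omega>)"
        using nonneg by (intro integral_nonneg_AE) auto
      ultimately have "expectation (\<lambda>\<omega>. tilt z k L (S \<omega>) (X \<omega>) * S \<omega>) = 0" by simp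
      then have "AE \<omega> in M. tilt z k L (S \<omega>) (X \<omega>) * S \<omega> = 0"
        using nonneg by (subst (asm) integral_nonneg_eq_0_iff_AE[OF intS]) auto
      then have "AE \<omega> in M. tilt z k L (S \<omega>) (X \<omega>) \<le> indicator {\<omega> \<in> space M. S \<omega> = 0} \<omega>"
        using AE_space
      proof eventually_elim
        case (elim \<omega>)
        then show ?case using zero[of \<omega>] by (auto simp: tilt_def indicator_def)
      qed
      then have "G L z \<le> expectation (indicator {\<omega> \<in> space M. S \<omega> = 0})"
        unfolding G_def by (intro integral_mono_AE int integrable_bounded_on[of _ 1]) (auto simp: indicator_def)
      with h_le nz z(3) show False by simp
    qed
  qed
qed

section \<open>Renewal-reward processes under a change of measure\<close>

locale renewal_reward = prob_space M
  (* All that matters about the total reward F is that it lies between the rewards of the cycles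
     completed by time t and those of any larger number of cycles not completed by then. *)
  for M :: "'a measure" and S X :: "nat \<Rightarrow> 'a \<Rightarrow> real" and F :: "real \<Rightarrow> 'a \<Rightarrow> real" +
  assumes pair_indep: "indep_vars (\<lambda>_. borel \<Otimes>\<^sub>M borel) (\<lambda>i \<omega>. (S i \<omega>, X i \<omega>)) {1..}"
    and pair_ident: "\<And>i. 1 \<le> i \<Longrightarrow> distr M (borel \<Otimes>\<^sub>M borel) (\<lambda>\<omega>. (S i \<omega>, X i \<omega>))
      = distr M (borel \<Otimes>\<^sub>M borel) (\<lambda>\<omega>. (S 1 \<omega>, X 1 \<omega>))"
    and S_nonneg: "\<And>i \<omega>. 1 \<le> i \<Longrightarrow> \<omega> \<in> space M \<Longrightarrow> 0 \<le> S i \<omega>"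
    and X_nonneg: "\<And>i \<omega>. 1 \<le> i \<Longrightarrow> \<omega> \<in> space M \<Longrightarrow> 0 \<le> X i \<omega>"
    and X_zero: "\<And>\<omega>. \<omega> \<in> space M \<Longrightarrow> S 1 \<omega> = 0 \<Longrightarrow> X 1 \<omega> = 0"
    and S_nonzero: "prob {\<omega> \<in> space M. S 1 \<omega> = 0} < 1"
    and F_measurable: "\<And>t. F t \<in> borel_measurable M"
    and F_bounds: "\<And>\<omega> t n N. \<omega> \<in> space M \<Longrightarrow> (\<Sum>i=1..n. S i \<omega>) \<le> t \<Longrightarrow> t < (\<Sum>i=1..N. S i \<omega>) \<Longrightarrow>
      (\<Sum>i=1..n. X i \<omega>) \<le> F t \<omega> \<and> F t \<omega> \<le> (\<Sum>i=1..N. X i \<omega>)"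
begin

lemma pair_measurable: "1 \<le> i \<Longrightarrow> (\<lambda>\<omega>. (S i \<omega>, X i \<omega>)) \<in> M \<rightarrow>\<^sub>M borel \<Otimes>\<^sub>M borel"
  using pair_indep by (auto simp: indep_vars_def)

lemma S_measurable: "1 \<le> i \<Longrightarrow> S i \<in> borel_measurable M"
  using measurable_compose[OF pair_measurable measurable_fst] by (simp add: comp_def)

lemma X_measurable: "1 \<le> i \<Longrightarrow> X i \<in> borel_measurable M"
  using measurable_compose[OF pair_measurable measurable_snd] by (simp add: comp_def)

lemma expectation_pair:
  fixes f :: "real \<Rightarrow> real \<Rightarrow> real"
  assumes f: "case_prod f \<in> borel_measurable (borel \<Otimes>\<^sub>M borel)" and i: "1 \<le> i"
  shows "expectation (\<lambda>\<omega>. f (S i \<omega>) (X i \<omega>)) = expectation (\<lambda>\<omega>. f (S 1 \<omega>) (X 1 \<omega>))"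
proof -
  have *: "expectation (\<lambda>\<omega>. f (S j \<omega>) (X j \<omega>)) = integral\<^sup>L (distr M (borel \<Otimes>\<^sub>M borel) (\<lambda>\<omega>. (S j \<omega>, X j \<omega>))) (case_prod f)"
    if "1 \<le> j" for j
    using integral_distr[OF pair_measurable[OF that] f] by simp
  show ?thesis using *[OF i] *[of 1] pair_ident[OF i] by simp
qed

lemma expectation_prod:
  fixes f :: "nat \<Rightarrow> real \<Rightarrow> real \<Rightarrow> real"
  assumes f: "\<And>i. case_prod (f i) \<in> borel_measurable (borel \<Otimes>\<^sub>M borel)"
    and bound: "\<And>i \<omega>. 1 \<le> i \<Longrightarrow> \<omega> \<in> space M \<Longrightarrow> \<bar>f i (S i \<omega>) (X i \<omega>)\<bar> \<le> C i"
  shows "expectation (\<lambda>\<omega>. \<Prod>i=1..N. f i (S i \<omega>) (X i \<omega>)) = (\<Prod>i=1..N. expectation (\<lambda>\<omega>. f i (S 1 \<omega>) (X 1 \<omega>)))"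
    and "integrable M (\<lambda>\<omega>. \<Prod>i=1..N. f i (S i \<omega>) (X i \<omega>))"
proof -
  have ind: "indep_vars (\<lambda>_. borel) (\<lambda>i \<omega>. f i (S i \<omega>) (X i \<omega>)) {1..N}"
    using indep_vars_compose2[OF indep_vars_subset[OF pair_indep, of "{1..N}"] f] by auto
  have int: "integrable M (\<lambda>\<omega>. f i (S i \<omega>) (X i \<omega>))" if "i \<in> {1..N}" for i
    using bound[of i] measurable_compose[OF pair_measurable f, of i i] that
    by (intro integrable_bounded_on[of _ "C i"]) auto
  show "expectation (\<lambda>\<omega>. \<Prod>i=1..N. f i (S i \<omega>) (X i \<omega>)) = (\<Prod>i=1..N. expectation (\<lambda>\<omega>. f i (S 1 \<omega>) (X 1 \<omega>)))"
    by (subst indep_vars_lebesgue_integral[OF _ ind int]) (auto intro!: prod.cong expectation_pair f)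
  show "integrable M (\<lambda>\<omega>. \<Prod>i=1..N. f i (S i \<omega>) (X i \<omega>))"
    by (rule indep_vars_integrable[OF _ ind int]) auto
qed

abbreviation tilted_mass :: "real \<Rightarrow> real \<Rightarrow> real \<Rightarrow> real" where
  "tilted_mass \<zeta> k L \<equiv> expectation (\<lambda>\<omega>. tilt \<zeta> k L (S 1 \<omega>) (X 1 \<omega>))"

abbreviation tilted_length :: "real \<Rightarrow> real \<Rightarrow> real \<Rightarrow> real" where
  "tilted_length \<zeta> k L \<equiv> expectation (\<lambda>\<omega>. tilt \<zeta> k L (S 1 \<omega>) (X 1 \<omega>) * S 1 \<omega>)"

abbreviation tilted_reward :: "real \<Rightarrow> real \<Rightarrow> real \<Rightarrow> real" where
  "tilted_reward \<zeta> k L \<equiv> expectation (\<lambda>\<omega>. tilt \<zeta> k L (S 1 \<omega>) (X 1 \<omega>) * X 1 \<omega>)"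

abbreviation weight :: "real \<Rightarrow> real \<Rightarrow> real \<Rightarrow> nat \<Rightarrow> 'a \<Rightarrow> real" where
  "weight \<zeta> k L N \<omega> \<equiv> (\<Prod>i=1..N. tilt \<zeta> k L (S i \<omega>) (X i \<omega>))"

lemma measurable_tilt_pair: "case_prod (tilt \<zeta> k L) \<in> borel_measurable (borel \<Otimes>\<^sub>M borel)"
  unfolding split_beta' by measurable

text \<open>
  An exponential bound takes the place of the law of large numbers under the tilted law: every factor
  \<open>tilt * exp (h (Y - \<epsilon>))\<close> has expectation at most \<open>\<rho> < 1\<close>, as \<open>Y\<close> is bounded and centred under the tilt.
  The weight runs over \<open>N\<close> cycles while the deviation concerns only the first \<open>n\<close>; the superfluous
  factors integrate to \<open>1\<close>.
\<close>

lemma chernoff: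
  fixes Y :: "real \<Rightarrow> real \<Rightarrow> real"
  assumes Y: "case_prod Y \<in> borel_measurable (borel \<Otimes>\<^sub>M borel)"
    and Y_bound: "\<And>s x. 0 \<le> s \<Longrightarrow> s \<le> L \<Longrightarrow> \<bar>x\<bar> \<le> L \<Longrightarrow> \<bar>Y s x\<bar> \<le> D"
    and tilt_one: "tilted_mass \<zeta> k L = 1"
    and centred: "expectation (\<lambda>\<omega>. tilt \<zeta> k L (S 1 \<omega>) (X 1 \<omega>) * Y (S 1 \<omega>) (X 1 \<omega>)) = 0"
    and eps: "0 < \<epsilon>"
  obtains \<rho> where "0 < \<rho>" "\<rho> < 1"
    "\<And>n N. n \<le> N \<Longrightarrow> expectation (\<lambda>\<omega>. weight \<zeta> k L N \<omega> *
       of_bool (\<epsilon> * n \<le> (\<Sum>i=1..n. Y (S i \<omega>) (X i \<omega>)))) \<le> \<rho> ^ n"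
proof -
  define E where "E = 1 + \<bar>D\<bar>"
  have E: "1 \<le> E" "D \<le> E" by (auto simp: E_def)
  (* Small enough for the quadratic expansion to apply and for the linear term h eps to win. *)
  define h where "h = min (1 / E) (\<epsilon> / (2 * E\<^sup>2))"
  have h_pos: "0 < h" using E eps by (simp add: h_def)
  have hE: "h * E \<le> 1" using E by (simp add: h_def min_def field_simps)
  have "h * E\<^sup>2 \<le> \<epsilon> / (2 * E\<^sup>2) * E\<^sup>2" by (intro mult_right_mono) (auto simp: h_def)
  also have "\<dots> < \<epsilon>" using E eps by simp
  finally have hE2: "h * E\<^sup>2 < \<epsilon>" .
  define \<rho> where "\<rho> = exp (h * (h * E\<^sup>2 - \<epsilon>))"
  have rho: "0 < \<rho>" "\<rho> < 1" using h_pos hE2 by (auto simp: \<rho>_def mult_less_0_iff)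
  define T where "T = exp (\<bar>\<zeta>\<bar> * \<bar>L\<bar> + \<bar>k\<bar> * \<bar>L\<bar>)"
  have T: "tilt \<zeta> k L s x \<le> T" if "0 \<le> s" for s x unfolding T_def by (rule tilt_le_bound[OF that])
  have T_pos: "0 < T" by (simp add: T_def)
  define g where "g s x = tilt \<zeta> k L s x * exp (h * (Y s x - \<epsilon>))" for s x
  have g_meas: "case_prod g \<in> borel_measurable (borel \<Otimes>\<^sub>M borel)"
    using Y measurable_tilt_pair[of \<zeta> k L] unfolding g_def split_beta' by measurable
  have g_nonneg: "0 \<le> g s x" for s x by (simp add: g_def)
  have g_bound: "\<bar>g s x\<bar> \<le> T * exp 1" if "0 \<le> s" for s x
  proof (cases "s \<le> L \<and> \<bar>x\<bar> \<le> L")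
    case True
    have "h * (Y s x - \<epsilon>) \<le> h * E" using Y_bound[of s x] True that E eps h_pos by (intro mult_left_mono) auto
    then have "exp (h * (Y s x - \<epsilon>)) \<le> exp 1" using hE by simp
    then show ?thesis unfolding g_def using T[OF that, of x] T_pos by (simp add: abs_mult) (intro mult_mono; simp)
  qed (use T_pos in \<open>auto simp: g_def tilt_def\<close>)
  have S1: "\<omega> \<in> space M \<Longrightarrow> 0 \<le> S 1 \<omega>" for \<omega> using S_nonneg[of 1] by simp
  have [measurable]: "S 1 \<in> borel_measurable M" "X 1 \<in> borel_measurable M" using S_measurable[of 1] X_measurable[of 1] by auto
  have Y1 [measurable]: "(\<lambda>\<omega>. Y (S 1 \<omega>) (X 1 \<omega>)) \<in> borel_measurable M"
    using measurable_compose[OF pair_measurable[of 1] Y] by simp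
  have int_tilt: "integrable M (\<lambda>\<omega>. tilt \<zeta> k L (S 1 \<omega>) (X 1 \<omega>))"
    using T S1 by (intro integrable_bounded_on[of _ T]) (auto)
  have int_Y: "integrable M (\<lambda>\<omega>. tilt \<zeta> k L (S 1 \<omega>) (X 1 \<omega>) * Y (S 1 \<omega>) (X 1 \<omega>))"
  proof (rule integrable_bounded_on[of _ "T * E"])
    fix \<omega> assume om: "\<omega> \<in> space M"
    show "\<bar>tilt \<zeta> k L (S 1 \<omega>) (X 1 \<omega>) * Y (S 1 \<omega>) (X 1 \<omega>)\<bar> \<le> T * E"
    proof (cases "S 1 \<omega> \<le> L \<and> \<bar>X 1 \<omega>\<bar> \<le> L")
      case True
      then show ?thesis using Y_bound[of "S 1 \<omega>" "X 1 \<omega>"] T[OF S1[OF om], of "X 1 \<omega>"] S1[OF om] E T_pos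
        by (simp add: abs_mult) (intro mult_mono; simp)
    qed (use T_pos E in \<open>auto simp: tilt_def\<close>)
  qed measurable
  have g_le: "expectation (\<lambda>\<omega>. g (S 1 \<omega>) (X 1 \<omega>)) \<le> \<rho>"
  proof -
    have int_g: "integrable M (\<lambda>\<omega>. g (S 1 \<omega>) (X 1 \<omega>))"
      using g_bound S1 measurable_compose[OF pair_measurable[of 1] g_meas]
      by (intro integrable_bounded_on[of _ "T * exp 1"]) (auto)
    have "expectation (\<lambda>\<omega>. g (S 1 \<omega>) (X 1 \<omega>)) \<le> expectation (\<lambda>\<omega>. exp (- (h * \<epsilon>)) *
        (tilt \<zeta> k L (S 1 \<omega>) (X 1 \<omega>) * (1 + (h * E)\<^sup>2) + h * (tilt \<zeta> k L (S 1 \<omega>) (X 1 \<omega>) * Y (S 1 \<omega>) (X 1 \<omega>))))"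
    proof (intro integral_mono int_g integrable_mult_right integrable_mult_left Bochner_Integration.integrable_add int_tilt int_Y)
      fix \<omega> assume om: "\<omega> \<in> space M"
      let ?t = "tilt \<zeta> k L (S 1 \<omega>) (X 1 \<omega>)" and ?y = "Y (S 1 \<omega>) (X 1 \<omega>)"
      have "?t * exp (h * ?y) \<le> ?t * (1 + (h * E)\<^sup>2 + h * ?y)"
      proof (cases "?t = 0")
        case False
        then have "S 1 \<omega> \<le> L" "\<bar>X 1 \<omega>\<bar> \<le> L" by (auto simp: tilt_def split: if_splits)
        then have "\<bar>?y\<bar> \<le> E" using Y_bound S1[OF om] E by force
        then have y: "\<bar>h * ?y\<bar> \<le> h * E" using h_pos by (simp add: abs_mult)
        then have "(h * ?y)\<^sup>2 \<le> (h * E)\<^sup>2" using power_mono[OF y, of 2] by simp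
        moreover have "exp (h * ?y) \<le> 1 + h * ?y + (h * ?y)\<^sup>2" using y hE by (intro exp_le_quadratic) simp
        ultimately have "exp (h * ?y) \<le> 1 + (h * E)\<^sup>2 + h * ?y" by linarith
        then show ?thesis by (intro mult_left_mono) auto
      qed simp
      then have "exp (- (h * \<epsilon>)) * (?t * exp (h * ?y)) \<le> exp (- (h * \<epsilon>)) * (?t * (1 + (h * E)\<^sup>2 + h * ?y))"
        by (rule mult_left_mono) simp
      moreover have "g (S 1 \<omega>) (X 1 \<omega>) = exp (- (h * \<epsilon>)) * (?t * exp (h * ?y))"
        by (simp add: g_def algebra_simps exp_diff exp_minus field_simps)
      ultimately show "g (S 1 \<omega>) (X 1 \<omega>) \<le> exp (- (h * \<epsilon>)) * (?t * (1 + (h * E)\<^sup>2) + h * (?t * ?y))"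
        by (simp add: algebra_simps)
    qed
    also have "\<dots> = exp (- (h * \<epsilon>)) * (1 + (h * E)\<^sup>2)"
      using int_tilt int_Y by (simp add: tilt_one centred)
    also have "\<dots> \<le> exp (- (h * \<epsilon>)) * exp ((h * E)\<^sup>2)"
      by (intro mult_left_mono exp_ge_add_one_self) auto
    also have "\<dots> = \<rho>" by (simp add: \<rho>_def exp_add[symmetric] power2_eq_square algebra_simps)
    finally show ?thesis .
  qed
  show ?thesis
  proof (rule that[OF rho])
    fix n N :: nat assume nN: "n \<le> N"
    define f where "f i = (if i \<le> n then g else tilt \<zeta> k L)" for i :: nat
    have f_meas: "case_prod (f i) \<in> borel_measurable (borel \<Otimes>\<^sub>M borel)" for i
      using g_meas measurable_tilt_pair by (auto simp: f_def)
    have f_bound: "\<bar>f i (S i \<omega>) (X i \<omega>)\<bar> \<le> max T (T * exp 1)" if "1 \<le> i" "\<omega> \<in> space M" for i \<omega>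
      using g_bound[OF S_nonneg[OF that], of "X i \<omega>"] T[OF S_nonneg[OF that], of "X i \<omega>"] by (auto simp: f_def)
    have split: "(\<Prod>i=1..N. if i \<le> n then a i else 1) = (\<Prod>i=1..n. a i)" for a :: "nat \<Rightarrow> real"
      using nN by (intro prod.mono_neutral_cong_right) auto
    have "expectation (\<lambda>\<omega>. weight \<zeta> k L N \<omega> *
       of_bool (\<epsilon> * n \<le> (\<Sum>i=1..n. Y (S i \<omega>) (X i \<omega>)))) \<le> expectation (\<lambda>\<omega>. \<Prod>i=1..N. f i (S i \<omega>) (X i \<omega>))"
    proof (rule integral_mono_AE', rule expectation_prod(2)[OF f_meas f_bound], goal_cases)
      case 3
      show ?case
      proof (rule AE_I2)
        fix \<omega> assume om: "\<omega> \<in> space M"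
        let ?y = "\<lambda>i. Y (S i \<omega>) (X i \<omega>)"
        have "(\<Prod>i=1..N. f i (S i \<omega>) (X i \<omega>)) = (\<Prod>i=1..N. tilt \<zeta> k L (S i \<omega>) (X i \<omega>) * (if i \<le> n then exp (h * (?y i - \<epsilon>)) else 1))"
          by (intro prod.cong) (auto simp: f_def g_def)
        also have "\<dots> = weight \<zeta> k L N \<omega> * exp (h * ((\<Sum>i=1..n. ?y i) - \<epsilon> * n))"
          by (simp add: prod.distrib split exp_sum[symmetric] sum_distrib_left[symmetric] sum_subtractf mult.commute)
        finally have eq: "(\<Prod>i=1..N. f i (S i \<omega>) (X i \<omega>)) = weight \<zeta> k L N \<omega> * exp (h * ((\<Sum>i=1..n. ?y i) - \<epsilon> * n))" .
        show "weight \<zeta> k L N \<omega> * of_bool (\<epsilon> * n \<le> (\<Sum>i=1..n. ?y i)) \<le> (\<Prod>i=1..N. f i (S i \<omega>) (X i \<omega>))"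
          unfolding eq using h_pos by (intro mult_left_mono prod_nonneg) auto
      qed
    next
      case 4 show ?case by (intro AE_I2 mult_nonneg_nonneg prod_nonneg) (auto simp: f_def g_nonneg)
    qed
    also have "\<dots> = (\<Prod>i=1..N. if i \<le> n then expectation (\<lambda>\<omega>. g (S 1 \<omega>) (X 1 \<omega>)) else 1)"
      by (subst expectation_prod(1)[OF f_meas f_bound]) (auto intro!: prod.cong simp: f_def tilt_one)
    also have "\<dots> = expectation (\<lambda>\<omega>. g (S 1 \<omega>) (X 1 \<omega>)) ^ n" by (simp add: split)
    also have "\<dots> \<le> \<rho> ^ n" using g_le g_nonneg by (intro power_mono integral_nonneg_AE) auto
    finally show "expectation (\<lambda>\<omega>. weight \<zeta> k L N \<omega> *
       of_bool (\<epsilon> * n \<le> (\<Sum>i=1..n. Y (S i \<omega>) (X i \<omega>)))) \<le> \<rho> ^ n" .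
  qed
qed

text \<open>
  On the event that \<open>n\<close> and \<open>N\<close> cycles have nearly their tilted mean length and reward, where \<open>n\<close> and \<open>N\<close>
  are slightly below and above \<open>t / m\<close>, time \<open>t\<close> lies between the two corresponding reset times and
  \<open>F t / t\<close> is close to \<open>w\<close>. The tilted probability of this event is at least one half, and on it the
  weight is at most \<open>exp ((\<zeta> + k w + \<eta>) t)\<close> up to a constant factor.
\<close>

lemma tilted_lower_bound:
  assumes tilt_one: "tilted_mass \<zeta> k L = 1"
    and m_pos: "0 < tilted_length \<zeta> k L"
    and mean_X: "tilted_reward \<zeta> k L
      = w * tilted_length \<zeta> k L"
    and pos: "0 < \<delta>" "0 < \<eta>"
  shows "\<exists>C>0. \<forall>\<^sub>F t in at_top. C * exp (- (\<zeta> + k * w + \<eta>) * t) \<le> prob {\<omega> \<in> space M. \<bar>F t \<omega> / t - w\<bar> < \<delta>}"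
proof -
  define m where "m = tilted_length \<zeta> k L"
  have m: "0 < m" using m_pos by (simp add: m_def)
  have w: "0 \<le> w"
  proof -
    have "0 \<le> w * m" unfolding m_def mean_X[symmetric]
      using X_nonneg[of 1] by (intro integral_nonneg_AE) auto
    with m show ?thesis by (simp add: zero_le_mult_iff)
  qed
  define c where "c = \<zeta> + k * w"
  define q where "q = \<bar>c\<bar> + (\<bar>\<zeta>\<bar> + \<bar>k\<bar>)"
  have q: "0 \<le> q" by (simp add: q_def)
  define \<epsilon> where "\<epsilon> = min (1/2) (min (\<delta> / (4 * (w + 1))) (\<eta> / (q + 1)))"
  have "0 < \<epsilon>" using pos w q by (simp add: \<epsilon>_def)
  moreover have "\<epsilon> \<le> 1/2" unfolding \<epsilon>_def by (rule min.cobounded1)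
  ultimately have eps: "0 < \<epsilon>" "\<epsilon> \<le> 1/2" .
  have "\<epsilon> * (w + 1) \<le> \<delta> / (4 * (w + 1)) * (w + 1)" using w by (intro mult_right_mono) (auto simp: \<epsilon>_def)
  also have "\<delta> / (4 * (w + 1)) * (w + 1) = \<delta> / 4" using w by (simp add: divide_simps)
  finally have eps_w: "\<epsilon> * w + \<epsilon> \<le> \<delta> / 4" by (simp add: distrib_left)
  have "\<epsilon> * (q + 1) \<le> \<eta> / (q + 1) * (q + 1)" using q by (intro mult_right_mono) (auto simp: \<epsilon>_def)
  also have "\<eta> / (q + 1) * (q + 1) = \<eta>" using q by (simp add: divide_simps)
  finally have eps_q: "\<epsilon> * q \<le> \<eta>" using eps by (simp add: distrib_left)
  define e where "e = m * \<epsilon> / 4"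
  have e: "0 < e" using m eps by (simp add: e_def)
  (* The four one-sided deviations of length and reward from their tilted means. *)
  define Y where "Y j s x = (if j = 0 then s - m else if j = 1 then m - s else if j = 2 then x - w * m else w * m - x)"
    for j :: nat and s x :: real
  have [measurable]: "S 1 \<in> borel_measurable M" "X 1 \<in> borel_measurable M" using S_measurable[of 1] X_measurable[of 1] by auto
  define T where "T = exp (\<bar>\<zeta>\<bar> * \<bar>L\<bar> + \<bar>k\<bar> * \<bar>L\<bar>)"
  have T: "tilt \<zeta> k L s x \<le> T" if "0 \<le> s" for s x unfolding T_def by (rule tilt_le_bound[OF that])
  have T_pos: "0 < T" by (simp add: T_def)
  have int: "integrable M (\<lambda>\<omega>. tilt \<zeta> k L (S 1 \<omega>) (X 1 \<omega>))"
    using T S_nonneg[of 1] by (intro integrable_bounded_on[of _ T]) auto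
  have int_S: "integrable M (\<lambda>\<omega>. tilt \<zeta> k L (S 1 \<omega>) (X 1 \<omega>) * S 1 \<omega>)"
    using m_pos not_integrable_integral_eq by fastforce
  have int_X: "integrable M (\<lambda>\<omega>. tilt \<zeta> k L (S 1 \<omega>) (X 1 \<omega>) * X 1 \<omega>)"
  proof (rule integrable_bounded_on[of _ "T * \<bar>L\<bar>"])
    fix \<omega> assume om: "\<omega> \<in> space M"
    show "\<bar>tilt \<zeta> k L (S 1 \<omega>) (X 1 \<omega>) * X 1 \<omega>\<bar> \<le> T * \<bar>L\<bar>"
    proof (cases "\<bar>X 1 \<omega>\<bar> \<le> L")
      case True
      then show ?thesis using T[OF S_nonneg[OF _ om, of 1], of "X 1 \<omega>"] T_pos
        by (simp add: abs_mult) (intro mult_mono; simp)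
    qed (use T_pos in \<open>auto simp: tilt_def\<close>)
  qed measurable
  have "\<exists>r. 0 < r \<and> r < 1 \<and> (\<forall>n N. n \<le> N \<longrightarrow> expectation (\<lambda>\<omega>. weight \<zeta> k L N \<omega> *
       of_bool (e * n \<le> (\<Sum>i=1..n. Y j (S i \<omega>) (X i \<omega>)))) \<le> r ^ n)" for j
  proof -
    have 1: "case_prod (Y j) \<in> borel_measurable (borel \<Otimes>\<^sub>M borel)"
      unfolding Y_def split_beta' by measurable
    have 2: "\<bar>Y j s x\<bar> \<le> \<bar>L\<bar> + \<bar>m\<bar> + \<bar>w * m\<bar>" if "0 \<le> s" "s \<le> L" "\<bar>x\<bar> \<le> L" for s x
      using that by (auto simp: Y_def)
    have 3: "expectation (\<lambda>\<omega>. tilt \<zeta> k L (S 1 \<omega>) (X 1 \<omega>) * Y j (S 1 \<omega>) (X 1 \<omega>)) = 0"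
      using int int_S int_X tilt_one mean_X
      by (cases "j = 0"; cases "j = 1"; cases "j = 2") (simp_all add: Y_def right_diff_distrib m_def[symmetric])
    show ?thesis
    proof (rule chernoff[OF 1 2 tilt_one 3 e])
      fix r :: real
      assume "0 < r" "r < 1" "\<And>n N. n \<le> N \<Longrightarrow> expectation (\<lambda>\<omega>. weight \<zeta> k L N \<omega> *
       of_bool (e * n \<le> (\<Sum>i=1..n. Y j (S i \<omega>) (X i \<omega>)))) \<le> r ^ n"
      then show ?thesis by (intro exI[of _ r] conjI allI impI)
    qed
  qed
  then have "\<forall>j. \<exists>r. 0 < r \<and> r < 1 \<and> (\<forall>n N. n \<le> N \<longrightarrow> expectation (\<lambda>\<omega>. weight \<zeta> k L N \<omega> *
       of_bool (e * n \<le> (\<Sum>i=1..n. Y j (S i \<omega>) (X i \<omega>)))) \<le> r ^ n)" ..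
  from choice[OF this] obtain r where r: "\<And>j. 0 < r j" "\<And>j. r j < 1"
    and bad_le: "\<And>j n N. n \<le> N \<Longrightarrow> expectation (\<lambda>\<omega>. weight \<zeta> k L N \<omega> *
       of_bool (e * n \<le> (\<Sum>i=1..n. Y j (S i \<omega>) (X i \<omega>)))) \<le> r j ^ n"
    by blast
  define R where "R n N = (\<Sum>j<4. r j ^ n + r j ^ N)" for n N
  define good where "good n N \<omega> \<longleftrightarrow> (\<forall>j<4. (\<Sum>i=1..n. Y j (S i \<omega>) (X i \<omega>)) < e * n \<and> (\<Sum>i=1..N. Y j (S i \<omega>) (X i \<omega>)) < e * N)"
    for n N \<omega>
  have Y_sum_meas [measurable]: "(\<lambda>\<omega>. \<Sum>i=1..n. Y j (S i \<omega>) (X i \<omega>)) \<in> borel_measurable M" for j n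
  proof (rule borel_measurable_sum)
    fix i assume "i \<in> {1..n}"
    then have [measurable]: "S i \<in> borel_measurable M" "X i \<in> borel_measurable M"
      using S_measurable X_measurable by auto
    show "(\<lambda>\<omega>. Y j (S i \<omega>) (X i \<omega>)) \<in> borel_measurable M" unfolding Y_def by measurable
  qed
  have good_meas [measurable]: "Measurable.pred M (good n N)" for n N
    unfolding good_def by measurable
  have weight_int: "integrable M (\<lambda>\<omega>. \<Prod>i=1..N. tilt \<zeta> k L (S i \<omega>) (X i \<omega>))"
    and weight_one: "expectation (\<lambda>\<omega>. \<Prod>i=1..N. tilt \<zeta> k L (S i \<omega>) (X i \<omega>)) = 1" for N
    using expectation_prod[of "\<lambda>_. tilt \<zeta> k L" "\<lambda>_. T" N] measurable_tilt_pair T S_nonneg tilt_one by auto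
  have weight_int_bool: "integrable M (\<lambda>\<omega>. weight \<zeta> k L N \<omega> * of_bool (P \<omega>))"
    if [measurable]: "Measurable.pred M P" for N P
    using borel_measurable_integrable[OF weight_int[of N]]
    by (intro Bochner_Integration.integrable_bound[OF weight_int[of N]]) (auto simp: abs_mult prod_nonneg)
  have good_weight: "1 - R n N \<le> expectation (\<lambda>\<omega>. weight \<zeta> k L N \<omega> * of_bool (good n N \<omega>))"
    if nN: "n \<le> N" for n N
  proof -
    let ?W = "\<lambda>\<omega>. weight \<zeta> k L N \<omega>"
    let ?B = "\<lambda>j n \<omega>. of_bool (e * real n \<le> (\<Sum>i=1..n. Y j (S i \<omega>) (X i \<omega>)))"
    have int_B: "integrable M (\<lambda>\<omega>. ?W \<omega> * ?B j n' \<omega>)" for j n' by (rule weight_int_bool) measurable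
    have "1 - expectation (\<lambda>\<omega>. ?W \<omega> * of_bool (good n N \<omega>)) = expectation (\<lambda>\<omega>. ?W \<omega> - ?W \<omega> * of_bool (good n N \<omega>))"
      by (subst Bochner_Integration.integral_diff[OF weight_int weight_int_bool]) (auto simp: weight_one)
    also have "\<dots> \<le> expectation (\<lambda>\<omega>. \<Sum>j<4. ?W \<omega> * ?B j n \<omega> + ?W \<omega> * ?B j N \<omega>)"
    proof (intro integral_mono Bochner_Integration.integrable_diff Bochner_Integration.integrable_sum
        Bochner_Integration.integrable_add int_B weight_int weight_int_bool)
      fix \<omega>
      have W: "0 \<le> ?W \<omega>" by (intro prod_nonneg) auto
      have nn: "0 \<le> ?W \<omega> * ?B j n \<omega> + ?W \<omega> * ?B j N \<omega>" for j using W by simp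
      show "?W \<omega> - ?W \<omega> * of_bool (good n N \<omega>) \<le> (\<Sum>j<4. ?W \<omega> * ?B j n \<omega> + ?W \<omega> * ?B j N \<omega>)"
      proof (cases "good n N \<omega>")
        case False
        then obtain j where j: "j < 4" "e * n \<le> (\<Sum>i=1..n. Y j (S i \<omega>) (X i \<omega>)) \<or> e * N \<le> (\<Sum>i=1..N. Y j (S i \<omega>) (X i \<omega>))"
          unfolding good_def by (auto simp: not_less)
        then have "?W \<omega> \<le> ?W \<omega> * ?B j n \<omega> + ?W \<omega> * ?B j N \<omega>" using W by auto
        also have "\<dots> \<le> (\<Sum>j<4. ?W \<omega> * ?B j n \<omega> + ?W \<omega> * ?B j N \<omega>)"
          using j(1) nn by (intro member_le_sum) auto
        finally show ?thesis using False by simp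
      qed (use nn in \<open>simp add: sum_nonneg\<close>)
    qed auto
    also have "\<dots> = (\<Sum>j<4. expectation (\<lambda>\<omega>. ?W \<omega> * ?B j n \<omega>) + expectation (\<lambda>\<omega>. ?W \<omega> * ?B j N \<omega>))"
      using int_B by (subst Bochner_Integration.integral_sum) auto
    also have "\<dots> \<le> R n N" unfolding R_def
      using nN by (intro sum_mono add_mono bad_le) auto
    finally show ?thesis by linarith
  qed
  define n where "n t = nat \<lfloor>(1 - \<epsilon>) * t / m\<rfloor>" for t
  define N where "N t = nat \<lceil>(1 + \<epsilon>) * t / m\<rceil>" for t
  have n_bounds: "real (n t) * m \<le> (1 - \<epsilon>) * t" "(1 - \<epsilon>) * t - m \<le> real (n t) * m" if "0 < t" for t
  proof -
    have "0 \<le> (1 - \<epsilon>) * t / m" using eps that m by simp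
    then have "real (n t) \<le> (1 - \<epsilon>) * t / m" "(1 - \<epsilon>) * t / m - 1 \<le> real (n t)"
      unfolding n_def by linarith+
    then show "real (n t) * m \<le> (1 - \<epsilon>) * t" "(1 - \<epsilon>) * t - m \<le> real (n t) * m"
      using m by (simp_all add: field_simps)
  qed
  have N_bounds: "(1 + \<epsilon>) * t \<le> real (N t) * m" "real (N t) * m \<le> (1 + \<epsilon>) * t + m" if "0 < t" for t
  proof -
    have "0 \<le> (1 + \<epsilon>) * t / m" using eps that m by simp
    then have "(1 + \<epsilon>) * t / m \<le> real (N t)" "real (N t) \<le> (1 + \<epsilon>) * t / m + 1"
      unfolding N_def by linarith+
    then show "(1 + \<epsilon>) * t \<le> real (N t) * m" "real (N t) * m \<le> (1 + \<epsilon>) * t + m"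
      using m by (simp_all add: field_simps)
  qed
  have nN: "n t \<le> N t" if "0 < t" for t
  proof -
    have "(1 - \<epsilon>) * t \<le> (1 + \<epsilon>) * t" using eps that by simp
    then have "real (n t) * m \<le> real (N t) * m" using n_bounds[OF that] N_bounds[OF that] by linarith
    then show ?thesis using m by simp
  qed
  have n_lim: "filterlim n at_top at_top"
  proof -
    have "filterlim (\<lambda>t. (1 - \<epsilon>) / m * t) at_top at_top"
      using eps m by (intro filterlim_tendsto_pos_mult_at_top[OF tendsto_const _ filterlim_ident]) auto
    then have "filterlim (\<lambda>t. nat \<lfloor>(1 - \<epsilon>) / m * t\<rfloor>) at_top at_top"
      by (intro filterlim_compose[OF filterlim_nat_sequentially] filterlim_compose[OF filterlim_floor_sequentially])
    then show ?thesis by (simp add: n_def[abs_def])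
  qed
  have "(\<lambda>n. \<Sum>j<4. 2 * r j ^ n) \<longlonglongrightarrow> (\<Sum>j<(4::nat). 2 * 0)"
    using r by (intro tendsto_intros LIMSEQ_power_zero) (simp add: abs_of_pos)
  then have "\<forall>\<^sub>F n in sequentially. (\<Sum>j<4. 2 * r j ^ n) < 1/2"
    by (rule order_tendstoD) simp
  then have ev: "\<forall>\<^sub>F t in at_top. (\<Sum>j<4. 2 * r j ^ n t) < 1/2"
    by (rule eventually_compose_filterlim[OF _ n_lim])
  have "\<forall>\<^sub>F t in at_top. 1/2 * exp (- (m * q)) * exp (- (\<zeta> + k * w + \<eta>) * t) \<le> prob {\<omega> \<in> space M. \<bar>F t \<omega> / t - w\<bar> < \<delta>}"
    using ev eventually_gt_at_top[of 0] eventually_ge_at_top[of "4 * m * (w + 1) / \<delta>"]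
  proof eventually_elim
    case (elim t)
    have t: "0 < t" by fact
    have mt: "m * (w + 1) \<le> \<delta> / 4 * t" using elim(3) pos by (simp add: field_simps)
    have et: "0 \<le> \<epsilon> * t" using eps t by simp
    note nb = n_bounds[OF t] and Nb = N_bounds[OF t]
    have "R (n t) (N t) \<le> (\<Sum>j<4. 2 * r j ^ n t)"
      unfolding R_def
    proof (rule sum_mono)
      fix j
      have "r j ^ N t \<le> r j ^ n t" using r[of j] nN[OF t] by (intro power_decreasing) (auto simp: less_imp_le)
      then show "r j ^ n t + r j ^ N t \<le> 2 * r j ^ n t" by simp
    qed
    then have half: "1/2 \<le> expectation (\<lambda>\<omega>. weight \<zeta> k L (N t) \<omega> * of_bool (good (n t) (N t) \<omega>))"
      using good_weight[OF nN[OF t]] elim(1) by linarith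
    have bounds: "\<bar>(\<Sum>i=1..n'. S i \<omega>) - n' * m\<bar> \<le> n' * m * \<epsilon> / 4 \<and> \<bar>(\<Sum>i=1..n'. X i \<omega>) - n' * m * w\<bar> \<le> n' * m * \<epsilon> / 4"
      if g: "good (n t) (N t) \<omega>" and n': "n' = n t \<or> n' = N t" for \<omega> n'
    proof -
      have "(\<Sum>i=1..n'. Y j (S i \<omega>) (X i \<omega>)) < n' * m * \<epsilon> / 4" if "j < 4" for j
        using g n' that unfolding good_def e_def by (auto simp: mult.commute mult.left_commute)
      from this[of 0] this[of 1] this[of 2] this[of 3] show ?thesis
        unfolding abs_le_iff by (simp add: Y_def sum_subtractf algebra_simps)
    qed
    define A where "A = {\<omega> \<in> space M. good (n t) (N t) \<omega>}"
    have A_meas [measurable]: "A \<in> sets M" unfolding A_def by measurable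
    have weight_le: "weight \<zeta> k L (N t) \<omega> * of_bool (good (n t) (N t) \<omega>)
        \<le> exp ((c + \<eta>) * t + m * q) * indicator A \<omega>" if om: "\<omega> \<in> space M" for \<omega>
    proof (cases "good (n t) (N t) \<omega>")
      case True
      let ?s = "\<Sum>i=1..N t. S i \<omega>" and ?x = "\<Sum>i=1..N t. X i \<omega>"
      let ?g = "real (N t) * m"
      have "weight \<zeta> k L (N t) \<omega> \<le> (\<Prod>i=1..N t. exp (\<zeta> * S i \<omega> + k * X i \<omega>))"
        by (intro prod_mono) (auto intro: tilt_le_exp)
      also have "\<dots> = exp (\<zeta> * ?s + k * ?x)"
        by (simp add: exp_sum[symmetric] sum.distrib sum_distrib_left)
      also have "\<dots> \<le> exp ((c + \<eta>) * t + m * q)"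
      proof -
        have b: "\<bar>?s - ?g\<bar> \<le> ?g * \<epsilon> / 4" "\<bar>?x - ?g * w\<bar> \<le> ?g * \<epsilon> / 4" using bounds[OF True, of "N t"] by auto
        have "\<zeta> * (?s - ?g) \<le> \<bar>\<zeta>\<bar> * (?g * \<epsilon> / 4)"
          by (rule order_trans[OF abs_ge_self]) (simp only: abs_mult, intro mult_left_mono b abs_ge_zero)
        moreover have "k * (?x - ?g * w) \<le> \<bar>k\<bar> * (?g * \<epsilon> / 4)"
          by (rule order_trans[OF abs_ge_self]) (simp only: abs_mult, intro mult_left_mono b abs_ge_zero)
        moreover have "\<zeta> * ?s + k * ?x = c * ?g + \<zeta> * (?s - ?g) + k * (?x - ?g * w)"
          by (simp add: c_def algebra_simps)
        ultimately have 1: "\<zeta> * ?s + k * ?x \<le> c * ?g + (\<bar>\<zeta>\<bar> + \<bar>k\<bar>) * (?g * \<epsilon> / 4)"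
          unfolding distrib_right by linarith
        have "0 \<le> ?g - t" "?g - t \<le> \<epsilon> * t + m" using Nb et by (simp_all add: algebra_simps)
        then have "\<bar>?g - t\<bar> \<le> \<epsilon> * t + m" by linarith
        from mult_left_mono[OF this, of "\<bar>c\<bar>"] have "c * (?g - t) \<le> \<bar>c\<bar> * (\<epsilon> * t + m)"
          using abs_ge_self[of "c * (?g - t)"] unfolding abs_mult by linarith
        then have 2: "c * ?g \<le> c * t + \<bar>c\<bar> * (\<epsilon> * t + m)" by (simp add: algebra_simps)
        have "?g * \<epsilon> / 4 \<le> ((1 + \<epsilon>) * t + m) * \<epsilon> / 4" using Nb eps by (intro divide_right_mono mult_right_mono) auto
        also have "\<dots> = (\<epsilon> * t) * ((1 + \<epsilon>) / 4) + m * (\<epsilon> / 4)" by (simp add: algebra_simps add_divide_distrib)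
        also have "\<dots> \<le> (\<epsilon> * t) * 1 + m * 1" using eps et m by (intro add_mono mult_left_mono) auto
        finally have "(\<bar>\<zeta>\<bar> + \<bar>k\<bar>) * (?g * \<epsilon> / 4) \<le> (\<bar>\<zeta>\<bar> + \<bar>k\<bar>) * (\<epsilon> * t + m)" by (intro mult_left_mono) auto
        with 1 2 have "\<zeta> * ?s + k * ?x \<le> c * t + q * (\<epsilon> * t + m)"
          unfolding q_def distrib_right by linarith
        also have "q * (\<epsilon> * t + m) \<le> \<eta> * t + m * q" using mult_right_mono[OF eps_q, of t] t by (simp add: algebra_simps)
        finally show ?thesis by (simp add: algebra_simps)
      qed
      finally show ?thesis using True om by (simp add: A_def)
    qed simp
    have "1/2 \<le> exp ((c + \<eta>) * t + m * q) * prob A"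
    proof -
      have int_A: "integrable M (\<lambda>\<omega>. exp ((c + \<eta>) * t + m * q) * indicator A \<omega>)"
        by (intro integrable_bounded_on[of _ "exp ((c + \<eta>) * t + m * q)"]) (auto simp: indicator_def)
      have "1/2 \<le> expectation (\<lambda>\<omega>. exp ((c + \<eta>) * t + m * q) * indicator A \<omega>)"
        by (rule order_trans[OF half], rule integral_mono[OF weight_int_bool int_A weight_le]) auto
      then show ?thesis by simp
    qed
    then have "1/2 * exp (- ((c + \<eta>) * t + m * q)) \<le> exp ((c + \<eta>) * t + m * q) * prob A * exp (- ((c + \<eta>) * t + m * q))"
      by (intro mult_right_mono) auto
    also have "exp a * p * exp (- a) = p" for a p :: real by (simp add: exp_minus)
    finally have "1/2 * exp (- (m * q)) * exp (- (\<zeta> + k * w + \<eta>) * t) \<le> prob A"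
      by (simp add: c_def exp_add[symmetric] algebra_simps)
    also have "prob A \<le> prob {\<omega> \<in> space M. \<bar>F t \<omega> / t - w\<bar> < \<delta>}"
    proof (rule finite_measure_mono)
      show "{\<omega> \<in> space M. \<bar>F t \<omega> / t - w\<bar> < \<delta>} \<in> sets M" using F_measurable[of t] by measurable
      show "A \<subseteq> {\<omega> \<in> space M. \<bar>F t \<omega> / t - w\<bar> < \<delta>}"
      proof
        fix \<omega> assume "\<omega> \<in> A"
        then have om: "\<omega> \<in> space M" and g: "good (n t) (N t) \<omega>" by (auto simp: A_def)
        let ?a = "real (n t) * m" and ?b = "real (N t) * m"
        have bn: "\<bar>(\<Sum>i=1..n t. S i \<omega>) - ?a\<bar> \<le> ?a * \<epsilon> / 4" "\<bar>(\<Sum>i=1..n t. X i \<omega>) - ?a * w\<bar> \<le> ?a * \<epsilon> / 4"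
          and bN: "\<bar>(\<Sum>i=1..N t. S i \<omega>) - ?b\<bar> \<le> ?b * \<epsilon> / 4" "\<bar>(\<Sum>i=1..N t. X i \<omega>) - ?b * w\<bar> \<le> ?b * \<epsilon> / 4"
          using bounds[OF g, of "n t"] bounds[OF g, of "N t"] by auto
        have "(\<Sum>i=1..n t. S i \<omega>) \<le> ?a * (1 + \<epsilon> / 4)" using bn unfolding abs_le_iff by (simp add: algebra_simps)
        also have "\<dots> \<le> (1 - \<epsilon>) * t * (1 + \<epsilon> / 4)" using nb eps by (intro mult_right_mono) auto
        also have "\<dots> = t - t * (3/4 * \<epsilon> + \<epsilon> * \<epsilon> / 4)" by (simp add: field_simps)
        also have "\<dots> \<le> t" using t eps by simp
        finally have Tn: "(\<Sum>i=1..n t. S i \<omega>) \<le> t" .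
        have "t < t + t * (\<epsilon> * (3/4 - \<epsilon> / 4))" using t eps by simp
        also have "\<dots> = (1 + \<epsilon>) * t * (1 - \<epsilon> / 4)" by (simp add: field_simps)
        also have "\<dots> \<le> ?b * (1 - \<epsilon> / 4)" using Nb eps by (intro mult_right_mono) auto
        also have "\<dots> \<le> (\<Sum>i=1..N t. S i \<omega>)" using bN unfolding abs_le_iff by (simp add: algebra_simps)
        finally have TN: "t < (\<Sum>i=1..N t. S i \<omega>)" .
        from F_bounds[OF om Tn TN] have F: "(\<Sum>i=1..n t. X i \<omega>) \<le> F t \<omega>" "F t \<omega> \<le> (\<Sum>i=1..N t. X i \<omega>)" by auto
        have ewt: "(\<epsilon> * w + \<epsilon>) * t \<le> \<delta> / 4 * t" using eps_w t by (intro mult_right_mono) auto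
        have "(\<Sum>i=1..N t. X i \<omega>) \<le> ?b * (w + \<epsilon> / 4)" using bN unfolding abs_le_iff by (simp add: algebra_simps)
        also have "\<dots> \<le> ((1 + \<epsilon>) * t + m) * (w + \<epsilon> / 4)" using Nb eps w by (intro mult_right_mono) auto
        also have "\<dots> = w * t + (\<epsilon> * w) * t + \<epsilon> * t * ((1 + \<epsilon>) / 4) + m * (w + \<epsilon> / 4)" by (simp add: field_simps)
        also have "\<dots> \<le> w * t + (\<epsilon> * w) * t + \<epsilon> * t * 1 + m * (w + 1)"
          using eps et m w by (intro add_mono mult_left_mono) auto
        also have "\<dots> \<le> w * t + \<delta> / 4 * t + \<delta> / 4 * t" using ewt mt by (simp add: algebra_simps)
        also have "\<dots> < (w + \<delta>) * t" using pos t by (simp add: algebra_simps)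
        finally have up: "F t \<omega> < (w + \<delta>) * t" using F by linarith
        have "(w - \<delta>) * t < w * t - \<delta> / 4 * t - \<delta> / 4 * t" using pos t by (simp add: algebra_simps)
        also have "\<dots> \<le> w * t - (\<epsilon> * w + \<epsilon>) * t - m * (w + 1)" using ewt mt by linarith
        also have "\<dots> \<le> ((1 - \<epsilon>) * t - m) * w - (1 - \<epsilon>) * t * \<epsilon> / 4"
        proof -
          have "(1 - \<epsilon>) * t * \<epsilon> / 4 = \<epsilon> * t * ((1 - \<epsilon>) / 4)" by simp
          also have "\<dots> \<le> \<epsilon> * t * 1" using eps et by (intro mult_left_mono) auto
          finally show ?thesis using m by (simp add: algebra_simps)
        qed
        also have "\<dots> \<le> ?a * w - ?a * \<epsilon> / 4"
        proof -
          have "?a * (\<epsilon> / 4) \<le> (1 - \<epsilon>) * t * (\<epsilon> / 4)" using nb eps by (intro mult_right_mono) auto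
          then show ?thesis using mult_right_mono[OF nb(2) w] by simp
        qed
        also have "\<dots> \<le> (\<Sum>i=1..n t. X i \<omega>)" using bn unfolding abs_le_iff by (simp add: algebra_simps)
        finally have low: "(w - \<delta>) * t < F t \<omega>" using F by linarith
        have "w - \<delta> < F t \<omega> / t" "F t \<omega> / t < w + \<delta>" using up low t by (simp_all add: field_simps)
        then show "\<omega> \<in> {\<omega> \<in> space M. \<bar>F t \<omega> / t - w\<bar> < \<delta>}" using om by auto
      qed
    qed
    finally show ?case .
  qed
  then show ?thesis by (intro exI[of _ "1/2 * exp (- (m * q))"]) auto
qed

end

section \<open>Large deviations of renewal-reward processes\<close>

lemma ereal_uminus_le_real: "ereal (- z) \<le> q \<Longrightarrow> - q \<le> ereal z"
  by (cases q) auto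

lemma ereal_real_le_uminus: "q \<le> ereal (- z) \<Longrightarrow> ereal z \<le> - q"
  by (cases q) auto

lemma ereal_le_uminus_swap: "(p :: ereal) \<le> - q \<Longrightarrow> q \<le> - p"
  by (cases p; cases q) auto

lemma ereal_not_le_uminus: "\<not> (q :: ereal) \<le> - p \<Longrightarrow> - q < p"
  by (cases p; cases q) auto

context renewal_reward
begin

definition feasible :: "real \<Rightarrow> real \<Rightarrow> bool" where
  "feasible \<zeta> k \<longleftrightarrow> (\<integral>\<^sup>+\<omega>. ennreal (exp (\<zeta> * S 1 \<omega> + k * X 1 \<omega>)) \<partial>M) \<le> 1"

definition exponent :: "real \<Rightarrow> ereal" where
  "exponent k = (SUP \<zeta>\<in>{\<zeta>. feasible \<zeta> k}. ereal \<zeta>)"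

definition rate :: "real \<Rightarrow> ereal" where
  "rate w = (SUP k. ereal (w * k) + exponent k)"

lemma feasible_zero: "feasible 0 0"
  by (simp add: feasible_def emeasure_space_1)

lemma feasible_le_rate:
  assumes "feasible \<zeta> k" shows "ereal (\<zeta> + k * w) \<le> rate w"
proof -
  have "ereal \<zeta> \<le> exponent k" unfolding exponent_def using assms by (intro SUP_upper) auto
  then have "ereal (w * k) + ereal \<zeta> \<le> ereal (w * k) + exponent k" by (rule add_left_mono)
  also have "\<dots> \<le> rate w" unfolding rate_def by (intro SUP_upper) auto
  finally show ?thesis by (simp add: mult.commute add.commute)
qed

lemma less_rate_obtain:
  assumes "ereal \<alpha> < rate w"
  obtains \<zeta> k where "feasible \<zeta> k" "\<alpha> < \<zeta> + k * w"
proof -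
  obtain k where "ereal \<alpha> < ereal (w * k) + exponent k"
    using assms unfolding rate_def less_SUP_iff by blast
  then have "ereal (\<alpha> - w * k) < exponent k" by (cases "exponent k") auto
  then obtain \<zeta> where "feasible \<zeta> k" "ereal (\<alpha> - w * k) < ereal \<zeta>"
    unfolding exponent_def less_SUP_iff by blast
  then show ?thesis by (intro that[of \<zeta> k]) (auto simp: algebra_simps)
qed

lemma rate_nonneg: "0 \<le> rate w"
  using feasible_le_rate[OF feasible_zero, of w] by (simp add: zero_ereal_def)

lemma rate_lower_semicontinuous: "lower_semicontinuous rate"
  unfolding lower_semicontinuous_def
proof
  fix x :: real
  show "rate x \<le> Liminf (at x) rate"
  proof (rule ccontr)
    assume "\<not> ?thesis"
    then have "Liminf (at x) rate < rate x" by simp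
    then obtain \<alpha> where a: "Liminf (at x) rate < ereal \<alpha>" "ereal \<alpha> < rate x" using ereal_dense2 by blast
    obtain \<zeta> k where z: "feasible \<zeta> k" "\<alpha> < \<zeta> + k * x" using less_rate_obtain[OF a(2)] .
    have "((\<lambda>w. \<zeta> + k * w) \<longlongrightarrow> \<zeta> + k * x) (at x)" by (intro tendsto_intros)
    from order_tendstoD(1)[OF this z(2)] have "\<forall>\<^sub>F w in at x. ereal \<alpha> \<le> rate w"
    proof eventually_elim
      case (elim w)
      have "ereal \<alpha> \<le> ereal (\<zeta> + k * w)" using elim by simp
      then show ?case using feasible_le_rate[OF z(1)] by (rule order_trans)
    qed
    then have "ereal \<alpha> \<le> Liminf (at x) rate" by (rule Liminf_bounded)
    with a(1) show False by simp
  qed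
qed

text \<open>
  A cycle has positive length with positive probability, so \<open>exp (\<alpha> S)\<close>, which is never below \<open>1\<close>,
  exceeds \<open>1\<close> by a definite amount on an event of positive probability.
\<close>

lemma not_feasible_pos:
  assumes "0 < \<alpha>" shows "\<not> feasible \<alpha> 0"
proof
  assume feas: "feasible \<alpha> 0"
  have [measurable]: "S 1 \<in> borel_measurable M" "X 1 \<in> borel_measurable M" using S_measurable[of 1] X_measurable[of 1] by auto
  obtain s L where sL: "0 < s" "0 < prob {\<omega> \<in> space M. s \<le> S 1 \<omega> \<and> S 1 \<omega> \<le> L \<and> \<bar>X 1 \<omega>\<bar> \<le> L}"
  proof (rule bounded_part_positive[OF S_measurable[of 1] X_measurable[of 1] _ S_nonzero])
    fix s L :: real
    assume "0 < s" "0 < prob {\<omega> \<in> space M. s \<le> S 1 \<omega> \<and> S 1 \<omega> \<le> L \<and> \<bar>X 1 \<omega>\<bar> \<le> L}"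
    then show thesis by (rule that)
  qed (use S_nonneg[of 1] in auto)
  define A where "A = {\<omega> \<in> space M. s \<le> S 1 \<omega> \<and> S 1 \<omega> \<le> L \<and> \<bar>X 1 \<omega>\<bar> \<le> L}"
  have [measurable]: "A \<in> sets M" unfolding A_def by measurable
  have e: "0 < exp (\<alpha> * s) - 1" using sL assms by simp
  have "1 + ennreal ((exp (\<alpha> * s) - 1) * prob A) = (\<integral>\<^sup>+\<omega>. 1 + ennreal (exp (\<alpha> * s) - 1) * indicator A \<omega> \<partial>M)"
    using e by (simp add: nn_integral_add nn_integral_cmult emeasure_eq_measure ennreal_mult' prob_space)
  also have "\<dots> \<le> (\<integral>\<^sup>+\<omega>. ennreal (exp (\<alpha> * S 1 \<omega> + 0 * X 1 \<omega>)) \<partial>M)"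
  proof (rule nn_integral_mono)
    fix \<omega> assume om: "\<omega> \<in> space M"
    have nn: "0 \<le> S 1 \<omega>" using S_nonneg[of 1] om by simp
    show "1 + ennreal (exp (\<alpha> * s) - 1) * indicator A \<omega> \<le> ennreal (exp (\<alpha> * S 1 \<omega> + 0 * X 1 \<omega>))"
    proof (cases "\<omega> \<in> A")
      case True
      then have "exp (\<alpha> * s) \<le> exp (\<alpha> * S 1 \<omega>)" using assms by (auto simp: A_def)
      moreover have "1 + ennreal (exp (\<alpha> * s) - 1) = ennreal (exp (\<alpha> * s))"
        using e by (simp add: ennreal_plus[symmetric] flip: ennreal_1 del: ennreal_plus)
      ultimately show ?thesis using True by simp
    next
      case False
      have "ennreal 1 \<le> ennreal (exp (\<alpha> * S 1 \<omega>))" using nn assms by (intro ennreal_leI) simp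
      then show ?thesis using False by simp
    qed
  qed
  also have "\<dots> \<le> 1" using feas by (simp add: feasible_def)
  finally have "ennreal ((exp (\<alpha> * s) - 1) * prob A) = 0" by (simp add: ennreal_add_left_cancel_le)
  then have "(exp (\<alpha> * s) - 1) * prob A \<le> 0" by (simp only: ennreal_eq_0_iff)
  moreover have "0 < (exp (\<alpha> * s) - 1) * prob A" using e sL(2) unfolding A_def by (rule mult_pos_pos)
  ultimately show False by simp
qed

lemma feasible_nonpos:
  assumes "feasible \<zeta> k" "0 \<le> k" shows "\<zeta> \<le> 0"
proof (rule ccontr)
  assume "\<not> \<zeta> \<le> 0"
  have "(\<integral>\<^sup>+\<omega>. ennreal (exp (\<zeta> * S 1 \<omega> + 0 * X 1 \<omega>)) \<partial>M) \<le> (\<integral>\<^sup>+\<omega>. ennreal (exp (\<zeta> * S 1 \<omega> + k * X 1 \<omega>)) \<partial>M)"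
    using X_nonneg[of 1] assms(2) by (intro nn_integral_mono ennreal_leI) auto
  with assms(1) have "feasible \<zeta> 0" unfolding feasible_def by (rule order_trans[rotated])
  with not_feasible_pos[of \<zeta>] \<open>\<not> \<zeta> \<le> 0\<close> show False by simp
qed

text \<open>
  Along such pairs with \<open>w\<close> tending to \<open>\<infinity>\<close> the integrands would dominate \<open>exp (\<alpha> S)\<close> in the limit, and
  Fatou's lemma would make \<open>(\<alpha>, 0)\<close> feasible. The bound lets the closed upper bound pick a largest point
  among those controlled by lower half-lines.
\<close>

lemma lower_points_bounded:
  assumes "0 < \<alpha>"
  obtains b where "\<And>\<zeta> k w. feasible \<zeta> k \<Longrightarrow> k \<le> 0 \<Longrightarrow> \<alpha> < \<zeta> + k * w \<Longrightarrow> w \<le> b"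
proof (rule ccontr)
  assume "\<not> thesis"
  then have "\<exists>\<zeta> k w. feasible \<zeta> k \<and> k \<le> 0 \<and> \<alpha> < \<zeta> + k * w \<and> b < w" for b
    using that[of b] by (meson not_le)
  then have "\<forall>n::nat. \<exists>\<zeta> k w. feasible \<zeta> k \<and> k \<le> 0 \<and> \<alpha> < \<zeta> + k * w \<and> real n < w" by blast
  then obtain z k w where seq: "\<And>n::nat. feasible (z n) (k n)" "\<And>n. k n \<le> 0"
    "\<And>n. \<alpha> < z n + k n * w n" "\<And>n. real n < w n" by metis
  have [measurable]: "S 1 \<in> borel_measurable M" "X 1 \<in> borel_measurable M" using S_measurable[of 1] X_measurable[of 1] by auto
  have "feasible \<alpha> 0" unfolding feasible_def
  proof (rule nn_integral_le_one_limit[where f = "\<lambda>n \<omega>. ennreal (exp (\<alpha> * S 1 \<omega>)) * of_bool (X 1 \<omega> \<le> real n * S 1 \<omega>)"])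
    fix \<omega> assume om: "\<omega> \<in> space M"
    have "\<forall>\<^sub>F n in sequentially. X 1 \<omega> \<le> real n * S 1 \<omega>"
    proof (cases "S 1 \<omega> = 0")
      case True then show ?thesis using X_zero[OF om] by simp
    next
      case False
      then have pos: "0 < S 1 \<omega>" using S_nonneg[of 1 \<omega>] om by simp
      obtain N where N: "X 1 \<omega> / S 1 \<omega> < real N" using reals_Archimedean2 by blast
      show ?thesis using eventually_ge_at_top[of N]
      proof eventually_elim
        case (elim n)
        then have "X 1 \<omega> / S 1 \<omega> \<le> real n" using N by simp
        then show ?case using pos by (simp add: field_simps)
      qed
    qed
    then have "\<forall>\<^sub>F n in sequentially. ennreal (exp (\<alpha> * S 1 \<omega> + 0 * X 1 \<omega>)) = ennreal (exp (\<alpha> * S 1 \<omega>)) * of_bool (X 1 \<omega> \<le> real n * S 1 \<omega>)"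
      by eventually_elim simp
    then show "(\<lambda>n. ennreal (exp (\<alpha> * S 1 \<omega>)) * of_bool (X 1 \<omega> \<le> real n * S 1 \<omega>)) \<longlonglongrightarrow> ennreal (exp (\<alpha> * S 1 \<omega> + 0 * X 1 \<omega>))"
      by (rule Lim_transform_eventually[OF tendsto_const])
  next
    fix n :: nat
    have "(\<integral>\<^sup>+\<omega>. ennreal (exp (\<alpha> * S 1 \<omega>)) * of_bool (X 1 \<omega> \<le> real n * S 1 \<omega>) \<partial>M)
       \<le> (\<integral>\<^sup>+\<omega>. ennreal (exp (z n * S 1 \<omega> + k n * X 1 \<omega>)) \<partial>M)"
    proof (rule nn_integral_mono)
      fix \<omega> assume om: "\<omega> \<in> space M"
      show "ennreal (exp (\<alpha> * S 1 \<omega>)) * of_bool (X 1 \<omega> \<le> real n * S 1 \<omega>) \<le> ennreal (exp (z n * S 1 \<omega> + k n * X 1 \<omega>))"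
      proof (cases "X 1 \<omega> \<le> real n * S 1 \<omega>")
        case True
        have nn: "0 \<le> S 1 \<omega>" using S_nonneg[of 1] om by simp
        have "X 1 \<omega> \<le> w n * S 1 \<omega>" using True mult_right_mono[OF less_imp_le[OF seq(4)[of n]] nn] by linarith
        then have "k n * (w n * S 1 \<omega>) \<le> k n * X 1 \<omega>" using seq(2) by (intro mult_left_mono_neg) auto
        moreover have "\<alpha> * S 1 \<omega> \<le> (z n + k n * w n) * S 1 \<omega>" using seq(3)[of n] nn by (intro mult_right_mono) auto
        ultimately have "\<alpha> * S 1 \<omega> \<le> z n * S 1 \<omega> + k n * X 1 \<omega>" by (simp add: algebra_simps)
        then show ?thesis using True by (simp add: ennreal_leI)
      qed simp
    qed
    also have "\<dots> \<le> 1" using seq(1)[of n] by (simp add: feasible_def)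
    finally show "(\<integral>\<^sup>+\<omega>. ennreal (exp (\<alpha> * S 1 \<omega>)) * of_bool (X 1 \<omega> \<le> real n * S 1 \<omega>) \<partial>M) \<le> 1" .
  qed measurable
  with not_feasible_pos[OF assms] show False by simp
qed

lemma open_lower_bound:
  assumes G: "open G"
  shows "- (INF w\<in>G. rate w) \<le> Liminf at_top (\<lambda>t. ereal (1 / t) * eln (emeasure M {\<omega> \<in> space M. F t \<omega> / t \<in> G}))"
    (is "_ \<le> ?L")
proof -
  have "- ?L \<le> rate w" if w: "w \<in> G" for w
  proof (cases "rate w = \<infinity>")
    case False
    then obtain \<alpha> where \<alpha>: "rate w = ereal \<alpha>" using rate_nonneg[of w] by (cases "rate w") auto
    obtain \<delta> where d: "0 < \<delta>" "\<And>y. dist y w < \<delta> \<Longrightarrow> y \<in> G" using G w unfolding open_dist by blast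
    have "ereal (- \<alpha>) \<le> ?L"
    proof (rule ereal_le_epsilon2)
      fix \<eta> :: real assume eta: "0 < \<eta>"
      have feas: "\<zeta> + k * w \<le> \<alpha>" if "(\<integral>\<^sup>+\<omega>. ennreal (exp (\<zeta> * S 1 \<omega> + k * X 1 \<omega>)) \<partial>M) \<le> 1" for \<zeta> k
        using feasible_le_rate[of \<zeta> k w] that \<alpha> by (simp add: feasible_def)
      have [measurable]: "S 1 \<in> borel_measurable M" "X 1 \<in> borel_measurable M" using S_measurable[of 1] X_measurable[of 1] by auto
      have nn: "\<omega> \<in> space M \<Longrightarrow> 0 \<le> S 1 \<omega>" for \<omega> using S_nonneg[of 1] by simp
      have d2: "0 < \<delta> / 2" and e2: "0 < \<eta> / 2" using d eta by auto
      obtain \<zeta> k L w' where tl: "\<bar>w' - w\<bar> < \<delta> / 2" "\<zeta> + k * w' \<le> \<alpha> + \<eta> / 2"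
        "tilted_mass \<zeta> k L = 1"
        "0 < tilted_length \<zeta> k L"
        "tilted_reward \<zeta> k L
           = w' * tilted_length \<zeta> k L"
        by (rule exists_tilt[OF S_measurable[of 1] X_measurable[of 1] nn S_nonzero feas d2 e2]) auto
      obtain C where C: "0 < C" "\<forall>\<^sub>F t in at_top. C * exp (- (\<zeta> + k * w' + \<eta> / 2) * t) \<le> prob {\<omega> \<in> space M. \<bar>F t \<omega> / t - w'\<bar> < \<delta> / 2}"
        using tilted_lower_bound[OF tl(3-5) d2 e2] by blast
      have "\<forall>\<^sub>F t in at_top. ennreal (C * exp (- (\<zeta> + k * w' + \<eta> / 2) * t)) \<le> emeasure M {\<omega> \<in> space M. F t \<omega> / t \<in> G}"
        using C(2)
      proof eventually_elim
        case (elim t)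
        have [measurable]: "F t \<in> borel_measurable M" by (rule F_measurable)
        have [measurable]: "G \<in> sets borel" using G by simp
        have "prob {\<omega> \<in> space M. \<bar>F t \<omega> / t - w'\<bar> < \<delta> / 2} \<le> prob {\<omega> \<in> space M. F t \<omega> / t \<in> G}"
        proof (rule finite_measure_mono)
          show "{\<omega> \<in> space M. \<bar>F t \<omega> / t - w'\<bar> < \<delta> / 2} \<subseteq> {\<omega> \<in> space M. F t \<omega> / t \<in> G}"
          proof
            fix \<omega> assume a: "\<omega> \<in> {\<omega> \<in> space M. \<bar>F t \<omega> / t - w'\<bar> < \<delta> / 2}"
            then have "\<bar>F t \<omega> / t - w'\<bar> < \<delta> / 2" by simp
            then have "dist (F t \<omega> / t) w < \<delta>" using tl(1) unfolding dist_real_def abs_less_iff by linarith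
            from d(2)[OF this] show "\<omega> \<in> {\<omega> \<in> space M. F t \<omega> / t \<in> G}" using a by simp
          qed
        qed measurable
        with elim show ?case by (simp add: emeasure_eq_measure ennreal_leI)
      qed
      from Liminf_rate_ge[OF C(1) this] have "ereal (- (\<zeta> + k * w' + \<eta> / 2)) \<le> ?L" .
      moreover have "ereal (- \<alpha> - \<eta>) \<le> ereal (- (\<zeta> + k * w' + \<eta> / 2))" using tl(2) by simp
      ultimately have "ereal (- \<alpha> - \<eta>) \<le> ?L" by (rule order_trans[rotated])
      then show "ereal (- \<alpha>) \<le> ?L + ereal \<eta>" by (cases ?L) auto
    qed
    then show ?thesis unfolding \<alpha> by (simp add: ereal_uminus_le_reorder)
  qed simp
  then have "- ?L \<le> (INF w\<in>G. rate w)" by (rule INF_greatest)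
  then show ?thesis by (simp add: ereal_uminus_le_reorder)
qed

lemma moment_lower_bound:
  "- exponent k \<le> Liminf at_top (\<lambda>t. ereal (1 / t) * eln (\<integral>\<^sup>+\<omega>. ennreal (exp (k * F t \<omega>)) \<partial>M))" (is "_ \<le> ?L")
proof -
  have "- ?L \<le> exponent k"
  proof (rule ccontr)
    assume "\<not> ?thesis"
    then have "exponent k < - ?L" by (rule not_le_imp_less)
    from ereal_dense2[OF this] obtain \<zeta> where z: "exponent k < ereal \<zeta>" "ereal \<zeta> < - ?L" by blast
    have "\<not> feasible \<zeta> k"
    proof
      assume "feasible \<zeta> k"
      then have "ereal \<zeta> \<le> exponent k" unfolding exponent_def by (intro SUP_upper) auto
      with z(1) show False by simp
    qed
    then have gt: "1 < (\<integral>\<^sup>+\<omega>. ennreal (exp (\<zeta> * S 1 \<omega> + k * X 1 \<omega>)) \<partial>M)" by (simp add: feasible_def not_le)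
    have nn: "\<omega> \<in> space M \<Longrightarrow> 0 \<le> S 1 \<omega>" for \<omega> using S_nonneg[of 1] by simp
    obtain \<zeta>' L where tl: "\<zeta>' \<le> \<zeta>" "tilted_mass \<zeta>' k L = 1"
      "0 < tilted_length \<zeta>' k L"
      by (rule exists_tilt_exponent[OF S_measurable[of 1] X_measurable[of 1] nn X_zero S_nonzero gt]) auto
    define w where "w = tilted_reward \<zeta>' k L / tilted_length \<zeta>' k L"
    have w: "tilted_reward \<zeta>' k L = w * tilted_length \<zeta>' k L"
      using tl(3) by (simp add: w_def)
    have "ereal (- \<zeta>) \<le> ?L"
    proof (rule ereal_le_epsilon2)
      fix \<eta> :: real assume eta: "0 < \<eta>"
      define \<delta> where "\<delta> = \<eta> / 2 / (\<bar>k\<bar> + 1)"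
      have d: "0 < \<delta>" and e2: "0 < \<eta> / 2" using eta by (auto simp: \<delta>_def intro!: divide_pos_pos)
      have kd1: "\<bar>k\<bar> * \<delta> \<le> (\<bar>k\<bar> + 1) * \<delta>" using d by (intro mult_right_mono) auto
      have "\<bar>k\<bar> + 1 \<noteq> 0" by linarith
      then have "(\<bar>k\<bar> + 1) * \<delta> = \<eta> / 2"
        unfolding \<delta>_def by (metis nonzero_mult_div_cancel_left times_divide_eq_right)
      with kd1 have kd: "\<bar>k\<bar> * \<delta> \<le> \<eta> / 2" by (rule ord_le_eq_trans)
      obtain C where C: "0 < C" "\<forall>\<^sub>F t in at_top. C * exp (- (\<zeta>' + k * w + \<eta> / 2) * t) \<le> prob {\<omega> \<in> space M. \<bar>F t \<omega> / t - w\<bar> < \<delta>}"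
        using tilted_lower_bound[OF tl(2,3) w d e2] by blast
      have "\<forall>\<^sub>F t in at_top. ennreal (C * exp (- (\<zeta>' + \<eta>) * t)) \<le> (\<integral>\<^sup>+\<omega>. ennreal (exp (k * F t \<omega>)) \<partial>M)"
        using C(2) eventually_gt_at_top[of 0]
      proof eventually_elim
        case (elim t)
        have t: "0 < t" by fact
        have [measurable]: "F t \<in> borel_measurable M" by (rule F_measurable)
        define A where "A = {\<omega> \<in> space M. \<bar>F t \<omega> / t - w\<bar> < \<delta>}"
        have [measurable]: "A \<in> sets M" unfolding A_def by measurable
        have "C * exp (- (\<zeta>' + \<eta>) * t) \<le> exp ((k * w - \<eta> / 2) * t) * (C * exp (- (\<zeta>' + k * w + \<eta> / 2) * t))"
          by (simp add: exp_add[symmetric] algebra_simps)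
        also have "\<dots> \<le> exp ((k * w - \<eta> / 2) * t) * prob A" using elim by (intro mult_left_mono) (auto simp: A_def)
        finally have "ennreal (C * exp (- (\<zeta>' + \<eta>) * t)) \<le> ennreal (exp ((k * w - \<eta> / 2) * t) * prob A)" by (rule ennreal_leI)
        also have "\<dots> = (\<integral>\<^sup>+\<omega>. ennreal (exp ((k * w - \<eta> / 2) * t)) * indicator A \<omega> \<partial>M)"
          by (simp add: nn_integral_cmult emeasure_eq_measure ennreal_mult')
        also have "\<dots> \<le> (\<integral>\<^sup>+\<omega>. ennreal (exp (k * F t \<omega>)) \<partial>M)"
        proof (rule nn_integral_mono)
          fix \<omega>
          show "ennreal (exp ((k * w - \<eta> / 2) * t)) * indicator A \<omega> \<le> ennreal (exp (k * F t \<omega>))"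
          proof (cases "\<omega> \<in> A")
            case True
            then have "\<bar>k * (F t \<omega> / t - w)\<bar> \<le> \<bar>k\<bar> * \<delta>" by (auto simp: A_def abs_mult intro!: mult_left_mono)
            then have "k * w - \<eta> / 2 \<le> k * (F t \<omega> / t)" using kd by (simp add: algebra_simps abs_le_iff)
            then have "(k * w - \<eta> / 2) * t \<le> k * (F t \<omega> / t) * t" using t by (intro mult_right_mono) auto
            then show ?thesis using True t by (simp add: ennreal_leI)
          qed simp
        qed
        finally show ?case .
      qed
      from Liminf_rate_ge[OF C(1) this] have "ereal (- (\<zeta>' + \<eta>)) \<le> ?L" .
      moreover have "ereal (- \<zeta> - \<eta>) \<le> ereal (- (\<zeta>' + \<eta>))" using tl(1) by simp
      ultimately have "ereal (- \<zeta> - \<eta>) \<le> ?L" by (rule order_trans[rotated])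
      then show "ereal (- \<zeta>) \<le> ?L + ereal \<eta>" by (cases ?L) auto
    qed
    from leD[OF ereal_uminus_le_real[OF this]] z(2) show False by contradiction
  qed
  then show ?thesis by (simp add: ereal_uminus_le_reorder)
qed

end

text \<open>
  Upper bounds depend on the cycle in progress at time \<open>t\<close>, about which the sandwich of \<open>F t\<close> between sums
  of rewards says too little. They enter through an assumption on the moment generating function.
\<close>

locale renewal_reward_bounded = renewal_reward +
  assumes moment_bound: "\<And>\<zeta> k \<eta>. feasible \<zeta> k \<Longrightarrow> 0 < \<eta> \<Longrightarrow>
    \<exists>C>0. \<forall>\<^sub>F t in at_top. (\<integral>\<^sup>+\<omega>. ennreal (exp (k * F t \<omega>)) \<partial>M) \<le> ennreal (C * exp ((\<eta> - \<zeta>) * t))"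
begin

lemma moment_limit:
  "((\<lambda>t. ereal (1 / t) * eln (\<integral>\<^sup>+\<omega>. ennreal (exp (k * F t \<omega>)) \<partial>M)) \<longlongrightarrow> - exponent k) at_top"
    (is "(?f \<longlongrightarrow> _) _")
proof -
  have le: "Limsup at_top ?f \<le> - exponent k"
  proof -
    have "ereal \<zeta> \<le> - Limsup at_top ?f" if z: "feasible \<zeta> k" for \<zeta>
    proof -
      have "Limsup at_top ?f \<le> ereal (- \<zeta>)"
      proof (rule ereal_le_epsilon2)
        fix \<eta> :: real assume "0 < \<eta>"
        from moment_bound[OF z this] obtain C where C: "0 < C"
          "\<forall>\<^sub>F t in at_top. (\<integral>\<^sup>+\<omega>. ennreal (exp (k * F t \<omega>)) \<partial>M) \<le> ennreal (C * exp ((\<eta> - \<zeta>) * t))" by blast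
        from Limsup_rate_le[OF C] show "Limsup at_top ?f \<le> ereal (- \<zeta>) + ereal \<eta>" by simp
      qed
      then show ?thesis by (rule ereal_real_le_uminus)
    qed
    then have "exponent k \<le> - Limsup at_top ?f" unfolding exponent_def by (intro SUP_least) auto
    then show ?thesis by (rule ereal_le_uminus_swap)
  qed
  have ge: "- exponent k \<le> Liminf at_top ?f" by (rule moment_lower_bound)
  have "Liminf at_top ?f \<le> Limsup at_top ?f" by (rule Liminf_le_Limsup) simp
  with le ge show ?thesis by (intro Liminf_eq_Limsup) auto
qed

text \<open>
  The event is a lower half-line for \<open>k < 0\<close> and an upper one for \<open>k > 0\<close>.
\<close>

lemma markov_half_line:
  assumes z: "feasible \<zeta> k" "\<alpha> < \<zeta> + k * x"
  shows "\<exists>C>0. \<forall>\<^sub>F t in at_top. emeasure M {\<omega> \<in> space M. k * x \<le> k * (F t \<omega> / t)} \<le> ennreal (C * exp (- \<alpha> * t))"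
proof -
  obtain C where C: "0 < C" "\<forall>\<^sub>F t in at_top. (\<integral>\<^sup>+\<omega>. ennreal (exp (k * F t \<omega>)) \<partial>M) \<le> ennreal (C * exp (((\<zeta> + k * x - \<alpha>) - \<zeta>) * t))"
    using moment_bound[OF z(1), of "\<zeta> + k * x - \<alpha>"] z(2) by auto
  have "\<forall>\<^sub>F t in at_top. emeasure M {\<omega> \<in> space M. k * x \<le> k * (F t \<omega> / t)} \<le> ennreal (C * exp (- \<alpha> * t))"
    using C(2) eventually_gt_at_top[of 0]
  proof eventually_elim
    case (elim t)
    have [measurable]: "F t \<in> borel_measurable M" by (rule F_measurable)
    have "emeasure M {\<omega> \<in> space M. k * x \<le> k * (F t \<omega> / t)} = (\<integral>\<^sup>+\<omega>. indicator {\<omega> \<in> space M. k * x \<le> k * (F t \<omega> / t)} \<omega> \<partial>M)"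
      by simp
    also have "\<dots> \<le> (\<integral>\<^sup>+\<omega>. ennreal (exp (- (k * x) * t)) * ennreal (exp (k * F t \<omega>)) \<partial>M)"
    proof (rule nn_integral_mono)
      fix \<omega>
      show "indicator {\<omega> \<in> space M. k * x \<le> k * (F t \<omega> / t)} \<omega> \<le> ennreal (exp (- (k * x) * t)) * ennreal (exp (k * F t \<omega>))"
      proof (cases "k * x \<le> k * (F t \<omega> / t)")
        case True
        then have "k * x * t \<le> k * (F t \<omega> / t) * t" using elim by (intro mult_right_mono) auto
        then have "1 \<le> exp (- (k * x) * t) * exp (k * F t \<omega>)" using elim by (simp add: exp_add[symmetric])
        then have "ennreal 1 \<le> ennreal (exp (- (k * x) * t) * exp (k * F t \<omega>))" by (rule ennreal_leI)
        then show ?thesis by (simp add: ennreal_mult indicator_def)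
      qed (simp add: indicator_def)
    qed
    also have "\<dots> = ennreal (exp (- (k * x) * t)) * (\<integral>\<^sup>+\<omega>. ennreal (exp (k * F t \<omega>)) \<partial>M)"
      by (intro nn_integral_cmult) measurable
    also have "\<dots> \<le> ennreal (exp (- (k * x) * t)) * ennreal (C * exp (((\<zeta> + k * x - \<alpha>) - \<zeta>) * t))"
      using elim by (intro mult_left_mono) auto
    also have "\<dots> = ennreal (C * exp (- \<alpha> * t))"
      using C(1) by (simp add: ennreal_mult[symmetric] exp_add[symmetric] algebra_simps)
    finally show ?case .
  qed
  then show ?thesis using C(1) by blast
qed

text \<open>
  Points where the rate exceeds \<open>\<alpha>\<close> are of two kinds: those certified by a feasible pair with \<open>k \<le> 0\<close>, which form
  an open lower half-line, and those certified by one with \<open>k \<ge> 0\<close>, which form an open upper half-line.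
  If the two overlap, two half-lines already cover everything. Otherwise each part of \<open>K\<close> is closed and
  bounded towards the gap, hence contained in the half-line that starts at its own extreme point.
\<close>

lemma closed_upper_bound_aux:
  assumes K: "closed K" and \<alpha>: "0 < \<alpha>" "ereal \<alpha> < (INF w\<in>K. rate w)"
  shows "Limsup at_top (\<lambda>t. ereal (1 / t) * eln (emeasure M {\<omega> \<in> space M. F t \<omega> / t \<in> K})) \<le> ereal (- \<alpha>)"
proof -
  define Um where "Um = {w. \<exists>\<zeta> k. feasible \<zeta> k \<and> k \<le> 0 \<and> \<alpha> < \<zeta> + k * w}"
  define Up where "Up = {w. \<exists>\<zeta> k. feasible \<zeta> k \<and> 0 \<le> k \<and> \<alpha> < \<zeta> + k * w}"
  define small where "small A \<longleftrightarrow> (\<exists>C>0. \<forall>\<^sub>F t in at_top. emeasure M {\<omega> \<in> space M. F t \<omega> / t \<in> A} \<le> ennreal (C * exp (- \<alpha> * t)))"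
    for A :: "real set"
  have [measurable]: "F t \<in> borel_measurable M" for t by (rule F_measurable)
  have K_sub: "K \<subseteq> Um \<union> Up"
  proof
    fix w assume "w \<in> K"
    then have "ereal \<alpha> < rate w" using \<alpha>(2) by (meson INF_lower less_le_trans)
    from less_rate_obtain[OF this] obtain \<zeta> k where "feasible \<zeta> k" "\<alpha> < \<zeta> + k * w" .
    then show "w \<in> Um \<union> Up" unfolding Um_def Up_def by (cases "k \<le> 0") auto
  qed
  have small_mono: "small A" if "small B" "A \<subseteq> B" "B \<in> sets borel" for A B
  proof -
    have [measurable]: "B \<in> sets borel" by fact
    obtain C where C: "0 < C" "\<forall>\<^sub>F t in at_top. emeasure M {\<omega> \<in> space M. F t \<omega> / t \<in> B} \<le> ennreal (C * exp (- \<alpha> * t))"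
      using \<open>small B\<close> unfolding small_def by blast
    have "emeasure M {\<omega> \<in> space M. F t \<omega> / t \<in> A} \<le> emeasure M {\<omega> \<in> space M. F t \<omega> / t \<in> B}" for t
      using that(2) by (intro emeasure_mono) auto
    with C(2) have "\<forall>\<^sub>F t in at_top. emeasure M {\<omega> \<in> space M. F t \<omega> / t \<in> A} \<le> ennreal (C * exp (- \<alpha> * t))"
      by (auto elim!: eventually_mono intro: order_trans)
    with C(1) show ?thesis unfolding small_def by blast
  qed
  have small_Um: "small {..x}" if x: "x \<in> Um" for x
  proof -
    obtain \<zeta> k where z: "feasible \<zeta> k" "k \<le> 0" "\<alpha> < \<zeta> + k * x" using x unfolding Um_def by blast
    obtain C where C: "0 < C" "\<forall>\<^sub>F t in at_top. emeasure M {\<omega> \<in> space M. k * x \<le> k * (F t \<omega> / t)} \<le> ennreal (C * exp (- \<alpha> * t))"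
      using markov_half_line[OF z(1,3)] by blast
    have "emeasure M {\<omega> \<in> space M. F t \<omega> / t \<in> {..x}} \<le> emeasure M {\<omega> \<in> space M. k * x \<le> k * (F t \<omega> / t)}" for t
      using z(2) mult_left_mono_neg[of _ x k] by (intro emeasure_mono) (auto simp del: times_divide_eq_right)
    with C(2) have "\<forall>\<^sub>F t in at_top. emeasure M {\<omega> \<in> space M. F t \<omega> / t \<in> {..x}} \<le> ennreal (C * exp (- \<alpha> * t))"
      by (auto elim!: eventually_mono intro: order_trans)
    with C(1) show ?thesis unfolding small_def by blast
  qed
  have small_Up: "small {x..}" if x: "x \<in> Up" for x
  proof -
    obtain \<zeta> k where z: "feasible \<zeta> k" "0 \<le> k" "\<alpha> < \<zeta> + k * x" using x unfolding Up_def by blast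
    obtain C where C: "0 < C" "\<forall>\<^sub>F t in at_top. emeasure M {\<omega> \<in> space M. k * x \<le> k * (F t \<omega> / t)} \<le> ennreal (C * exp (- \<alpha> * t))"
      using markov_half_line[OF z(1,3)] by blast
    have "emeasure M {\<omega> \<in> space M. F t \<omega> / t \<in> {x..}} \<le> emeasure M {\<omega> \<in> space M. k * x \<le> k * (F t \<omega> / t)}" for t
      using z(2) mult_left_mono[of x _ k] by (intro emeasure_mono) (auto simp del: times_divide_eq_right)
    with C(2) have "\<forall>\<^sub>F t in at_top. emeasure M {\<omega> \<in> space M. F t \<omega> / t \<in> {x..}} \<le> ennreal (C * exp (- \<alpha> * t))"
      by (auto elim!: eventually_mono intro: order_trans)
    with C(1) show ?thesis unfolding small_def by blast
  qed
  have small_Un: "small (A \<union> B)" if sA: "small A" and sB: "small B" and AB: "A \<in> sets borel" "B \<in> sets borel" for A B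
  proof -
    have [measurable]: "A \<in> sets borel" "B \<in> sets borel" by fact+
    obtain C D where C: "0 < C" "\<forall>\<^sub>F t in at_top. emeasure M {\<omega> \<in> space M. F t \<omega> / t \<in> A} \<le> ennreal (C * exp (- \<alpha> * t))"
      and D: "0 < D" "\<forall>\<^sub>F t in at_top. emeasure M {\<omega> \<in> space M. F t \<omega> / t \<in> B} \<le> ennreal (D * exp (- \<alpha> * t))"
      using sA sB unfolding small_def by blast
    have "\<forall>\<^sub>F t in at_top. emeasure M {\<omega> \<in> space M. F t \<omega> / t \<in> A \<union> B} \<le> ennreal ((C + D) * exp (- \<alpha> * t))"
      using C(2) D(2)
    proof eventually_elim
      case (elim t)
      have "emeasure M {\<omega> \<in> space M. F t \<omega> / t \<in> A \<union> B} = emeasure M ({\<omega> \<in> space M. F t \<omega> / t \<in> A} \<union> {\<omega> \<in> space M. F t \<omega> / t \<in> B})"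
        by (rule arg_cong[where f = "emeasure M"]) auto
      also have "\<dots> \<le> emeasure M {\<omega> \<in> space M. F t \<omega> / t \<in> A} + emeasure M {\<omega> \<in> space M. F t \<omega> / t \<in> B}"
        by (rule emeasure_subadditive) measurable
      also have "\<dots> \<le> ennreal (C * exp (- \<alpha> * t)) + ennreal (D * exp (- \<alpha> * t))" by (intro add_mono elim)
      also have "\<dots> = ennreal ((C + D) * exp (- \<alpha> * t))"
        using C(1) D(1) by (simp add: ennreal_plus[symmetric] algebra_simps del: ennreal_plus)
      finally show ?case .
    qed
    then show ?thesis unfolding small_def using C(1) D(1) by (intro exI[of _ "C + D"]) auto
  qed
  have "small K"
  proof (cases "Um \<inter> Up = {}")
    case False
    then obtain x where "x \<in> Um" "x \<in> Up" by blast
    then have "small ({..x} \<union> {x..})" by (intro small_Un small_Um small_Up) auto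
    then show ?thesis by (rule small_mono) auto
  next
    case True
    have open_Um: "open Um" and open_Up: "open Up"
    proof -
      have "Um = (\<Union>(\<zeta>, k)\<in>{(\<zeta>, k). feasible \<zeta> k \<and> k \<le> 0}. {w. \<alpha> < \<zeta> + k * w})"
        "Up = (\<Union>(\<zeta>, k)\<in>{(\<zeta>, k). feasible \<zeta> k \<and> 0 \<le> k}. {w. \<alpha> < \<zeta> + k * w})"
        by (auto simp: Um_def Up_def)
      moreover have "open {w. \<alpha> < \<zeta> + k * w}" for \<zeta> k :: real
        by (intro open_Collect_less continuous_intros)
      ultimately show "open Um" "open Up" by auto
    qed
    have "closed (K \<inter> - Up)" "closed (K \<inter> - Um)" using K open_Um open_Up by auto
    moreover have "K \<inter> - Up = K \<inter> Um" "K \<inter> - Um = K \<inter> Up" using K_sub True by auto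
    ultimately have cl: "closed (K \<inter> Um)" "closed (K \<inter> Up)" by auto
    have bdd_Um: "bdd_above Um"
    proof -
      obtain b where "\<And>\<zeta> k w. feasible \<zeta> k \<Longrightarrow> k \<le> 0 \<Longrightarrow> \<alpha> < \<zeta> + k * w \<Longrightarrow> w \<le> b"
        using lower_points_bounded[OF \<alpha>(1)] by blast
      then show ?thesis by (intro bdd_aboveI[of _ b]) (auto simp: Um_def)
    qed
    have bdd_Up: "bdd_below Up"
    proof (rule bdd_belowI[of _ 0])
      fix w assume "w \<in> Up"
      then obtain \<zeta> k where z: "feasible \<zeta> k" "0 \<le> k" "\<alpha> < \<zeta> + k * w" unfolding Up_def by blast
      have "0 < k * w" using feasible_nonpos[OF z(1,2)] z(3) \<alpha>(1) by linarith
      then show "0 \<le> w" using z(2) by (simp add: zero_less_mult_iff)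
    qed
    have empty: "small {}"
      unfolding small_def by (intro exI[of _ 1]) auto
    have "small (K \<inter> Um)"
    proof (cases "K \<inter> Um = {}")
      case False
      have bdd: "bdd_above (K \<inter> Um)" using bdd_Um by (rule bdd_above_mono) auto
      have "Sup (K \<inter> Um) \<in> K \<inter> Um" by (intro closed_contains_Sup False bdd cl)
      then have "small {..Sup (K \<inter> Um)}" by (intro small_Um) auto
      then show ?thesis by (rule small_mono) (auto intro: cSup_upper bdd)
    qed (use empty in simp)
    moreover have "small (K \<inter> Up)"
    proof (cases "K \<inter> Up = {}")
      case False
      have bdd: "bdd_below (K \<inter> Up)" using bdd_Up by (rule bdd_below_mono) auto
      have "Inf (K \<inter> Up) \<in> K \<inter> Up" by (intro closed_contains_Inf False bdd cl)
      then have "small {Inf (K \<inter> Up)..}" by (intro small_Up) auto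
      then show ?thesis by (rule small_mono) (auto intro: cInf_lower bdd)
    qed (use empty in simp)
    ultimately have "small ((K \<inter> Um) \<union> (K \<inter> Up))" using cl by (intro small_Un) auto
    then show ?thesis using K_sub cl by (intro small_mono[of "(K \<inter> Um) \<union> (K \<inter> Up)" K]) auto
  qed
  then obtain C where "0 < C" "\<forall>\<^sub>F t in at_top. emeasure M {\<omega> \<in> space M. F t \<omega> / t \<in> K} \<le> ennreal (C * exp (- \<alpha> * t))"
    unfolding small_def by blast
  then show ?thesis by (rule Limsup_rate_le)
qed

lemma closed_upper_bound:
  assumes K: "closed K"
  shows "Limsup at_top (\<lambda>t. ereal (1 / t) * eln (emeasure M {\<omega> \<in> space M. F t \<omega> / t \<in> K})) \<le> - (INF w\<in>K. rate w)"
    (is "?L \<le> _")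
proof (rule ccontr)
  assume "\<not> ?thesis"
  then have "- ?L < (INF w\<in>K. rate w)" by (rule ereal_not_le_uminus)
  from ereal_dense2[OF this] obtain \<alpha> where a: "- ?L < ereal \<alpha>" "ereal \<alpha> < (INF w\<in>K. rate w)" by blast
  have "?L \<le> ereal (- \<alpha>)"
  proof (cases "0 < \<alpha>")
    case True then show ?thesis by (rule closed_upper_bound_aux[OF K _ a(2)])
  next
    case False
    have "?L \<le> ereal 0"
    proof (rule Limsup_rate_le)
      show "\<forall>\<^sub>F t in at_top. emeasure M {\<omega> \<in> space M. F t \<omega> / t \<in> K} \<le> ennreal (1 * exp (0 * t))"
        by (simp add: emeasure_eq_measure)
    qed simp
    also have "\<dots> \<le> ereal (- \<alpha>)" using False by simp
    finally show ?thesis .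
  qed
  from leD[OF ereal_real_le_uminus[OF this]] a(1) show False by contradiction
qed

theorem renewal_reward_LDP: "full_LDP M F rate"
  unfolding full_LDP_def
  using rate_lower_semicontinuous open_lower_bound closed_upper_bound by auto

end

section \<open>Gaussian smoothing of radially monotone functions\<close>

definition smoothing :: "real \<Rightarrow> (real \<Rightarrow> real) \<Rightarrow> real \<Rightarrow> real" where
  "smoothing \<sigma> g x = (\<integral>y. g (x + y) * normal_density 0 \<sigma> y \<partial>lborel)"

definition bounded_nonneg :: "(real \<Rightarrow> real) \<Rightarrow> bool" where
  "bounded_nonneg g \<longleftrightarrow> g \<in> borel_measurable borel \<and> (\<forall>x. 0 \<le> g x) \<and> (\<exists>C. \<forall>x. g x \<le> C)"

definition radially_decreasing :: "(real \<Rightarrow> real) \<Rightarrow> bool" where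
  "radially_decreasing g \<longleftrightarrow> (\<forall>x y. \<bar>x\<bar> \<le> \<bar>y\<bar> \<longrightarrow> g y \<le> g x)"

lemma bounded_nonneg_measurable: "bounded_nonneg g \<Longrightarrow> g \<in> borel_measurable borel"
  by (simp add: bounded_nonneg_def)

lemma bounded_nonneg_const: "0 \<le> c \<Longrightarrow> bounded_nonneg (\<lambda>_. c)"
  by (auto simp: bounded_nonneg_def)

lemma bounded_nonneg_mult:
  assumes "bounded_nonneg f" "bounded_nonneg g"
  shows "bounded_nonneg (\<lambda>x. f x * g x)"
proof -
  obtain C D where "\<And>x. f x \<le> C" "\<And>x. g x \<le> D" using assms by (auto simp: bounded_nonneg_def)
  then have "f x * g x \<le> C * D" for x
    using assms order_trans[of 0 "f x" C] by (intro mult_mono) (auto simp: bounded_nonneg_def)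
  with assms show ?thesis by (auto simp: bounded_nonneg_def intro!: borel_measurable_times)
qed

lemma integrable_smoothing:
  assumes [measurable]: "g \<in> borel_measurable borel" and C: "\<And>x. \<bar>g x\<bar> \<le> C" and d: "d \<noteq> 0" and \<sigma>: "0 < \<sigma>"
  shows "integrable lborel (\<lambda>y. g (a + c * y) * normal_density 0 \<sigma> (b + d * y))"
proof (rule Bochner_Integration.integrable_bound)
  show "integrable lborel (\<lambda>y. C * normal_density 0 \<sigma> (b + d * y))"
    using lborel_integrable_real_affine[OF integrable_normal_density[OF \<sigma>] d, of 0 b] by simp
  have "0 \<le> C" using C[of 0] by linarith
  then show "AE y in lborel. norm (g (a + c * y) * normal_density 0 \<sigma> (b + d * y)) \<le> norm (C * normal_density 0 \<sigma> (b + d * y))"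
    using C by (auto simp: abs_mult intro!: mult_right_mono)
qed measurable

lemma bounded_nonneg_smoothing:
  assumes g: "bounded_nonneg g" and \<sigma>: "0 < \<sigma>" shows "bounded_nonneg (smoothing \<sigma> g)"
proof -
  obtain C where C: "\<And>x. g x \<le> C" and nn: "\<And>x. 0 \<le> g x" and [measurable]: "g \<in> borel_measurable borel"
    using g by (auto simp: bounded_nonneg_def)
  have "smoothing \<sigma> g x \<le> C" for x
  proof -
    have "smoothing \<sigma> g x \<le> (\<integral>y. C * normal_density 0 \<sigma> y \<partial>lborel)"
      unfolding smoothing_def
      using integrable_smoothing[of g C 1 \<sigma> x 1 0] C nn \<sigma> integrable_normal_density[OF \<sigma>, of 0]
      by (intro integral_mono) (auto intro!: mult_right_mono)
    then show ?thesis by (simp add: integral_normal_density \<sigma>)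
  qed
  moreover have "0 \<le> smoothing \<sigma> g x" for x
    unfolding smoothing_def using nn by (intro integral_nonneg_AE) auto
  moreover have "smoothing \<sigma> g \<in> borel_measurable borel"
    unfolding smoothing_def[abs_def] by measurable
  ultimately show ?thesis by (auto simp: bounded_nonneg_def)
qed

lemma normal_density_le_iff_abs:
  assumes "\<bar>x\<bar> \<le> \<bar>y\<bar>" shows "normal_density 0 \<sigma> y \<le> normal_density 0 \<sigma> x"
proof -
  have "x\<^sup>2 \<le> y\<^sup>2" using assms by (simp add: abs_le_square_iff)
  then have "- (y\<^sup>2) / (2 * \<sigma>\<^sup>2) \<le> - (x\<^sup>2) / (2 * \<sigma>\<^sup>2)" by (intro divide_right_mono) auto
  then show ?thesis by (auto simp: normal_density_def intro!: divide_right_mono)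
qed

lemma normal_density_even: "normal_density 0 \<sigma> (- x) = normal_density 0 \<sigma> x"
  by (simp add: normal_density_def)

text \<open>
  For \<open>0 \<le> x \<le> y\<close> reflect the integration variable at the midpoint of \<open>x\<close> and \<open>y\<close>. The reflection exchanges
  the Gaussian weights centred at \<open>x\<close> and \<open>y\<close>, and twice the difference of the two values becomes the
  integral of a product of two factors that change sign together at the midpoint.
\<close>

lemma smoothing_radially_decreasing:
  assumes [measurable]: "g \<in> borel_measurable borel" and C: "\<And>x. \<bar>g x\<bar> \<le> C"
    and g: "radially_decreasing g" and \<sigma>: "0 < \<sigma>"
  shows "radially_decreasing (smoothing \<sigma> g)"
proof -
  have even: "g (- x) = g x" for x
    using g by (simp add: radially_decreasing_def order_antisym)
  let ?p = "normal_density 0 \<sigma>"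
  have smooth_even: "smoothing \<sigma> g (- x) = smoothing \<sigma> g x" for x
  proof -
    have "smoothing \<sigma> g (- x) = (\<integral>y. g (- x + (0 + (-1) * y)) * ?p (0 + (-1) * y) \<partial>lborel)"
      unfolding smoothing_def by (subst lborel_integral_real_affine[of "-1" _ 0]) auto
    also have "\<dots> = smoothing \<sigma> g x"
      unfolding smoothing_def using even[of "x + _"] by (intro Bochner_Integration.integral_cong) (auto simp: normal_density_even)
    finally show ?thesis .
  qed
  have mono: "smoothing \<sigma> g y \<le> smoothing \<sigma> g x" if xy: "0 \<le> x" "x \<le> y" for x y
  proof -
    have refl: "?p (u - v) = ?p (v - u)" for u v using normal_density_even[of \<sigma> "v - u"] by simp
    define c where "c = x + y"
    have int: "integrable lborel (\<lambda>z. g z * ?p (z - w))" "integrable lborel (\<lambda>z. g (c - z) * ?p (z - w))" for w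
      using integrable_smoothing[of g C 1 \<sigma> 0 1 "-w"] integrable_smoothing[of g C 1 \<sigma> c "-1" "-w"] C \<sigma> by auto
    have shift: "smoothing \<sigma> g w = (\<integral>z. g z * ?p (z - w) \<partial>lborel)" for w
    proof -
      have "(\<integral>z. g z * ?p (z - w) \<partial>lborel) = (\<integral>z. g (w + 1 * z) * ?p (w + 1 * z - w) \<partial>lborel)"
        by (subst lborel_integral_real_affine[of 1 _ w]) auto
      then show ?thesis by (simp add: smoothing_def)
    qed
    have reflect: "smoothing \<sigma> g w = (\<integral>z. g (c - z) * ?p (z - (c - w)) \<partial>lborel)" for w
    proof -
      have "smoothing \<sigma> g w = (\<integral>z. g (c + (-1) * z) * ?p (c + (-1) * z - w) \<partial>lborel)"
        unfolding shift by (subst lborel_integral_real_affine[of "-1" _ c]) auto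
      also have "\<dots> = (\<integral>z. g (c - z) * ?p (z - (c - w)) \<partial>lborel)"
        using refl[of "c - _" w] by (intro Bochner_Integration.integral_cong) (auto simp: algebra_simps refl[of c])
      finally show ?thesis .
    qed
    have "0 \<le> (\<integral>z. (g z - g (c - z)) * (?p (z - x) - ?p (z - y)) \<partial>lborel)"
    proof (rule integral_nonneg_AE, rule AE_I2)
      fix z
      show "0 \<le> (g z - g (c - z)) * (?p (z - x) - ?p (z - y))"
      proof (cases "2 * z \<le> c")
        case True
        have "\<bar>z\<bar> \<le> \<bar>c - z\<bar>" "\<bar>z - x\<bar> \<le> \<bar>z - y\<bar>" using True xy by (auto simp: c_def)
        then have "g (c - z) \<le> g z" "?p (z - y) \<le> ?p (z - x)"
          using g normal_density_le_iff_abs by (auto simp: radially_decreasing_def)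
        then show ?thesis by simp
      next
        case False
        have "\<bar>c - z\<bar> \<le> \<bar>z\<bar>" "\<bar>z - y\<bar> \<le> \<bar>z - x\<bar>" using False xy by (auto simp: c_def)
        then have "g z \<le> g (c - z)" "?p (z - x) \<le> ?p (z - y)"
          using g normal_density_le_iff_abs by (auto simp: radially_decreasing_def)
        then show ?thesis by (simp add: mult_nonpos_nonpos)
      qed
    qed
    also have "\<dots> = (\<integral>z. (g z * ?p (z - x) - g z * ?p (z - y)) + (g (c - z) * ?p (z - y) - g (c - z) * ?p (z - x)) \<partial>lborel)"
      by (intro Bochner_Integration.integral_cong) (auto simp: algebra_simps)
    also have "\<dots> = (smoothing \<sigma> g x - smoothing \<sigma> g y) + (smoothing \<sigma> g x - smoothing \<sigma> g y)"
    proof -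
      have "c - x = y" "c - y = x" by (auto simp: c_def)
      then have "smoothing \<sigma> g x = (\<integral>z. g (c - z) * ?p (z - y) \<partial>lborel)"
        "smoothing \<sigma> g y = (\<integral>z. g (c - z) * ?p (z - x) \<partial>lborel)"
        using reflect[of x] reflect[of y] by auto
      then show ?thesis
        by (subst Bochner_Integration.integral_add) (simp_all add: int shift[symmetric])
    qed
    finally show ?thesis by simp
  qed
  show ?thesis unfolding radially_decreasing_def
  proof (intro allI impI)
    fix x y :: real assume "\<bar>x\<bar> \<le> \<bar>y\<bar>"
    then have "smoothing \<sigma> g \<bar>y\<bar> \<le> smoothing \<sigma> g \<bar>x\<bar>" by (intro mono) auto
    then show "smoothing \<sigma> g y \<le> smoothing \<sigma> g x" using smooth_even[of x] smooth_even[of y]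
      by (auto simp: abs_if split: if_splits)
  qed
qed

text \<open>
  The transition operator of a Gaussian random walk with multiplicative weight \<open>f\<close>: its \<open>n\<close>-th power,
  applied to \<open>g\<close> at \<open>x\<close>, is the expected product of the weights along \<open>n\<close> steps from \<open>x\<close>, times \<open>g\<close> at the end.
\<close>

definition weighted_step :: "(real \<Rightarrow> real) \<Rightarrow> real \<Rightarrow> (real \<Rightarrow> real) \<Rightarrow> real \<Rightarrow> real" where
  "weighted_step f \<sigma> g x = f x * smoothing \<sigma> g x"

text \<open>
  The sign \<open>s\<close> treats both orientations at once: \<open>s = 1\<close> means decreasing and \<open>s = - 1\<close> increasing in \<open>\<bar>x\<bar>\<close>.
  They correspond to weights \<open>exp (k \<bar>x\<bar>)\<close> with \<open>k \<le> 0\<close> and with \<open>k \<ge> 0\<close>.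
\<close>

definition radial :: "real \<Rightarrow> (real \<Rightarrow> real) \<Rightarrow> bool" where
  "radial s g \<longleftrightarrow> bounded_nonneg g \<and> radially_decreasing (\<lambda>x. s * g x)"

lemma bounded_nonneg_weighted_step:
  "bounded_nonneg f \<Longrightarrow> 0 < \<sigma> \<Longrightarrow> bounded_nonneg g \<Longrightarrow> bounded_nonneg (weighted_step f \<sigma> g)"
  unfolding weighted_step_def[abs_def] by (intro bounded_nonneg_mult bounded_nonneg_smoothing)

lemma bounded_nonneg_weighted_step_power:
  "bounded_nonneg f \<Longrightarrow> 0 < \<sigma> \<Longrightarrow> bounded_nonneg g \<Longrightarrow> bounded_nonneg ((weighted_step f \<sigma> ^^ n) g)"
  by (induction n) (auto intro: bounded_nonneg_weighted_step)

lemma smoothing_cmult: "smoothing \<sigma> (\<lambda>x. c * g x) x = c * smoothing \<sigma> g x"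
  by (simp add: smoothing_def mult.assoc)

lemma radial_weighted_step:
  assumes s: "s = 1 \<or> s = -1" and f: "radial s f" and \<sigma>: "0 < \<sigma>" and g: "radial s g"
  shows "radial s (weighted_step f \<sigma> g)"
proof -
  have bf: "bounded_nonneg f" and bg: "bounded_nonneg g" using f g by (auto simp: radial_def)
  obtain C where C: "\<And>x. 0 \<le> g x" "\<And>x. g x \<le> C" and [measurable]: "g \<in> borel_measurable borel"
    using bg by (auto simp: bounded_nonneg_def)
  have "radially_decreasing (smoothing \<sigma> (\<lambda>x. s * g x))"
    using g C s \<sigma> by (intro smoothing_radially_decreasing[of _ C]) (auto simp: radial_def)
  then have sm: "radially_decreasing (\<lambda>x. s * smoothing \<sigma> g x)" by (simp add: smoothing_cmult[abs_def])
  have fg: "0 \<le> f x" "0 \<le> smoothing \<sigma> g x" for x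
    using bf bounded_nonneg_smoothing[OF bg \<sigma>] by (auto simp: bounded_nonneg_def)
  from s have "radially_decreasing (\<lambda>x. s * weighted_step f \<sigma> g x)"
  proof
    assume "s = 1"
    then show ?thesis using f sm fg
      unfolding radial_def radially_decreasing_def weighted_step_def by (auto intro!: mult_mono)
  next
    assume "s = -1"
    then show ?thesis using f sm fg
      unfolding radial_def radially_decreasing_def weighted_step_def by (simp, blast intro!: mult_mono)
  qed
  then show ?thesis using bounded_nonneg_weighted_step[OF bf \<sigma> bg] by (simp add: radial_def)
qed

lemma radial_weighted_step_power:
  assumes s: "s = 1 \<or> s = -1" and f: "radial s f" and \<sigma>: "0 < \<sigma>"
  shows "radial s ((weighted_step f \<sigma> ^^ n) (\<lambda>_. 1))"
proof (induction n)
  case 0 show ?case using bounded_nonneg_const[of 1] by (auto simp: radial_def radially_decreasing_def)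
next
  case (Suc n) then show ?case using radial_weighted_step[OF s f \<sigma>] by simp
qed

lemma weighted_step_power_le:
  assumes f: "bounded_nonneg f" and \<sigma>: "0 < \<sigma>" and g: "bounded_nonneg g" and c: "0 \<le> c"
    and le: "\<And>x. s * g x \<le> s * c"
  shows "s * (weighted_step f \<sigma> ^^ n) g x \<le> s * (c * (weighted_step f \<sigma> ^^ n) (\<lambda>_. 1) x)"
proof (induction n arbitrary: x)
  case (Suc n)
  let ?u = "(weighted_step f \<sigma> ^^ n) g" and ?v = "(weighted_step f \<sigma> ^^ n) (\<lambda>_. 1)"
  have bu: "bounded_nonneg ?u" and bv: "bounded_nonneg ?v"
    using bounded_nonneg_weighted_step_power[OF f \<sigma>] g bounded_nonneg_const[of 1] by auto
  obtain Cu Cv where C: "\<And>x. \<bar>?u x\<bar> \<le> Cu" "\<And>x. \<bar>?v x\<bar> \<le> Cv"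
    using bu bv by (auto simp: bounded_nonneg_def abs_of_nonneg)
  have int: "integrable lborel (\<lambda>y. ?u (x + y) * normal_density 0 \<sigma> y)" "integrable lborel (\<lambda>y. ?v (x + y) * normal_density 0 \<sigma> y)"
    using integrable_smoothing[OF bounded_nonneg_measurable[OF bu] C(1), of 1 \<sigma> x 1 0]
      integrable_smoothing[OF bounded_nonneg_measurable[OF bv] C(2), of 1 \<sigma> x 1 0] \<sigma> by auto
  have "s * smoothing \<sigma> ?u x = (\<integral>y. s * (?u (x + y) * normal_density 0 \<sigma> y) \<partial>lborel)" by (simp add: smoothing_def)
  also have "\<dots> \<le> (\<integral>y. s * (c * (?v (x + y) * normal_density 0 \<sigma> y)) \<partial>lborel)"
  proof (intro integral_mono integrable_mult_right int)
    fix y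
    show "s * (?u (x + y) * normal_density 0 \<sigma> y) \<le> s * (c * (?v (x + y) * normal_density 0 \<sigma> y))"
      using mult_right_mono[OF Suc.IH[of "x + y"] normal_density_nonneg[of 0 \<sigma> y]] by (simp add: mult.assoc)
  qed
  also have "\<dots> = s * (c * smoothing \<sigma> ?v x)" by (simp add: smoothing_def)
  finally have "f x * (s * smoothing \<sigma> ?u x) \<le> f x * (s * (c * smoothing \<sigma> ?v x))"
    using f by (rule_tac mult_left_mono) (auto simp: bounded_nonneg_def)
  then show ?case by (simp add: weighted_step_def[of f \<sigma> ?u] weighted_step_def[of f \<sigma> ?v] mult_ac)
qed (use le in simp)

text \<open>
  After \<open>m\<close> steps the remaining \<open>n\<close> steps are worth a radial function of the current position. It is
  extremal at the origin, so replacing the position by \<open>0\<close> decouples the two blocks of steps.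
\<close>

lemma weighted_step_power_submult:
  assumes s: "s = 1 \<or> s = -1" and f: "radial s f" and \<sigma>: "0 < \<sigma>"
  shows "s * (weighted_step f \<sigma> ^^ (m + n)) (\<lambda>_. 1) 0
    \<le> s * ((weighted_step f \<sigma> ^^ m) (\<lambda>_. 1) 0 * (weighted_step f \<sigma> ^^ n) (\<lambda>_. 1) 0)"
proof -
  let ?v = "(weighted_step f \<sigma> ^^ n) (\<lambda>_. 1)"
  have v: "radial s ?v" by (rule radial_weighted_step_power[OF s f \<sigma>])
  have "s * (weighted_step f \<sigma> ^^ m) ?v 0 \<le> s * (?v 0 * (weighted_step f \<sigma> ^^ m) (\<lambda>_. 1) 0)"
  proof (rule weighted_step_power_le)
    show "bounded_nonneg f" "bounded_nonneg ?v" using f v by (auto simp: radial_def)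
    then show "0 \<le> ?v 0" by (simp add: bounded_nonneg_def)
    fix x show "s * ?v x \<le> s * ?v 0"
      using v unfolding radial_def radially_decreasing_def by auto
  qed (rule \<sigma>)
  then show ?thesis by (simp add: funpow_add mult.commute)
qed

section \<open>Brownian functionals on a grid\<close>

text \<open>
  The left Riemann sums are integrals of step functions; these converge pointwise by continuity and are
  dominated by a multiple of the indicator of a bounded interval. The grids may end slightly before or
  after \<open>s\<close>, as happens when the grids of two adjacent time intervals are joined.
\<close>

lemma riemann_sum_tendsto:
  fixes f :: "real \<Rightarrow> real" and \<delta> :: "nat \<Rightarrow> real" and N :: "nat \<Rightarrow> nat"
  assumes cont: "continuous_on {0..} f"
    and d: "\<And>n. 0 < \<delta> n" "\<delta> \<longlonglongrightarrow> 0" and N: "(\<lambda>n. real (N n) * \<delta> n) \<longlonglongrightarrow> s"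
  shows "(\<lambda>n. \<delta> n * (\<Sum>j<N n. f (\<delta> n * j))) \<longlonglongrightarrow> (LINT \<tau>:{0..s}|lborel. f \<tau>)"
proof -
  obtain R where R: "\<And>n. real (N n) * \<delta> n \<le> R"
    using convergent_imp_Bseq[OF convergentI[OF N]] unfolding Bseq_def by (auto dest!: abs_le_D1)
  have R0: "0 \<le> R" using R[of 0] d(1)[of 0] by (meson mult_nonneg_nonneg less_imp_le of_nat_0_le_iff order_trans)
  have "compact (f ` {0..R})" using cont by (intro compact_continuous_image continuous_on_subset[OF cont]) auto
  then obtain K where K: "\<And>\<tau>. 0 \<le> \<tau> \<Longrightarrow> \<tau> \<le> R \<Longrightarrow> \<bar>f \<tau>\<bar> \<le> K"
    using compact_imp_bounded bounded_iff by (metis atLeastAtMost_iff image_eqI real_norm_def)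
  have K0: "0 \<le> K" using K[of 0] R0 by force
  define g where "g n \<tau> = (\<Sum>j<N n. f (\<delta> n * j) * indicator {\<delta> n * j..<\<delta> n * Suc j} \<tau>)" for n \<tau>
  have g_meas [measurable]: "g n \<in> borel_measurable lborel" for n unfolding g_def by measurable
  have g_int: "(\<integral>\<tau>. g n \<tau> \<partial>lborel) = \<delta> n * (\<Sum>j<N n. f (\<delta> n * j))" for n
  proof -
    have "\<delta> n * j \<le> \<delta> n * Suc j" for j using d(1)[of n] by (intro mult_left_mono) auto
    then have *: "integrable lborel (indicator {\<delta> n * j..<\<delta> n * Suc j} :: real \<Rightarrow> real)"
      "(\<integral>\<tau>. indicator {\<delta> n * j..<\<delta> n * Suc j} \<tau> \<partial>lborel) = \<delta> n" for j
      by (auto simp: algebra_simps)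
    have "(\<integral>\<tau>. g n \<tau> \<partial>lborel) = (\<Sum>j<N n. \<integral>\<tau>. f (\<delta> n * j) * indicator {\<delta> n * j..<\<delta> n * Suc j} \<tau> \<partial>lborel)"
      unfolding g_def by (intro Bochner_Integration.integral_sum integrable_mult_right *(1))
    also have "\<dots> = (\<Sum>j<N n. f (\<delta> n * j) * \<delta> n)"
      unfolding integral_mult_right_zero *(2) ..
    finally show ?thesis by (simp add: sum_distrib_left mult.commute)
  qed
  have g_eq: "g n \<tau> = (if 0 \<le> \<tau> \<and> nat \<lfloor>\<tau> / \<delta> n\<rfloor> < N n then f (\<delta> n * nat \<lfloor>\<tau> / \<delta> n\<rfloor>) else 0)" for n \<tau>
  proof -
    have iff: "\<tau> \<in> {\<delta> n * j..<\<delta> n * Suc j} \<longleftrightarrow> 0 \<le> \<tau> \<and> j = nat \<lfloor>\<tau> / \<delta> n\<rfloor>" for j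
    proof -
      have "\<tau> \<in> {\<delta> n * j..<\<delta> n * Suc j} \<longleftrightarrow> real j \<le> \<tau> / \<delta> n \<and> \<tau> / \<delta> n < real j + 1"
        using d(1)[of n] by (auto simp: field_simps)
      also have "\<dots> \<longleftrightarrow> 0 \<le> \<tau> / \<delta> n \<and> \<lfloor>\<tau> / \<delta> n\<rfloor> = int j"
        by (auto simp: floor_eq_iff)
      also have "\<dots> \<longleftrightarrow> 0 \<le> \<tau> \<and> j = nat \<lfloor>\<tau> / \<delta> n\<rfloor>"
        using d(1)[of n] by (auto simp: zero_le_divide_iff)
      finally show ?thesis .
    qed
    have "g n \<tau> = (\<Sum>j<N n. if j = nat \<lfloor>\<tau> / \<delta> n\<rfloor> then (if 0 \<le> \<tau> then f (\<delta> n * j) else 0) else 0)"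
      unfolding g_def indicator_def iff by (intro sum.cong) auto
    then show ?thesis by (simp add: sum.delta)
  qed
  have g_bound: "\<bar>g n \<tau>\<bar> \<le> K * indicator {0..R} \<tau>" for n \<tau>
  proof (cases "0 \<le> \<tau> \<and> nat \<lfloor>\<tau> / \<delta> n\<rfloor> < N n")
    case True
    define j where "j = nat \<lfloor>\<tau> / \<delta> n\<rfloor>"
    have q0: "0 \<le> \<tau> / \<delta> n" using True d(1)[of n] by simp
    then have j: "real j \<le> \<tau> / \<delta> n" "\<tau> / \<delta> n < real j + 1" unfolding j_def by linarith+
    then have j': "\<delta> n * j \<le> \<tau>" "\<tau> < (real j + 1) * \<delta> n" using d(1)[of n] by (simp_all add: field_simps)
    have "(real j + 1) * \<delta> n \<le> real (N n) * \<delta> n" using True d(1)[of n] unfolding j_def by (intro mult_right_mono) auto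
    then have tR: "\<tau> \<le> R" using j' R[of n] by linarith
    have "\<bar>f (\<delta> n * j)\<bar> \<le> K" using d(1)[of n] j' tR by (intro K) auto
    then show ?thesis using True tR unfolding g_eq j_def by simp
  qed (use K0 in \<open>auto simp: g_eq\<close>)
  have lim: "(\<lambda>n. \<integral>\<tau>. g n \<tau> \<partial>lborel) \<longlonglongrightarrow> (\<integral>\<tau>. indicator {0..s} \<tau> *\<^sub>R f \<tau> \<partial>lborel)"
  proof (rule integral_dominated_convergence[where w = "\<lambda>\<tau>. K * indicator {0..R} \<tau>"])
    show "(\<lambda>\<tau>. indicator {0..s} \<tau> *\<^sub>R f \<tau>) \<in> borel_measurable lborel"
      using borel_measurable_continuous_on_indicator[OF _ continuous_on_subset[OF cont, of "{0..s}"]] by auto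
    have "AE \<tau> in lborel. \<tau> \<noteq> s" by (rule AE_lborel_singleton)
    then show "AE \<tau> in lborel. (\<lambda>n. g n \<tau>) \<longlonglongrightarrow> indicator {0..s} \<tau> *\<^sub>R f \<tau>"
    proof eventually_elim
      case (elim \<tau>)
      consider "\<tau> < 0" | "0 \<le> \<tau>" "\<tau> < s" | "0 \<le> \<tau>" "s < \<tau>" using elim by linarith
      then show ?case
      proof cases
        case 1 then show ?thesis by (simp add: g_eq)
      next
        case 2
        have "(\<lambda>n. real (N n) * \<delta> n - \<delta> n) \<longlonglongrightarrow> s - 0" by (intro tendsto_intros N d)
        then have "\<forall>\<^sub>F n in sequentially. \<tau> < real (N n) * \<delta> n - \<delta> n" using 2 by (intro order_tendstoD(1)[of _ s]) auto
        then have ev: "\<forall>\<^sub>F n in sequentially. f (\<delta> n * nat \<lfloor>\<tau> / \<delta> n\<rfloor>) = g n \<tau>"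
        proof eventually_elim
          case (elim n)
          have "\<tau> / \<delta> n < real (N n) - 1" using elim d(1)[of n] by (simp add: field_simps)
          moreover have "0 \<le> \<tau> / \<delta> n" using 2 d(1)[of n] by simp
          ultimately have "nat \<lfloor>\<tau> / \<delta> n\<rfloor> < N n" by linarith
          then show ?case using 2 by (simp add: g_eq)
        qed
        have close: "\<bar>\<delta> n * nat \<lfloor>\<tau> / \<delta> n\<rfloor> - \<tau>\<bar> \<le> \<delta> n" for n
        proof -
          have "0 \<le> \<tau> / \<delta> n" using 2 d(1)[of n] by simp
          then have "real (nat \<lfloor>\<tau> / \<delta> n\<rfloor>) \<le> \<tau> / \<delta> n" "\<tau> / \<delta> n \<le> real (nat \<lfloor>\<tau> / \<delta> n\<rfloor>) + 1" by linarith+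
          then show ?thesis using d(1)[of n] by (simp add: field_simps abs_le_iff)
        qed
        have "(\<lambda>n. \<delta> n * nat \<lfloor>\<tau> / \<delta> n\<rfloor> - \<tau>) \<longlonglongrightarrow> 0"
          by (rule Lim_null_comparison[OF _ d(2)]) (use close in auto)
        then have "(\<lambda>n. \<delta> n * nat \<lfloor>\<tau> / \<delta> n\<rfloor>) \<longlonglongrightarrow> \<tau>" by (simp add: LIM_zero_iff)
        moreover have "\<delta> n * nat \<lfloor>\<tau> / \<delta> n\<rfloor> \<in> {0..}" for n using d(1)[of n] by (simp add: less_imp_le)
        ultimately have "(\<lambda>n. f (\<delta> n * nat \<lfloor>\<tau> / \<delta> n\<rfloor>)) \<longlonglongrightarrow> f \<tau>"
          using cont 2 by (intro continuous_on_tendsto_compose[OF cont]) auto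
        from Lim_transform_eventually[OF this ev] show ?thesis using 2 by simp
      next
        case 3
        have "\<forall>\<^sub>F n in sequentially. real (N n) * \<delta> n < \<tau>" using 3 by (intro order_tendstoD(2)[OF N])
        then have "\<forall>\<^sub>F n in sequentially. 0 = g n \<tau>"
        proof eventually_elim
          case (elim n)
          then have "real (N n) < \<tau> / \<delta> n" using d(1)[of n] by (simp add: field_simps)
          then have "\<not> nat \<lfloor>\<tau> / \<delta> n\<rfloor> < N n" by linarith
          then show ?case by (simp add: g_eq)
        qed
        from Lim_transform_eventually[OF tendsto_const this] show ?thesis using 3 by simp
      qed
    qed
  qed (use g_bound R0 in auto)
  then show ?thesis by (simp add: g_int set_lebesgue_integral_def)
qed

text \<open>
  Fubini's theorem for independent variables, phrased on the original probability space.
\<close>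

lemma (in prob_space) nn_integral_indep_pair:
  assumes ind: "indep_var S X T Y"
    and f: "case_prod f \<in> borel_measurable (S \<Otimes>\<^sub>M T)"
  shows "(\<integral>\<^sup>+\<omega>. f (X \<omega>) (Y \<omega>) \<partial>M) = (\<integral>\<^sup>+\<omega>. (\<integral>\<^sup>+\<omega>'. f (X \<omega>) (Y \<omega>') \<partial>M) \<partial>M)"
proof -
  have X [measurable]: "random_variable S X" and Y [measurable]: "random_variable T Y"
    and eq: "distr M S X \<Otimes>\<^sub>M distr M T Y = distr M (S \<Otimes>\<^sub>M T) (\<lambda>\<omega>. (X \<omega>, Y \<omega>))"
    using ind unfolding indep_var_distribution_eq by auto
  interpret PY: prob_space "distr M T Y" by (rule prob_space_distr) fact
  have f2: "f x \<in> borel_measurable T" if "x \<in> space S" for x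
    using measurable_Pair2[OF f that] by simp
  have f': "case_prod f \<in> borel_measurable (distr M S X \<Otimes>\<^sub>M distr M T Y)"
    using f by (simp cong: measurable_cong_sets)
  have f'': "case_prod f \<in> borel_measurable (S \<Otimes>\<^sub>M distr M T Y)"
    using f by (simp cong: measurable_cong_sets)
  have "(\<integral>\<^sup>+\<omega>. f (X \<omega>) (Y \<omega>) \<partial>M) = (\<integral>\<^sup>+p. case_prod f p \<partial>distr M (S \<Otimes>\<^sub>M T) (\<lambda>\<omega>. (X \<omega>, Y \<omega>)))"
    by (subst nn_integral_distr) (auto intro: f)
  also have "\<dots> = (\<integral>\<^sup>+x. \<integral>\<^sup>+y. f x y \<partial>distr M T Y \<partial>distr M S X)"
    unfolding eq[symmetric] by (subst PY.nn_integral_fst[OF f', symmetric]) simp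
  also have "\<dots> = (\<integral>\<^sup>+\<omega>. \<integral>\<^sup>+y. f (X \<omega>) y \<partial>distr M T Y \<partial>M)"
    using PY.borel_measurable_nn_integral_fst[OF f''] by (subst nn_integral_distr) auto
  also have "\<dots> = (\<integral>\<^sup>+\<omega>. (\<integral>\<^sup>+\<omega>'. f (X \<omega>) (Y \<omega>') \<partial>M) \<partial>M)"
    using measurable_space[OF X] f2 by (intro nn_integral_cong nn_integral_distr Y) (simp cong: measurable_cong_sets)
  finally show ?thesis .
qed

definition mesh :: "nat \<Rightarrow> real" where "mesh n = 1 / Suc n"
definition mesh_count :: "real \<Rightarrow> nat \<Rightarrow> nat" where "mesh_count s n = nat \<lfloor>s * Suc n\<rfloor>"

lemma mesh_pos: "0 < mesh n" by (simp add: mesh_def)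
lemma mesh_tendsto: "mesh \<longlonglongrightarrow> 0"
  unfolding mesh_def[abs_def] using LIMSEQ_inverse_real_of_nat by (simp add: inverse_eq_divide)

lemma mesh_count_tendsto:
  assumes "0 \<le> s" shows "(\<lambda>n. real (mesh_count s n) * mesh n) \<longlonglongrightarrow> s"
proof -
  have "\<bar>real (mesh_count s n) * mesh n - s\<bar> \<le> mesh n" for n
  proof -
    have "0 \<le> s * Suc n" using assms by simp
    then have "real (mesh_count s n) \<le> s * Suc n" "s * Suc n \<le> real (mesh_count s n) + 1"
      unfolding mesh_count_def by linarith+
    then have "\<bar>real (mesh_count s n) - s * Suc n\<bar> \<le> 1" by linarith
    moreover have "real (mesh_count s n) * mesh n - s = (real (mesh_count s n) - s * Suc n) / Suc n"
      by (simp add: mesh_def diff_divide_distrib del: of_nat_Suc)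
    ultimately show ?thesis by (simp add: mesh_def abs_divide divide_right_mono)
  qed
  then have "(\<lambda>n. real (mesh_count s n) * mesh n - s) \<longlonglongrightarrow> 0"
    by (intro Lim_null_comparison[OF _ mesh_tendsto]) auto
  then show ?thesis by (simp add: LIM_zero_iff)
qed

locale brownian_path = prob_space M for M :: "'a measure" +
  fixes W :: "real \<Rightarrow> 'a \<Rightarrow> real"
  assumes bm: "standard_brownian_motion M W"
begin

lemma W_measurable: "0 \<le> t \<Longrightarrow> W t \<in> borel_measurable M"
  using bm by (simp add: standard_brownian_motion_def)

lemma W_zero: "\<omega> \<in> space M \<Longrightarrow> W 0 \<omega> = 0"
  using bm by (simp add: standard_brownian_motion_def)

lemma W_continuous: "\<omega> \<in> space M \<Longrightarrow> continuous_on {0..} (\<lambda>t. W t \<omega>)"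
  using bm by (simp add: standard_brownian_motion_def)

definition incr :: "real \<Rightarrow> nat \<Rightarrow> 'a \<Rightarrow> real" where
  "incr \<delta> i \<omega> = W (\<delta> * Suc i) \<omega> - W (\<delta> * i) \<omega>"

lemma incr_measurable: "0 < \<delta> \<Longrightarrow> incr \<delta> i \<in> borel_measurable M"
  unfolding incr_def[abs_def] by (intro borel_measurable_diff W_measurable) auto

lemma incr_indep:
  assumes "0 < \<delta>" shows "indep_vars (\<lambda>_. borel) (incr \<delta>) {..<n}"
proof -
  have "mono_on {..n} (\<lambda>i::nat. \<delta> * i)" using assms by (intro mono_onI mult_left_mono) auto
  moreover have "0 \<le> \<delta> * real 0" by simp
  ultimately show ?thesis
    using bm[unfolded standard_brownian_motion_def, THEN conjunct2, THEN conjunct2, THEN conjunct2, THEN conjunct2,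
        rule_format, of "\<lambda>i. \<delta> * real i" n]
    by (simp add: incr_def[abs_def])
qed

lemma incr_distr:
  assumes "0 < \<delta>" shows "distr M borel (incr \<delta> i) = density lborel (normal_density 0 (sqrt \<delta>))"
proof -
  have lt: "\<delta> * i < \<delta> * Suc i" "0 \<le> \<delta> * i" using assms by auto
  have "distributed M lborel (\<lambda>\<omega>. W (\<delta> * Suc i) \<omega> - W (\<delta> * i) \<omega>) (normal_density 0 (sqrt (\<delta> * Suc i - \<delta> * i)))"
    using bm lt unfolding standard_brownian_motion_def by blast
  then have "distr M lborel (incr \<delta> i) = density lborel (normal_density 0 (sqrt \<delta>))"
    by (simp add: distributed_def incr_def[abs_def] algebra_simps)
  moreover have "distr M lborel (incr \<delta> i) = distr M borel (incr \<delta> i)" by (rule distr_cong) auto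
  ultimately show ?thesis by simp
qed

lemma W_grid:
  assumes "\<omega> \<in> space M" shows "W (\<delta> * real j) \<omega> = (\<Sum>i<j. incr \<delta> i \<omega>)"
  using sum_lessThan_telescope[of "\<lambda>i. W (\<delta> * i) \<omega>" j] W_zero[OF assms] by (simp add: incr_def)

text \<open>
  The increments over the grid are independent centred normal variables of variance \<open>\<delta>\<close>, so the path on
  the grid is a Gaussian random walk. The induction integrates out the last increment first, which turns
  the final function \<open>g\<close> into one step of the operator.
\<close>

lemma expectation_grid:
  assumes f: "bounded_nonneg f" and g: "bounded_nonneg g" and \<delta>: "0 < \<delta>"
  shows "(\<integral>\<^sup>+\<omega>. ennreal ((\<Prod>j<n. f (W (\<delta> * real j) \<omega>)) * g (W (\<delta> * n) \<omega>)) \<partial>M)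
    = ennreal ((weighted_step f (sqrt \<delta>) ^^ n) g 0)"
  using g
proof (induction n arbitrary: g)
  case 0
  have "(\<integral>\<^sup>+\<omega>. ennreal (g (W 0 \<omega>)) \<partial>M) = (\<integral>\<^sup>+\<omega>. ennreal (g 0) \<partial>M)"
    by (intro nn_integral_cong) (simp add: W_zero)
  then show ?case by (simp add: emeasure_space_1)
next
  case (Suc n)
  have \<sigma>: "0 < sqrt \<delta>" using \<delta> by simp
  have fm [measurable]: "f \<in> borel_measurable borel" and gm [measurable]: "g \<in> borel_measurable borel"
    and f0: "\<And>x. 0 \<le> f x" and g0: "\<And>x. 0 \<le> g x"
    using f Suc.prems by (auto simp: bounded_nonneg_def)
  obtain C where C: "\<And>x. \<bar>g x\<bar> \<le> C" using Suc.prems by (auto simp: bounded_nonneg_def)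
  define A where "A v = (\<Prod>j<n. f (\<Sum>i<j. v i)) * f (\<Sum>i<n. v i)" for v :: "nat \<Rightarrow> real"
  have A0: "0 \<le> A v" for v unfolding A_def using f0 by (intro mult_nonneg_nonneg prod_nonneg) auto
  define \<Psi> where "\<Psi> v d = ennreal (A v * g ((\<Sum>i<n. v i) + d))" for v d
  have comp [measurable]: "(\<lambda>v. \<Sum>i<j. v i :: real) \<in> borel_measurable (PiM {..<n} (\<lambda>_. borel))" if "j \<le> n" for j :: nat
  proof (rule borel_measurable_sum)
    fix i assume "i \<in> {..<j}"
    with that show "(\<lambda>v. v i) \<in> borel_measurable (PiM {..<n} (\<lambda>_. borel))"
      by (intro measurable_component_singleton) auto
  qed
  have A_meas [measurable]: "A \<in> borel_measurable (PiM {..<n} (\<lambda>_. borel))"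
    unfolding A_def by (intro borel_measurable_times borel_measurable_prod measurable_compose[OF comp fm]) auto
  have Psi_meas: "(\<lambda>(v, w). \<Psi> v (w n)) \<in> borel_measurable (PiM {..<n} (\<lambda>_. borel) \<Otimes>\<^sub>M PiM {n} (\<lambda>_. borel))"
    using comp[of n] unfolding \<Psi>_def split_beta' by measurable
  have ind: "indep_var (PiM {..<n} (\<lambda>_. borel)) (\<lambda>\<omega>. \<lambda>i\<in>{..<n}. incr \<delta> i \<omega>) (PiM {n} (\<lambda>_. borel)) (\<lambda>\<omega>. \<lambda>i\<in>{n}. incr \<delta> i \<omega>)"
    by (rule indep_var_restrict[OF incr_indep[OF \<delta>, of "Suc n"]]) auto
  have A_W: "A (\<lambda>i\<in>{..<n}. incr \<delta> i \<omega>) = (\<Prod>j<n. f (W (\<delta> * real j) \<omega>)) * f (W (\<delta> * n) \<omega>)" if om: "\<omega> \<in> space M" for \<omega>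
    unfolding A_def W_grid[OF om] by (intro arg_cong2[where f = "(*)"] prod.cong arg_cong[where f = f] sum.cong) auto
  have inner: "(\<integral>\<^sup>+\<omega>'. \<Psi> v (incr \<delta> n \<omega>') \<partial>M) = ennreal (A v * smoothing (sqrt \<delta>) g (\<Sum>i<n. v i))" for v
  proof -
    have "(\<integral>\<^sup>+\<omega>'. \<Psi> v (incr \<delta> n \<omega>') \<partial>M) = (\<integral>\<^sup>+d. \<Psi> v d \<partial>distr M borel (incr \<delta> n))"
      unfolding \<Psi>_def by (subst nn_integral_distr[OF incr_measurable[OF \<delta>]]) measurable
    also have "\<dots> = (\<integral>\<^sup>+d. ennreal (A v * (g ((\<Sum>i<n. v i) + d) * normal_density 0 (sqrt \<delta>) d)) \<partial>lborel)"
      unfolding incr_distr[OF \<delta>] \<Psi>_def using A0 g0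
      by (subst nn_integral_density) (auto simp: ennreal_mult[symmetric] mult_ac intro!: nn_integral_cong)
    also have "\<dots> = ennreal (\<integral>d. A v * (g ((\<Sum>i<n. v i) + d) * normal_density 0 (sqrt \<delta>) d) \<partial>lborel)"
      using integrable_smoothing[OF gm C, of 1 "sqrt \<delta>" "\<Sum>i<n. v i" 1 0] \<sigma> A0 g0
      by (intro nn_integral_eq_integral) auto
    finally show ?thesis by (simp add: smoothing_def)
  qed
  have "(\<integral>\<^sup>+\<omega>. ennreal ((\<Prod>j<Suc n. f (W (\<delta> * real j) \<omega>)) * g (W (\<delta> * Suc n) \<omega>)) \<partial>M)
      = (\<integral>\<^sup>+\<omega>. \<Psi> (\<lambda>i\<in>{..<n}. incr \<delta> i \<omega>) (incr \<delta> n \<omega>) \<partial>M)"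
  proof (rule nn_integral_cong)
    fix \<omega> assume om: "\<omega> \<in> space M"
    have "W (\<delta> * Suc n) \<omega> = (\<Sum>i<n. (\<lambda>i\<in>{..<n}. incr \<delta> i \<omega>) i) + incr \<delta> n \<omega>"
      unfolding W_grid[OF om] by simp
    then show "ennreal ((\<Prod>j<Suc n. f (W (\<delta> * real j) \<omega>)) * g (W (\<delta> * Suc n) \<omega>)) = \<Psi> (\<lambda>i\<in>{..<n}. incr \<delta> i \<omega>) (incr \<delta> n \<omega>)"
      unfolding \<Psi>_def A_W[OF om] by simp
  qed
  also have "\<dots> = (\<integral>\<^sup>+\<omega>. \<integral>\<^sup>+\<omega>'. \<Psi> (\<lambda>i\<in>{..<n}. incr \<delta> i \<omega>) (incr \<delta> n \<omega>') \<partial>M \<partial>M)"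
    using nn_integral_indep_pair[OF ind Psi_meas] by simp
  also have "\<dots> = (\<integral>\<^sup>+\<omega>. ennreal ((\<Prod>j<n. f (W (\<delta> * real j) \<omega>)) * weighted_step f (sqrt \<delta>) g (W (\<delta> * n) \<omega>)) \<partial>M)"
  proof (rule nn_integral_cong)
    fix \<omega> assume om: "\<omega> \<in> space M"
    have "W (\<delta> * n) \<omega> = (\<Sum>i<n. (\<lambda>i\<in>{..<n}. incr \<delta> i \<omega>) i)" unfolding W_grid[OF om] by simp
    then show "(\<integral>\<^sup>+\<omega>'. \<Psi> (\<lambda>i\<in>{..<n}. incr \<delta> i \<omega>) (incr \<delta> n \<omega>') \<partial>M)
      = ennreal ((\<Prod>j<n. f (W (\<delta> * real j) \<omega>)) * weighted_step f (sqrt \<delta>) g (W (\<delta> * n) \<omega>))"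
      unfolding inner A_W[OF om] by (simp add: weighted_step_def mult.assoc)
  qed
  also have "\<dots> = ennreal ((weighted_step f (sqrt \<delta>) ^^ n) (weighted_step f (sqrt \<delta>) g) 0)"
    by (rule Suc.IH) (rule bounded_nonneg_weighted_step[OF f \<sigma> Suc.prems])
  finally show ?case by (simp add: funpow_swap1)
qed

definition path_integral :: "(real \<Rightarrow> real) \<Rightarrow> real \<Rightarrow> 'a \<Rightarrow> real" where
  "path_integral h s \<omega> = (LINT \<tau>:{0..s}|lborel. h (W \<tau> \<omega>))"

lemma path_integral_tendsto:
  assumes h: "continuous_on UNIV h" and om: "\<omega> \<in> space M"
    and d: "\<And>n. 0 < \<delta> n" "\<delta> \<longlonglongrightarrow> 0" and N: "(\<lambda>n. real (N n) * \<delta> n) \<longlonglongrightarrow> s"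
  shows "(\<lambda>n. \<delta> n * (\<Sum>j<N n. h (W (\<delta> n * real j) \<omega>))) \<longlonglongrightarrow> path_integral h s \<omega>"
  unfolding path_integral_def
  by (rule riemann_sum_tendsto[OF continuous_on_compose2[OF h W_continuous[OF om]] d N]) auto

lemma grid_sum_measurable:
  assumes h: "continuous_on UNIV h" and \<delta>: "0 < \<delta>"
  shows "(\<lambda>\<omega>. \<delta> * (\<Sum>j<N. h (W (\<delta> * real j) \<omega>))) \<in> borel_measurable M"
proof -
  have hm: "h \<in> borel_measurable borel" by (rule borel_measurable_continuous_onI[OF h])
  show ?thesis using \<delta>
    by (intro borel_measurable_times borel_measurable_const borel_measurable_sum measurable_compose[OF W_measurable hm]) auto
qed

lemma path_integral_measurable:
  assumes h: "continuous_on UNIV h" and s: "0 \<le> s"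
  shows "path_integral h s \<in> borel_measurable M"
  by (rule borel_measurable_LIMSEQ_real[OF path_integral_tendsto[OF h _ mesh_pos mesh_tendsto mesh_count_tendsto[OF s]]
        grid_sum_measurable[OF h mesh_pos]])

text \<open>
  The inequality for the discretised functional is the one for powers of the weighted step operator; it
  passes to the limit of a fine mesh by dominated convergence, for which the upper bound on \<open>k h\<close> serves.
\<close>

lemma expectation_path_integral_submult:
  assumes h: "continuous_on UNIV h" and mono: "\<And>x y. \<bar>x\<bar> \<le> \<bar>y\<bar> \<Longrightarrow> h x \<le> h y"
    and bound: "\<And>x. k * h x \<le> b" and b: "0 \<le> b"
    and sign: "s = 1 \<and> k \<le> 0 \<or> s = -1 \<and> 0 \<le> k"
    and uv: "0 \<le> u" "0 \<le> v"
  shows "s * expectation (\<lambda>\<omega>. exp (k * path_integral h (u + v) \<omega>))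
    \<le> s * (expectation (\<lambda>\<omega>. exp (k * path_integral h u \<omega>)) * expectation (\<lambda>\<omega>. exp (k * path_integral h v \<omega>)))"
proof -
  define p where "p n N = expectation (\<lambda>\<omega>. exp (k * (mesh n * (\<Sum>j<N. h (W (mesh n * real j) \<omega>)))))" for n N
  have hm [measurable]: "h \<in> borel_measurable borel" by (rule borel_measurable_continuous_onI[OF h])
  have exponent_le: "k * (mesh n * (\<Sum>j<N. h (W (mesh n * real j) \<omega>))) \<le> real N * mesh n * b" for n N \<omega>
  proof -
    have "k * (mesh n * (\<Sum>j<N. h (W (mesh n * real j) \<omega>))) = mesh n * (\<Sum>j<N. k * h (W (mesh n * real j) \<omega>))"
      by (simp add: sum_distrib_left mult_ac)
    also have "\<dots> \<le> mesh n * (\<Sum>j<N. b)"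
      using bound mesh_pos[of n] by (intro mult_left_mono sum_mono) auto
    finally show ?thesis by (simp add: mult_ac)
  qed
  have lim: "(\<lambda>n. p n (N n)) \<longlonglongrightarrow> expectation (\<lambda>\<omega>. exp (k * path_integral h t \<omega>))"
    if N: "(\<lambda>n. real (N n) * mesh n) \<longlonglongrightarrow> t" and t: "0 \<le> t" for N t
  proof -
    obtain R where R: "\<And>n. real (N n) * mesh n \<le> R"
      using convergent_imp_Bseq[OF convergentI[OF N]] unfolding Bseq_def by (auto dest!: abs_le_D1)
    show ?thesis unfolding p_def
    proof (rule integral_dominated_convergence[where w = "\<lambda>_. exp (R * b)"])
      show "(\<lambda>\<omega>. exp (k * path_integral h t \<omega>)) \<in> borel_measurable M"
        using path_integral_measurable[OF h t] by measurable
      show "(\<lambda>\<omega>. exp (k * (mesh n * (\<Sum>j<N n. h (W (mesh n * real j) \<omega>))))) \<in> borel_measurable M" for n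
        using grid_sum_measurable[OF h mesh_pos, of n "N n"] by measurable
      show "AE \<omega> in M. (\<lambda>n. exp (k * (mesh n * (\<Sum>j<N n. h (W (mesh n * real j) \<omega>))))) \<longlonglongrightarrow> exp (k * path_integral h t \<omega>)"
        by (intro AE_I2 tendsto_intros path_integral_tendsto[OF h _ mesh_pos mesh_tendsto N])
      show "AE \<omega> in M. norm (exp (k * (mesh n * (\<Sum>j<N n. h (W (mesh n * real j) \<omega>))))) \<le> exp (R * b)" for n
        using order_trans[OF exponent_le mult_right_mono[OF R b]] by (intro AE_I2) simp
    qed simp
  qed
  have p_eq: "p n N = (weighted_step (\<lambda>x. exp (k * mesh n * h x)) (sqrt (mesh n)) ^^ N) (\<lambda>_. 1) 0" for n N
  proof -
    let ?f = "\<lambda>x. exp (k * mesh n * h x)"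
    have f: "bounded_nonneg ?f"
    proof -
      have "?f x \<le> exp (mesh n * b)" for x
        using mult_left_mono[OF bound[of x] less_imp_le[OF mesh_pos[of n]]] by (simp add: mult_ac)
      then show ?thesis by (auto simp: bounded_nonneg_def)
    qed
    have nn: "0 \<le> (weighted_step ?f (sqrt (mesh n)) ^^ N) (\<lambda>_. 1) 0"
      using bounded_nonneg_weighted_step_power[OF f _ bounded_nonneg_const[of 1], of "sqrt (mesh n)" N] mesh_pos[of n]
      by (auto simp: bounded_nonneg_def)
    have "(\<Prod>j<N. ?f (W (mesh n * real j) \<omega>)) = exp (k * (mesh n * (\<Sum>j<N. h (W (mesh n * real j) \<omega>))))" for \<omega>
      by (simp add: exp_sum[symmetric] sum_distrib_left mult_ac)
    then have "(\<integral>\<^sup>+\<omega>. ennreal (exp (k * (mesh n * (\<Sum>j<N. h (W (mesh n * real j) \<omega>))))) \<partial>M)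
        = ennreal ((weighted_step ?f (sqrt (mesh n)) ^^ N) (\<lambda>_. 1) 0)"
      using expectation_grid[OF f bounded_nonneg_const[of 1] mesh_pos[of n], of N] by simp
    then have "has_bochner_integral M (\<lambda>\<omega>. exp (k * (mesh n * (\<Sum>j<N. h (W (mesh n * real j) \<omega>)))))
        ((weighted_step ?f (sqrt (mesh n)) ^^ N) (\<lambda>_. 1) 0)"
      using grid_sum_measurable[OF h mesh_pos, of n N] nn by (intro has_bochner_integral_nn_integral) auto
    then show ?thesis unfolding p_def by (rule has_bochner_integral_integral_eq)
  qed
  have submult: "s * p n (a + c) \<le> s * (p n a * p n c)" for n a c
    unfolding p_eq
  proof (rule weighted_step_power_submult)
    let ?f = "\<lambda>x. exp (k * mesh n * h x)"
    show "s = 1 \<or> s = -1" using sign by auto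
    show "0 < sqrt (mesh n)" using mesh_pos by simp
    have "?f x \<le> exp (mesh n * b)" for x
      using mult_left_mono[OF bound[of x] less_imp_le[OF mesh_pos[of n]]] by (simp add: mult_ac)
    then have f: "bounded_nonneg ?f" by (auto simp: bounded_nonneg_def)
    have "radially_decreasing (\<lambda>x. s * ?f x)" unfolding radially_decreasing_def
    proof (intro allI impI)
      fix x y :: real assume "\<bar>x\<bar> \<le> \<bar>y\<bar>"
      then have hxy: "h x \<le> h y" by (rule mono)
      show "s * ?f y \<le> s * ?f x" using sign
      proof
        assume "s = 1 \<and> k \<le> 0"
        then show ?thesis using mult_left_mono_neg[OF hxy, of "k * mesh n"] mesh_pos[of n] by (simp add: mult_nonpos_nonneg)
      next
        assume "s = -1 \<and> 0 \<le> k"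
        then show ?thesis using mult_left_mono[OF hxy, of "k * mesh n"] mesh_pos[of n] by simp
      qed
    qed
    with f show "radial s ?f" by (simp add: radial_def)
  qed
  have "(\<lambda>n. real (mesh_count u n + mesh_count v n) * mesh n) \<longlonglongrightarrow> u + v"
    using tendsto_add[OF mesh_count_tendsto[OF uv(1)] mesh_count_tendsto[OF uv(2)]] by (simp add: algebra_simps)
  then have "(\<lambda>n. p n (mesh_count u n + mesh_count v n)) \<longlonglongrightarrow> expectation (\<lambda>\<omega>. exp (k * path_integral h (u + v) \<omega>))"
    using uv by (intro lim) auto
  then have 1: "(\<lambda>n. s * p n (mesh_count u n + mesh_count v n)) \<longlonglongrightarrow> s * expectation (\<lambda>\<omega>. exp (k * path_integral h (u + v) \<omega>))"
    by (intro tendsto_intros)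
  have 2: "(\<lambda>n. s * (p n (mesh_count u n) * p n (mesh_count v n))) \<longlonglongrightarrow>
     s * (expectation (\<lambda>\<omega>. exp (k * path_integral h u \<omega>)) * expectation (\<lambda>\<omega>. exp (k * path_integral h v \<omega>)))"
    by (intro tendsto_intros lim mesh_count_tendsto uv)
  show ?thesis by (rule LIMSEQ_le[OF 1 2]) (use submult in auto)
qed

end

context brownian_path
begin

text \<open>
  The right-hand side does not mention the path. This is how the law of a path functional is seen to be
  the same for all Brownian motions.
\<close>

lemma grid_sum_distr:
  assumes h: "continuous_on UNIV h" and \<delta>: "0 < \<delta>"
  shows "distr M borel (\<lambda>\<omega>. \<delta> * (\<Sum>j<N. h (W (\<delta> * real j) \<omega>))) =
    distr (PiM {..<Suc N} (\<lambda>_. density lborel (normal_density 0 (sqrt \<delta>)))) borel (\<lambda>v. \<delta> * (\<Sum>j<N. h (\<Sum>i<j. v i)))"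
proof -
  have [measurable]: "h \<in> borel_measurable borel" by (rule borel_measurable_continuous_onI[OF h])
  let ?I = "{..<Suc N}"
  let ?\<Psi> = "\<lambda>v. \<delta> * (\<Sum>j<N. h (\<Sum>i<j. v i :: real))"
  let ?D = "\<lambda>\<omega>. \<lambda>i\<in>?I. incr \<delta> i \<omega>"
  have comp: "(\<lambda>v. \<Sum>i<j. v i :: real) \<in> borel_measurable (PiM ?I (\<lambda>_. borel))" if "j \<le> N" for j
  proof (rule borel_measurable_sum)
    fix i assume "i \<in> {..<j}"
    with that show "(\<lambda>v. v i) \<in> borel_measurable (PiM ?I (\<lambda>_. borel))"
      by (intro measurable_component_singleton) auto
  qed
  have Psi: "?\<Psi> \<in> borel_measurable (PiM ?I (\<lambda>_. borel))"
    by (intro borel_measurable_times borel_measurable_const borel_measurable_sum measurable_compose[OF comp]) auto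
  have D: "?D \<in> M \<rightarrow>\<^sub>M PiM ?I (\<lambda>_. borel)"
    by (intro measurable_restrict incr_measurable[OF \<delta>])
  have "distr M (PiM ?I (\<lambda>_. borel)) ?D = PiM ?I (\<lambda>i. distr M borel (incr \<delta> i))"
    using indep_vars_iff_distr_eq_PiM'[where I = ?I and M' = "\<lambda>_. borel" and X = "incr \<delta>"] incr_indep[OF \<delta>, of "Suc N"] incr_measurable[OF \<delta>] by auto
  then have law: "distr M (PiM ?I (\<lambda>_. borel)) ?D = PiM ?I (\<lambda>_. density lborel (normal_density 0 (sqrt \<delta>)))"
    by (simp add: incr_distr[OF \<delta>])
  have "distr M borel (\<lambda>\<omega>. \<delta> * (\<Sum>j<N. h (W (\<delta> * real j) \<omega>))) = distr M borel (?\<Psi> \<circ> ?D)"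
  proof (rule distr_cong)
    fix \<omega> assume om: "\<omega> \<in> space M"
    show "\<delta> * (\<Sum>j<N. h (W (\<delta> * real j) \<omega>)) = (?\<Psi> \<circ> ?D) \<omega>"
      unfolding W_grid[OF om] by (auto intro!: sum.cong arg_cong[where f = h])
  qed auto
  also have "\<dots> = distr (distr M (PiM ?I (\<lambda>_. borel)) ?D) borel ?\<Psi>"
    by (rule distr_distr[OF Psi D, symmetric])
  finally show ?thesis unfolding law .
qed

lemma char_path_integral_tendsto:
  assumes h: "continuous_on UNIV h" and s: "0 \<le> s"
  shows "(\<lambda>n. char (distr M borel (\<lambda>\<omega>. mesh n * (\<Sum>j<mesh_count s n. h (W (mesh n * real j) \<omega>)))) t)
    \<longlonglongrightarrow> char (distr M borel (path_integral h s)) t"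
proof -
  define G where "G n \<omega> = mesh n * (\<Sum>j<mesh_count s n. h (W (mesh n * real j) \<omega>))" for n \<omega>
  have lim: "(\<lambda>n. G n \<omega>) \<longlonglongrightarrow> path_integral h s \<omega>" if "\<omega> \<in> space M" for \<omega>
    unfolding G_def by (rule path_integral_tendsto[OF h that mesh_pos mesh_tendsto mesh_count_tendsto[OF s]])
  have [measurable]: "G n \<in> borel_measurable M" for n
    unfolding G_def[abs_def] by (rule grid_sum_measurable[OF h mesh_pos])
  note [measurable] = path_integral_measurable[OF h s]
  have "(\<lambda>n. CLINT \<omega>|M. iexp (t * G n \<omega>)) \<longlonglongrightarrow> (CLINT \<omega>|M. iexp (t * path_integral h s \<omega>))"
  proof (rule integral_dominated_convergence[where w = "\<lambda>_. 1"])
    show "AE \<omega> in M. (\<lambda>n. iexp (t * G n \<omega>)) \<longlonglongrightarrow> iexp (t * path_integral h s \<omega>)"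
      by (intro AE_I2 tendsto_intros lim)
  qed (auto simp: norm_exp_i_times)
  then have "(\<lambda>n. char (distr M borel (G n)) t) \<longlonglongrightarrow> char (distr M borel (path_integral h s)) t"
    by (simp add: char_def integral_distr)
  then show ?thesis by (simp add: G_def[abs_def])
qed

end

lemma (in prob_space) path_integral_distr_eq:
  assumes "brownian_path M W" "brownian_path M W'" and h: "continuous_on UNIV h" and s: "0 \<le> s"
  shows "distr M borel (brownian_path.path_integral W h s) = distr M borel (brownian_path.path_integral W' h s)"
proof -
  interpret W: brownian_path M W by fact
  interpret W': brownian_path M W' by fact
  have "char (distr M borel (W.path_integral h s)) t = char (distr M borel (W'.path_integral h s)) t" for t
    using W.char_path_integral_tendsto[OF h s, of t] W'.char_path_integral_tendsto[OF h s, of t]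
    unfolding W.grid_sum_distr[OF h mesh_pos] W'.grid_sum_distr[OF h mesh_pos]
    by (rule LIMSEQ_unique)
  then show ?thesis
    using W.path_integral_measurable[OF h s] W'.path_integral_measurable[OF h s]
    by (intro Levy_uniqueness ext real_distribution_distr) auto
qed

context brownian_path
begin

section \<open>Exponential moments of the absolute Brownian area\<close>

abbreviation area :: "real \<Rightarrow> 'a \<Rightarrow> real" where
  "area \<equiv> path_integral (\<lambda>x. \<bar>x\<bar>)"

text \<open>
  The moment generating function may be infinite for positive arguments, hence its values in \<open>ennreal\<close>.
\<close>

definition area_mgf :: "real \<Rightarrow> real \<Rightarrow> ennreal" where
  "area_mgf k s = (\<integral>\<^sup>+\<omega>. ennreal (exp (k * area s \<omega>)) \<partial>M)"

lemma abs_continuous: "continuous_on UNIV (\<lambda>x::real. \<bar>x\<bar>)"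
  by (intro continuous_intros)

lemma area_measurable: "0 \<le> s \<Longrightarrow> area s \<in> borel_measurable M"
  by (rule path_integral_measurable[OF abs_continuous])

lemma path_set_integrable:
  fixes h :: "real \<Rightarrow> real"
  assumes "continuous_on UNIV h" "\<omega> \<in> space M"
  shows "set_integrable lborel {0..s} (\<lambda>\<tau>. h (W \<tau> \<omega>))"
  by (intro borel_integrable_atLeastAtMost' continuous_on_compose2[OF assms(1)]
      continuous_on_subset[OF W_continuous[OF assms(2)]]) auto

lemma area_nonneg: "0 \<le> area s \<omega>"
  unfolding path_integral_def set_lebesgue_integral_def
  by (intro integral_nonneg_AE) (auto simp: indicator_def)

lemma area_mgf_pos: "0 < area_mgf k s" if "0 \<le> s"
proof -
  note [measurable] = area_measurable[OF that]
  have "area_mgf k s \<noteq> 0"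
  proof
    assume "area_mgf k s = 0"
    then have "AE \<omega> in M. ennreal (exp (k * area s \<omega>)) = 0"
      unfolding area_mgf_def by (subst (asm) nn_integral_0_iff_AE) auto
    then have "AE \<omega> in M. False" by eventually_elim (simp add: ennreal_eq_0_iff not_le[symmetric])
    then show False by simp
  qed
  then show ?thesis by (simp add: zero_less_iff_neq_zero)
qed

lemma area_mgf_submult:
  assumes k: "k \<le> 0" and uv: "0 \<le> u" "0 \<le> v"
  shows "area_mgf k (u + v) \<le> area_mgf k u * area_mgf k v"
proof -
  have eq: "area_mgf k s = ennreal (expectation (\<lambda>\<omega>. exp (k * area s \<omega>)))" if "0 \<le> s" for s
    unfolding area_mgf_def using area_measurable[OF that] k area_nonneg
    by (intro nn_integral_eq_integral integrable_const_bound[of _ 1]) (auto simp: mult_nonpos_nonneg)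
  have "1 * expectation (\<lambda>\<omega>. exp (k * area (u + v) \<omega>))
    \<le> 1 * (expectation (\<lambda>\<omega>. exp (k * area u \<omega>)) * expectation (\<lambda>\<omega>. exp (k * area v \<omega>)))"
    by (rule expectation_path_integral_submult[OF abs_continuous, of k 0]) (use k uv in \<open>auto simp: mult_nonpos_nonneg\<close>)
  then show ?thesis using uv by (simp add: eq ennreal_mult[symmetric] ennreal_leI)
qed

lemma area_mgf_le_one: "k \<le> 0 \<Longrightarrow> area_mgf k s \<le> 1"
proof -
  assume "k \<le> 0"
  then have "area_mgf k s \<le> (\<integral>\<^sup>+\<omega>. 1 \<partial>M)"
    unfolding area_mgf_def using area_nonneg by (intro nn_integral_mono) (auto simp: mult_nonpos_nonneg)
  then show ?thesis by (simp add: emeasure_space_1)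
qed

lemma area_mgf_ge_one: "0 \<le> k \<Longrightarrow> 1 \<le> area_mgf k s"
proof -
  assume k: "0 \<le> k"
  have "(\<integral>\<^sup>+\<omega>. 1 \<partial>M) \<le> area_mgf k s"
    unfolding area_mgf_def using area_nonneg k by (intro nn_integral_mono) auto
  then show ?thesis by (simp add: emeasure_space_1)
qed

text \<open>
  For \<open>k > 0\<close> the weight \<open>exp (k \<bar>x\<bar>)\<close> is unbounded. Capping \<open>\<bar>x\<bar>\<close> at \<open>R\<close> keeps it radially increasing, and
  on each path the cap has no effect once \<open>R\<close> exceeds the maximum of the path.
\<close>

lemma area_mgf_truncation:
  assumes k: "0 \<le> k" and s: "0 \<le> s"
  shows "(\<lambda>R. ennreal (expectation (\<lambda>\<omega>. exp (k * path_integral (\<lambda>x. min \<bar>x\<bar> (real R)) s \<omega>)))) \<longlonglongrightarrow> area_mgf k s"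
    and "ennreal (expectation (\<lambda>\<omega>. exp (k * path_integral (\<lambda>x. min \<bar>x\<bar> (real R)) s \<omega>))) \<le> area_mgf k s"
proof -
  define h where "h R x = min \<bar>x\<bar> (real R)" for R :: nat and x :: real
  have h: "continuous_on UNIV (h R)" for R unfolding h_def by (intro continuous_intros)
  note [measurable] = path_integral_measurable[OF h s]
  have mono: "path_integral (h R) s \<omega> \<le> path_integral (h R') s \<omega>" if "R \<le> R'" "\<omega> \<in> space M" for R R' \<omega>
    unfolding path_integral_def using that
    by (intro set_integral_mono path_set_integrable h) (auto simp: h_def)
  have eventually: "\<exists>R0. \<forall>R\<ge>R0. path_integral (h R) s \<omega> = area s \<omega>" if om: "\<omega> \<in> space M" for \<omega>
  proof -
    have "compact ((\<lambda>\<tau>. W \<tau> \<omega>) ` {0..s})"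
      by (intro compact_continuous_image continuous_on_subset[OF W_continuous[OF om]]) auto
    then obtain K where K: "\<And>\<tau>. \<tau> \<in> {0..s} \<Longrightarrow> \<bar>W \<tau> \<omega>\<bar> \<le> K"
      using compact_imp_bounded bounded_iff by (metis image_eqI real_norm_def)
    obtain R0 :: nat where R0: "K \<le> real R0" using real_arch_simple by blast
    have "path_integral (h R) s \<omega> = area s \<omega>" if "R0 \<le> R" for R
      unfolding path_integral_def
    proof (rule set_lebesgue_integral_cong)
      show "\<forall>\<tau>. \<tau> \<in> {0..s} \<longrightarrow> h R (W \<tau> \<omega>) = \<bar>W \<tau> \<omega>\<bar>"
        using K R0 that by (auto simp: h_def min_def) (smt (verit) of_nat_mono atLeastAtMost_iff)
    qed simp
    then show ?thesis by blast
  qed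
  have bound: "path_integral (h R) s \<omega> \<le> real R * s" if om: "\<omega> \<in> space M" for R \<omega>
  proof -
    have "path_integral (h R) s \<omega> \<le> (LINT \<tau>:{0..s}|lborel. real R)"
      unfolding path_integral_def
      by (intro set_integral_mono path_set_integrable[OF h om] borel_integrable_atLeastAtMost' continuous_intros) (auto simp: h_def)
    then show ?thesis using s by (simp add: set_lebesgue_integral_def mult.commute)
  qed
  have E: "(\<integral>\<^sup>+\<omega>. ennreal (exp (k * path_integral (h R) s \<omega>)) \<partial>M) = ennreal (expectation (\<lambda>\<omega>. exp (k * path_integral (h R) s \<omega>)))" for R
    using bound k by (intro nn_integral_eq_integral integrable_const_bound[of _ "exp (k * (real R * s))"]) (auto intro: mult_left_mono)
  have sup: "(SUP R. ennreal (exp (k * path_integral (h R) s \<omega>))) = ennreal (exp (k * area s \<omega>))" if om: "\<omega> \<in> space M" for \<omega>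
  proof (rule antisym)
    obtain R0 where R0: "\<And>R. R0 \<le> R \<Longrightarrow> path_integral (h R) s \<omega> = area s \<omega>" using eventually[OF om] by blast
    show "ennreal (exp (k * area s \<omega>)) \<le> (SUP R. ennreal (exp (k * path_integral (h R) s \<omega>)))"
      by (rule SUP_upper2[of R0]) (auto simp: R0)
    show "(SUP R. ennreal (exp (k * path_integral (h R) s \<omega>))) \<le> ennreal (exp (k * area s \<omega>))"
    proof (rule SUP_least)
      fix R
      have "path_integral (h R) s \<omega> \<le> area s \<omega>" using mono[of R "max R R0" \<omega>] R0[of "max R R0"] om by simp
      then show "ennreal (exp (k * path_integral (h R) s \<omega>)) \<le> ennreal (exp (k * area s \<omega>))"
        using k by (intro ennreal_leI) (simp add: mult_left_mono)
    qed
  qed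
  have inc: "(\<integral>\<^sup>+\<omega>. ennreal (exp (k * path_integral (h R) s \<omega>)) \<partial>M) \<le> (\<integral>\<^sup>+\<omega>. ennreal (exp (k * path_integral (h R') s \<omega>)) \<partial>M)" if "R \<le> R'" for R R'
    using mono[OF that] k by (intro nn_integral_mono ennreal_leI) (simp add: mult_left_mono)
  have "area_mgf k s = (\<integral>\<^sup>+\<omega>. (SUP R. ennreal (exp (k * path_integral (h R) s \<omega>))) \<partial>M)"
    unfolding area_mgf_def by (intro nn_integral_cong) (simp add: sup)
  also have "\<dots> = (SUP R. \<integral>\<^sup>+\<omega>. ennreal (exp (k * path_integral (h R) s \<omega>)) \<partial>M)"
    using mono k by (intro nn_integral_monotone_convergence_SUP_AE) (auto intro!: AE_I2 ennreal_leI simp: mult_left_mono)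
  finally have SUP: "area_mgf k s = (SUP R. \<integral>\<^sup>+\<omega>. ennreal (exp (k * path_integral (h R) s \<omega>)) \<partial>M)" .
  have lim: "(\<lambda>R. \<integral>\<^sup>+\<omega>. ennreal (exp (k * path_integral (h R) s \<omega>)) \<partial>M) \<longlonglongrightarrow> area_mgf k s"
    unfolding SUP by (rule LIMSEQ_SUP) (use inc in \<open>auto simp: incseq_def\<close>)
  show "(\<lambda>R. ennreal (expectation (\<lambda>\<omega>. exp (k * path_integral (\<lambda>x. min \<bar>x\<bar> (real R)) s \<omega>)))) \<longlonglongrightarrow> area_mgf k s"
    using lim[unfolded E, unfolded h_def[abs_def]] .
  have "(\<integral>\<^sup>+\<omega>. ennreal (exp (k * path_integral (h R) s \<omega>)) \<partial>M) \<le> area_mgf k s"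
    unfolding SUP by (rule SUP_upper) simp
  then show "ennreal (expectation (\<lambda>\<omega>. exp (k * path_integral (\<lambda>x. min \<bar>x\<bar> (real R)) s \<omega>))) \<le> area_mgf k s"
    unfolding E unfolding h_def[abs_def] .
qed

lemma area_mgf_supermult:
  assumes k: "0 \<le> k" and uv: "0 \<le> u" "0 \<le> v"
  shows "area_mgf k u * area_mgf k v \<le> area_mgf k (u + v)"
proof -
  define e where "e R s = expectation (\<lambda>\<omega>. exp (k * path_integral (\<lambda>x. min \<bar>x\<bar> (real R)) s \<omega>))" for R :: nat and s
  have le: "ennreal (e R u) * ennreal (e R v) \<le> area_mgf k (u + v)" for R
  proof -
    have "- 1 * e R (u + v) \<le> - 1 * (e R u * e R v)" unfolding e_def
    proof (rule expectation_path_integral_submult[where b = "k * real R"])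
      show "continuous_on UNIV (\<lambda>x::real. min \<bar>x\<bar> (real R))" by (intro continuous_intros)
      show "k * min \<bar>x\<bar> (real R) \<le> k * real R" for x using k by (intro mult_left_mono) auto
    qed (use k uv in auto)
    moreover have "0 \<le> e R s" for s unfolding e_def by (intro integral_nonneg_AE) auto
    ultimately have "ennreal (e R u) * ennreal (e R v) \<le> ennreal (e R (u + v))"
      by (simp add: ennreal_mult[symmetric] ennreal_leI)
    also have "\<dots> \<le> area_mgf k (u + v)" unfolding e_def using uv by (intro area_mgf_truncation k) auto
    finally show ?thesis .
  qed
  have "(\<lambda>R. ennreal (e R u) * ennreal (e R v)) \<longlonglongrightarrow> area_mgf k u * area_mgf k v"
    using area_mgf_truncation(1)[OF k uv(1)] area_mgf_truncation(1)[OF k uv(2)] area_mgf_pos[OF uv(1), of k] area_mgf_pos[OF uv(2), of k]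
    unfolding e_def by (intro tendsto_mult_ennreal) auto
  then show ?thesis by (rule LIMSEQ_le_const2) (use le in auto)
qed

text \<open>
  Time is extended to the whole real line by \<open>max 0\<close>, which allows Fubini's theorem over \<open>lborel\<close>.
\<close>

lemma W_jointly_measurable:
  "(\<lambda>p. W (max 0 (fst p)) (snd p)) \<in> borel_measurable (borel \<Otimes>\<^sub>M M)"
proof (rule borel_measurable_LIMSEQ_real)
  fix p :: "real \<times> 'a" assume p: "p \<in> space (borel \<Otimes>\<^sub>M M)"
  then have om: "snd p \<in> space M" by (auto simp: space_pair_measure)
  let ?t = "max 0 (fst p)"
  have "(\<lambda>n. mesh n * real (mesh_count ?t n)) \<longlonglongrightarrow> ?t"
    using mesh_count_tendsto[of ?t] by (simp add: mult.commute)
  moreover have "mesh n * real (mesh_count ?t n) \<in> {0..}" for n using mesh_pos[of n] by simp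
  ultimately show "(\<lambda>n. W (mesh n * real (mesh_count ?t n)) (snd p)) \<longlonglongrightarrow> W ?t (snd p)"
    by (intro continuous_on_tendsto_compose[OF W_continuous[OF om]]) auto
next
  fix n
  show "(\<lambda>p. W (mesh n * real (mesh_count (max 0 (fst p)) n)) (snd p)) \<in> borel_measurable (borel \<Otimes>\<^sub>M M)"
  proof (rule measurable_compose_countable[where f = "\<lambda>j p. W (mesh n * real j) (snd p)"])
    fix j :: nat
    have "W (mesh n * real j) \<in> borel_measurable M" using mesh_pos[of n] by (intro W_measurable) simp
    then show "(\<lambda>p. W (mesh n * real j) (snd p)) \<in> borel_measurable (borel \<Otimes>\<^sub>M M)"
      by (rule measurable_compose[OF measurable_snd])
    show "(\<lambda>p. mesh_count (max 0 (fst p)) n) \<in> (borel \<Otimes>\<^sub>M M) \<rightarrow>\<^sub>M count_space UNIV"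
      unfolding mesh_count_def by measurable
  qed
qed

lemma nn_integral_abs_W:
  assumes t: "0 < t" shows "(\<integral>\<^sup>+\<omega>. ennreal \<bar>W t \<omega>\<bar> \<partial>M) = ennreal (sqrt t * sqrt (2 / pi))"
proof -
  have "distributed M lborel (\<lambda>\<omega>. W t \<omega> - W 0 \<omega>) (normal_density 0 (sqrt (t - 0)))"
    using bm t unfolding standard_brownian_motion_def by blast
  then have D: "distributed M lborel (\<lambda>\<omega>. W t \<omega> - W 0 \<omega>) (normal_density 0 (sqrt t))" by simp
  have "(\<integral>\<^sup>+\<omega>. ennreal \<bar>W t \<omega>\<bar> \<partial>M) = (\<integral>\<^sup>+\<omega>. ennreal \<bar>W t \<omega> - W 0 \<omega>\<bar> \<partial>M)"
    by (intro nn_integral_cong) (simp add: W_zero)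
  also have "\<dots> = (\<integral>\<^sup>+x. ennreal (normal_density 0 (sqrt t) x) * ennreal \<bar>x\<bar> \<partial>lborel)"
    by (rule distributed_nn_integral[OF D, symmetric]) measurable
  also have "\<dots> = (\<integral>\<^sup>+x. ennreal (normal_density 0 (sqrt t) x * \<bar>x\<bar>) \<partial>lborel)"
    by (intro nn_integral_cong) (simp add: ennreal_mult)
  also have "\<dots> = ennreal (sqrt t * sqrt (2 / pi))"
  proof -
    have N: "has_bochner_integral lborel (\<lambda>x. normal_density 0 (sqrt t) x * \<bar>x\<bar>) (sqrt t * sqrt (2 / pi))"
      using normal_moment_abs_odd[where \<mu> = 0 and \<sigma> = "sqrt t" and k = 0] t by simp
    have "(\<integral>\<^sup>+x. ennreal (normal_density 0 (sqrt t) x * \<bar>x\<bar>) \<partial>lborel)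
        = ennreal (\<integral>x. normal_density 0 (sqrt t) x * \<bar>x\<bar> \<partial>lborel)"
      using N by (intro nn_integral_eq_integral) (auto simp: has_bochner_integral_iff)
    then show ?thesis unfolding has_bochner_integral_integral_eq[OF N] .
  qed
  finally show ?thesis .
qed

text \<open>
  The mean area is of order \<open>v powr (3 / 2)\<close>, as \<open>E \<bar>W \<tau>\<bar>\<close> is a multiple of \<open>sqrt \<tau>\<close>. Its superlinear growth is what
  matters; the bound keeps only the second half of the time interval.
\<close>

lemma expectation_area_bounds:
  assumes v: "0 < v"
  shows "integrable M (area v)" "v / 2 * (sqrt (v / 2) * sqrt (2 / pi)) \<le> expectation (area v)"
proof -
  let ?c = "sqrt (2 / pi)"
  interpret P: pair_sigma_finite lborel M ..
  have [measurable]: "(\<lambda>p. W (max 0 (fst p)) (snd p)) \<in> borel_measurable (lborel \<Otimes>\<^sub>M M)"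
    using W_jointly_measurable by (simp cong: measurable_cong_sets sets_pair_measure_cong)
  have "(\<integral>\<^sup>+\<omega>. ennreal (area v \<omega>) \<partial>M) = (\<integral>\<^sup>+\<omega>. \<integral>\<^sup>+\<tau>. indicator {0..v} \<tau> * ennreal \<bar>W (max 0 \<tau>) \<omega>\<bar> \<partial>lborel \<partial>M)"
  proof (rule nn_integral_cong)
    fix \<omega> assume om: "\<omega> \<in> space M"
    have "integrable lborel (\<lambda>\<tau>. indicator {0..v} \<tau> *\<^sub>R \<bar>W \<tau> \<omega>\<bar>)"
      using path_set_integrable[OF abs_continuous om, of v] by (simp add: set_integrable_def)
    then have "ennreal (area v \<omega>) = (\<integral>\<^sup>+\<tau>. ennreal (indicator {0..v} \<tau> *\<^sub>R \<bar>W \<tau> \<omega>\<bar>) \<partial>lborel)"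
      unfolding path_integral_def set_lebesgue_integral_def
      by (subst nn_integral_eq_integral) auto
    also have "\<dots> = (\<integral>\<^sup>+\<tau>. indicator {0..v} \<tau> * ennreal \<bar>W (max 0 \<tau>) \<omega>\<bar> \<partial>lborel)"
      by (intro nn_integral_cong) (auto simp: indicator_def max_def)
    finally show "ennreal (area v \<omega>) = (\<integral>\<^sup>+\<tau>. indicator {0..v} \<tau> * ennreal \<bar>W (max 0 \<tau>) \<omega>\<bar> \<partial>lborel)" .
  qed
  also have "\<dots> = (\<integral>\<^sup>+\<tau>. \<integral>\<^sup>+\<omega>. indicator {0..v} \<tau> * ennreal \<bar>W (max 0 \<tau>) \<omega>\<bar> \<partial>M \<partial>lborel)"
  proof (rule P.Fubini')
    show "(\<lambda>(\<tau>, \<omega>). indicator {0..v} \<tau> * ennreal \<bar>W (max 0 \<tau>) \<omega>\<bar>) \<in> borel_measurable (lborel \<Otimes>\<^sub>M M)"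
      unfolding split_beta' by measurable
  qed
  also have "\<dots> = (\<integral>\<^sup>+\<tau>. indicator {0..v} \<tau> * ennreal (sqrt \<tau> * ?c) \<partial>lborel)"
  proof (rule nn_integral_cong_AE)
    have "AE \<tau> in lborel. \<tau> \<noteq> (0::real)" by (rule AE_lborel_singleton)
    then show "AE \<tau> in lborel. (\<integral>\<^sup>+\<omega>. indicator {0..v} \<tau> * ennreal \<bar>W (max 0 \<tau>) \<omega>\<bar> \<partial>M) = indicator {0..v} \<tau> * ennreal (sqrt \<tau> * ?c)"
    proof eventually_elim
      case (elim \<tau>)
      then show ?case using nn_integral_abs_W[of \<tau>] by (cases "\<tau> \<in> {0..v}") (auto simp: indicator_def max_def)
    qed
  qed
  finally have eq: "(\<integral>\<^sup>+\<omega>. ennreal (area v \<omega>) \<partial>M) = (\<integral>\<^sup>+\<tau>. indicator {0..v} \<tau> * ennreal (sqrt \<tau> * ?c) \<partial>lborel)" .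
  also have "\<dots> \<le> (\<integral>\<^sup>+\<tau>. ennreal (sqrt v * ?c) * indicator {0..v} \<tau> \<partial>lborel)"
    by (intro nn_integral_mono) (auto simp: indicator_def intro!: ennreal_leI mult_right_mono)
  also have "\<dots> < \<infinity>" using v by (simp add: nn_integral_cmult ennreal_mult_less_top)
  finally have fin: "(\<integral>\<^sup>+\<omega>. ennreal (area v \<omega>) \<partial>M) < \<infinity>" .
  show int: "integrable M (area v)"
    using fin v area_measurable[of v] area_nonneg by (intro integrableI_nonneg) auto
  have "ennreal (v / 2 * (sqrt (v / 2) * ?c)) = (\<integral>\<^sup>+\<tau>. ennreal (sqrt (v / 2) * ?c) * indicator {v/2..v} \<tau> \<partial>lborel)"
  proof -
    have "v - v / 2 = v / 2" by simp
    then have "(\<integral>\<^sup>+\<tau>. ennreal (sqrt (v / 2) * ?c) * indicator {v/2..v} \<tau> \<partial>lborel) = ennreal (sqrt (v / 2) * ?c) * ennreal (v / 2)"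
      using v by (simp add: nn_integral_cmult_indicator)
    also have "\<dots> = ennreal (sqrt (v / 2) * ?c * (v / 2))" using v by (intro ennreal_mult[symmetric]) auto
    finally show ?thesis by (simp only: mult.commute)
  qed
  also have "\<dots> \<le> (\<integral>\<^sup>+\<tau>. indicator {0..v} \<tau> * ennreal (sqrt \<tau> * ?c) \<partial>lborel)"
    using v by (intro nn_integral_mono) (auto simp: indicator_def intro!: ennreal_leI mult_right_mono)
  also have "\<dots> = ennreal (expectation (area v))"
    unfolding eq[symmetric] using int area_nonneg by (intro nn_integral_eq_integral) auto
  finally show "v / 2 * (sqrt (v / 2) * ?c) \<le> expectation (area v)"
    using area_nonneg by (subst (asm) ennreal_le_iff) (auto intro!: integral_nonneg_AE)
qed

text \<open>
  Jensen's inequality through the tangent line of the exponential at the mean, whose expectation is finite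
  even when the exponential moment is not.
\<close>

lemma area_mgf_jensen:
  assumes v: "0 < v" shows "ennreal (exp (k * expectation (area v))) \<le> area_mgf k v"
proof -
  define a where "a = expectation (area v)"
  have int: "integrable M (area v)" by (rule expectation_area_bounds[OF v])
  let ?f = "\<lambda>\<omega>. exp (k * a) * (1 + k * (area v \<omega> - a))"
  have int_f: "integrable M ?f" using int by simp
  have "exp (k * a) = expectation ?f" using int by (simp add: a_def prob_space)
  also have "\<dots> \<le> expectation (\<lambda>\<omega>. max 0 (?f \<omega>))"
    using int_f by (intro integral_mono) auto
  finally have "ennreal (exp (k * a)) \<le> ennreal (expectation (\<lambda>\<omega>. max 0 (?f \<omega>)))" by (rule ennreal_leI)
  also have "\<dots> = (\<integral>\<^sup>+\<omega>. ennreal (max 0 (?f \<omega>)) \<partial>M)"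
    using int_f by (intro nn_integral_eq_integral[symmetric]) auto
  also have "\<dots> \<le> area_mgf k v" unfolding area_mgf_def
  proof (intro nn_integral_mono ennreal_leI)
    fix \<omega>
    have "?f \<omega> \<le> exp (k * a) * exp (k * (area v \<omega> - a))" by (intro mult_left_mono exp_ge_add_one_self) auto
    also have "\<dots> = exp (k * area v \<omega>)" by (simp add: exp_add[symmetric] algebra_simps)
    finally show "max 0 (?f \<omega>) \<le> exp (k * area v \<omega>)" by simp
  qed
  finally show ?thesis by (simp add: a_def)
qed

lemma area_mgf_superexponential:
  assumes k: "0 < k"
  shows "\<exists>v>0. ennreal (exp (a * v)) \<le> area_mgf k v"
proof -
  define c where "c = sqrt (2 / pi)"
  have c: "0 < c" by (simp add: c_def)
  (* With v = 2 r^2 the mean area is at least c r v / 2, and this r makes k c r / 2 at least a. *)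
  define r where "r = 2 * \<bar>a\<bar> / (k * c) + 1"
  have r: "0 < r" using k c by (simp add: r_def add_nonneg_pos)
  define v where "v = 2 * r\<^sup>2"
  have v: "0 < v" using r by (simp add: v_def)
  have "sqrt (v / 2) = r" using r by (simp add: v_def)
  then have "v / 2 * (r * c) \<le> expectation (area v)"
    using expectation_area_bounds(2)[OF v] by (simp add: c_def)
  then have "k * (v / 2 * (r * c)) \<le> k * expectation (area v)" using k by (intro mult_left_mono) auto
  moreover have "a * v \<le> k * (v / 2 * (r * c))"
  proof -
    have "k * c * r = 2 * \<bar>a\<bar> + k * c" using k c by (simp add: r_def field_simps)
    moreover have "0 < k * c" using k c by simp
    ultimately have "2 * a \<le> k * c * r" using abs_ge_self[of a] by linarith
    then have "2 * a * (v / 2) \<le> k * c * r * (v / 2)" using v by (intro mult_right_mono) auto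
    then show ?thesis by (simp add: mult_ac)
  qed
  ultimately have "ennreal (exp (a * v)) \<le> ennreal (exp (k * expectation (area v)))" by (intro ennreal_leI) simp
  also have "\<dots> \<le> area_mgf k v" by (rule area_mgf_jensen[OF v])
  finally show ?thesis using v by blast
qed

end

section \<open>Cycles of the reset Brownian motion\<close>

abbreviation path_space :: "(real \<Rightarrow> real) measure" where
  "path_space \<equiv> Pi\<^sub>M {0..} (\<lambda>_. borel)"

text \<open>
  On the product space of paths the integral of a path is not measurable. A limit of Riemann sums over
  countably many fixed times is, and for continuous paths it agrees with the integral. Cycle areas are
  therefore measurable functions of the pair of waiting time and path, which is what independence of the
  cycles requires.
\<close>

definition riemann_area :: "real \<Rightarrow> (real \<Rightarrow> real) \<Rightarrow> real" where
  "riemann_area s b = lim (\<lambda>n. mesh n * (\<Sum>j<mesh_count s n. \<bar>b (mesh n * real j)\<bar>))"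

lemma riemann_area_measurable:
  "case_prod riemann_area \<in> borel_measurable (borel \<Otimes>\<^sub>M path_space)"
  unfolding riemann_area_def split_beta'
proof (rule borel_measurable_lim_metric)
  fix n
  let ?mesh = "mesh n"
  have pos: "0 \<le> ?mesh * real j" for j :: nat
    by (simp add: mesh_def)
  show "(\<lambda>p. ?mesh * (\<Sum>j<mesh_count (fst p) n. \<bar>snd p (?mesh * real j)\<bar>)) \<in> borel_measurable (borel \<Otimes>\<^sub>M path_space)"
  proof (rule measurable_compose_countable[where f = "\<lambda>N p. ?mesh * (\<Sum>j<N. \<bar>snd p (?mesh * real j)\<bar>)"])
    fix N :: nat
    have "(\<lambda>p. snd p (?mesh * real j)) \<in> borel_measurable (borel \<Otimes>\<^sub>M path_space)" for j :: nat
      using pos[of j] by (intro measurable_compose[OF measurable_snd] measurable_component_singleton) simp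
    then show "(\<lambda>p. ?mesh * (\<Sum>j<N. \<bar>snd p (?mesh * real j)\<bar>)) \<in> borel_measurable (borel \<Otimes>\<^sub>M path_space)"
      by measurable
    show "(\<lambda>p. mesh_count (fst p) n) \<in> (borel \<Otimes>\<^sub>M path_space) \<rightarrow>\<^sub>M count_space UNIV"
      unfolding mesh_count_def by measurable
  qed
qed

context brownian_resetting
begin

definition cycle_path :: "nat \<Rightarrow> 'a \<Rightarrow> real \<Rightarrow> real" where
  "cycle_path i \<omega> = (\<lambda>t\<in>{0..}. B i t \<omega>)"

definition area :: "nat \<Rightarrow> real \<Rightarrow> 'a \<Rightarrow> real" where
  "area i s \<omega> = (LINT \<tau>:{0..s}|lborel. \<bar>B i \<tau> \<omega>\<bar>)"

definition cycle_area :: "nat \<Rightarrow> 'a \<Rightarrow> real" where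
  "cycle_area i \<omega> = area i (S i \<omega>) \<omega>"

lemma B_path: "1 \<le> i \<Longrightarrow> brownian_path M (B i)"
  by unfold_locales (rule brownian)

lemma area_eq: "area i = brownian_path.path_integral (B i) (\<lambda>x. \<bar>x\<bar>)" if "1 \<le> i"
proof -
  interpret W: brownian_path M "B i" by (rule B_path[OF that])
  show ?thesis by (simp add: fun_eq_iff area_def W.path_integral_def)
qed

lemma S_measurable: "1 \<le> i \<Longrightarrow> S i \<in> borel_measurable M"
  using waiting_indep by (auto simp: indep_vars_def)

lemma cycle_path_measurable: "1 \<le> i \<Longrightarrow> cycle_path i \<in> M \<rightarrow>\<^sub>M path_space"
  using brownian_indep by (auto simp: indep_vars_def cycle_path_def[abs_def])

lemma area_measurable: "1 \<le> i \<Longrightarrow> 0 \<le> s \<Longrightarrow> area i s \<in> borel_measurable M"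
  using brownian_path.area_measurable[OF B_path] by (simp add: area_eq)

lemma area_nonneg: "0 \<le> area i s \<omega>"
  unfolding area_def set_lebesgue_integral_def
  by (intro integral_nonneg_AE) (auto simp: indicator_def)

lemma area_eq_riemann_area:
  assumes i: "1 \<le> i" and s: "0 \<le> s" and om: "\<omega> \<in> space M"
  shows "area i s \<omega> = riemann_area s (cycle_path i \<omega>)"
proof -
  interpret W: brownian_path M "B i" by (rule B_path[OF i])
  have "(\<lambda>n. mesh n * (\<Sum>j<mesh_count s n. \<bar>B i (mesh n * real j) \<omega>\<bar>)) \<longlonglongrightarrow> area i s \<omega>"
    unfolding area_eq[OF i] by (rule W.path_integral_tendsto[OF W.abs_continuous om mesh_pos mesh_tendsto mesh_count_tendsto[OF s]])
  moreover have "B i (mesh n * real j) \<omega> = cycle_path i \<omega> (mesh n * real j)" for n j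
    using mesh_pos[of n] by (simp add: cycle_path_def)
  ultimately show ?thesis unfolding riemann_area_def by (simp add: limI)
qed

lemma cycle_area_eq:
  assumes "1 \<le> i" "\<omega> \<in> space M" shows "cycle_area i \<omega> = riemann_area (S i \<omega>) (cycle_path i \<omega>)"
  unfolding cycle_area_def using assms by (intro area_eq_riemann_area waiting_nonneg)

lemma waiting_brownian_events_indep:
  fixes J :: "nat set"
  assumes J: "finite J" "J \<noteq> {}" "J \<subseteq> {1..}"
    and a: "\<And>j. j \<in> J \<Longrightarrow> a j \<in> sets borel" and b: "\<And>j. j \<in> J \<Longrightarrow> b j \<in> sets path_space"
  shows "prob (\<Inter>j\<in>J. (S j -` a j \<inter> space M) \<inter> (cycle_path j -` b j \<inter> space M)) =
    prob (\<Inter>j\<in>J. S j -` a j \<inter> space M) * prob (\<Inter>j\<in>J. cycle_path j -` b j \<inter> space M)"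
proof -
  define fS where "fS \<omega> = (\<lambda>n\<in>{1..}. S n \<omega>)" for \<omega>
  define fB where "fB \<omega> = (\<lambda>p\<in>{1..} \<times> {0..}. B (fst p) (snd p) \<omega>)" for \<omega>
  define VS where "VS = vimage_algebra (space M) fS (Pi\<^sub>M {1..} (\<lambda>_. borel :: real measure))"
  define VB where "VB = vimage_algebra (space M) fB (Pi\<^sub>M ({1::nat..} \<times> {0::real..}) (\<lambda>_. borel :: real measure))"
  have ind: "indep_set (sets VS) (sets VB)"
    using waiting_brownian_indep by (simp add: VS_def VB_def fS_def[abs_def] fB_def[abs_def])
  have sp: "space VS = space M" "space VB = space M" by (auto simp: VS_def VB_def)
  have fS: "fS \<in> VS \<rightarrow>\<^sub>M Pi\<^sub>M {1..} (\<lambda>_. borel)" unfolding VS_def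
    by (rule measurable_vimage_algebra1) (auto simp: fS_def space_PiM)
  have fB: "fB \<in> VB \<rightarrow>\<^sub>M Pi\<^sub>M ({1..} \<times> {0..}) (\<lambda>_. borel)" unfolding VB_def
    by (rule measurable_vimage_algebra1) (auto simp: fB_def space_PiM)
  have S: "S j \<in> borel_measurable VS" if "1 \<le> j" for j
  proof -
    have "(\<lambda>\<omega>. fS \<omega> j) \<in> borel_measurable VS"
      using that by (intro measurable_compose[OF fS] measurable_component_singleton) auto
    then show ?thesis using that by (simp add: fS_def)
  qed
  have P: "cycle_path j \<in> VB \<rightarrow>\<^sub>M path_space" if "1 \<le> j" for j
    unfolding cycle_path_def[abs_def]
  proof (rule measurable_restrict)
    fix t :: real assume t: "t \<in> {0..}"
    have "(\<lambda>\<omega>. fB \<omega> (j, t)) \<in> borel_measurable VB"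
      using that t by (intro measurable_compose[OF fB] measurable_component_singleton) auto
    then show "B j t \<in> borel_measurable VB" using that t by (simp add: fB_def)
  qed
  have 1: "(\<Inter>j\<in>J. S j -` a j \<inter> space M) \<in> sets VS"
    using J by (intro sets.finite_INT) (auto simp: sp(1)[symmetric] intro!: measurable_sets[OF S] a)
  have 2: "(\<Inter>j\<in>J. cycle_path j -` b j \<inter> space M) \<in> sets VB"
    using J by (intro sets.finite_INT) (auto simp: sp(2)[symmetric] intro!: measurable_sets[OF P] b)
  have "(\<Inter>j\<in>J. (S j -` a j \<inter> space M) \<inter> (cycle_path j -` b j \<inter> space M))
     = (\<Inter>j\<in>J. S j -` a j \<inter> space M) \<inter> (\<Inter>j\<in>J. cycle_path j -` b j \<inter> space M)"
    using J by blast
  then show ?thesis using indep_setD[OF ind 1 2] by simp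
qed

text \<open>
  Rectangles generate the product sigma-algebra and are stable under intersection. On rectangles,
  independence follows by separating waiting times from paths and then factorising within each family.
\<close>

lemma cycle_indep:
  "indep_vars (\<lambda>_. borel \<Otimes>\<^sub>M path_space) (\<lambda>i \<omega>. (S i \<omega>, cycle_path i \<omega>)) {1..}"
  unfolding indep_vars_def2
proof (intro conjI ballI)
  fix i :: nat assume "i \<in> {1..}"
  then show "(\<lambda>\<omega>. (S i \<omega>, cycle_path i \<omega>)) \<in> M \<rightarrow>\<^sub>M borel \<Otimes>\<^sub>M path_space"
    using S_measurable[of i] cycle_path_measurable[of i] by (intro measurable_Pair) auto
next
  define G where "G i = {(S i -` a \<inter> space M) \<inter> (cycle_path i -` b \<inter> space M) | a b. a \<in> sets borel \<and> b \<in> sets path_space}" for i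
  have G_indep: "indep_sets G {1..}"
  proof (rule indep_setsI)
    fix i :: nat assume "i \<in> {1..}"
    then show "G i \<subseteq> events"
      using S_measurable[of i] cycle_path_measurable[of i] by (auto simp: G_def intro!: sets.Int measurable_sets)
  next
    fix A and J :: "nat set" assume J: "J \<noteq> {}" "J \<subseteq> {1..}" "finite J" and A: "\<forall>j\<in>J. A j \<in> G j"
    have "\<exists>p. fst p \<in> sets borel \<and> snd p \<in> sets path_space \<and> A j = (S j -` fst p \<inter> space M) \<inter> (cycle_path j -` snd p \<inter> space M)"
      if "j \<in> J" for j
    proof -
      have "A j \<in> G j" using A that by blast
      then obtain a b where "a \<in> sets borel" "b \<in> sets path_space" "A j = (S j -` a \<inter> space M) \<inter> (cycle_path j -` b \<inter> space M)"
        unfolding G_def by blast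
      then show ?thesis by (intro exI[of _ "(a, b)"]) simp
    qed
    then have "\<forall>j\<in>J. \<exists>p. fst p \<in> sets borel \<and> snd p \<in> sets path_space \<and> A j = (S j -` fst p \<inter> space M) \<inter> (cycle_path j -` snd p \<inter> space M)" ..
    from bchoice[OF this] obtain p where p: "\<forall>j\<in>J. fst (p j) \<in> sets borel \<and> snd (p j) \<in> sets path_space \<and> A j = (S j -` fst (p j) \<inter> space M) \<inter> (cycle_path j -` snd (p j) \<inter> space M)" ..
    define a where "a j = fst (p j)" for j
    define b where "b j = snd (p j)" for j
    have ab: "a j \<in> sets borel" "b j \<in> sets path_space" "A j = (S j -` a j \<inter> space M) \<inter> (cycle_path j -` b j \<inter> space M)" if "j \<in> J" for j
      using p that by (auto simp: a_def b_def)
    have "prob (\<Inter>j\<in>J. A j) = prob (\<Inter>j\<in>J. (S j -` a j \<inter> space M) \<inter> (cycle_path j -` b j \<inter> space M))"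
      using ab(3) by (intro arg_cong[where f = prob] INF_cong) auto
    also have "\<dots> = prob (\<Inter>j\<in>J. S j -` a j \<inter> space M) * prob (\<Inter>j\<in>J. cycle_path j -` b j \<inter> space M)"
      using J ab by (intro waiting_brownian_events_indep) auto
    also have "prob (\<Inter>j\<in>J. S j -` a j \<inter> space M) = (\<Prod>j\<in>J. prob (S j -` a j \<inter> space M))"
      by (rule indep_varsD[OF waiting_indep]) (use J ab in auto)
    also have "prob (\<Inter>j\<in>J. cycle_path j -` b j \<inter> space M) = (\<Prod>j\<in>J. prob (cycle_path j -` b j \<inter> space M))"
      by (rule indep_varsD[OF brownian_indep[folded cycle_path_def]]) (use J ab in auto)
    also have "(\<Prod>j\<in>J. prob (S j -` a j \<inter> space M)) * (\<Prod>j\<in>J. prob (cycle_path j -` b j \<inter> space M)) = (\<Prod>j\<in>J. prob (A j))"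
      unfolding prod.distrib[symmetric]
    proof (rule prod.cong)
      fix j assume j: "j \<in> J"
      then show "prob (S j -` a j \<inter> space M) * prob (cycle_path j -` b j \<inter> space M) = prob (A j)"
        using waiting_brownian_events_indep[of "{j}" a b] J ab by auto
    qed simp
    finally show "prob (\<Inter>j\<in>J. A j) = (\<Prod>j\<in>J. prob (A j))" .
  qed
  have G_stable: "Int_stable (G i)" for i
  proof (rule Int_stableI)
    fix x y assume "x \<in> G i" "y \<in> G i"
    then obtain a b c d where "a \<in> sets borel" "b \<in> sets path_space" "c \<in> sets borel" "d \<in> sets path_space"
      "x = (S i -` a \<inter> space M) \<inter> (cycle_path i -` b \<inter> space M)" "y = (S i -` c \<inter> space M) \<inter> (cycle_path i -` d \<inter> space M)"
      unfolding G_def by blast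
    then have "a \<inter> c \<in> sets borel" "b \<inter> d \<in> sets path_space"
      "x \<inter> y = (S i -` (a \<inter> c) \<inter> space M) \<inter> (cycle_path i -` (b \<inter> d) \<inter> space M)" by auto
    then show "x \<inter> y \<in> G i" unfolding G_def by blast
  qed
  have sub: "{(\<lambda>\<omega>. (S i \<omega>, cycle_path i \<omega>)) -` A \<inter> space M | A. A \<in> sets (borel \<Otimes>\<^sub>M path_space)} \<subseteq> sigma_sets (space M) (G i)"
    if "i \<in> {1..}" for i
  proof -
    let ?f = "\<lambda>\<omega>. (S i \<omega>, cycle_path i \<omega>)" and ?\<Omega> = "space borel \<times> space path_space"
    let ?R = "{a \<times> b | a b. a \<in> sets borel \<and> b \<in> sets path_space}"
    have f: "?f \<in> space M \<rightarrow> ?\<Omega>"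
      using that measurable_space[OF cycle_path_measurable[of i]] by auto
    have "{?f -` A \<inter> space M | A. A \<in> sets (borel \<Otimes>\<^sub>M path_space)} = sigma_sets (space M) {?f -` A \<inter> space M | A. A \<in> ?R}"
      unfolding sets_pair_measure by (rule sigma_sets_vimage_commute[OF f])
    also have "{?f -` A \<inter> space M | A. A \<in> ?R} \<subseteq> G i" unfolding G_def by blast
    then have "sigma_sets (space M) {?f -` A \<inter> space M | A. A \<in> ?R} \<subseteq> sigma_sets (space M) (G i)"
      by (rule sigma_sets_mono')
    finally show ?thesis .
  qed
  show "indep_sets (\<lambda>i. {(\<lambda>\<omega>. (S i \<omega>, cycle_path i \<omega>)) -` A \<inter> space M | A. A \<in> sets (borel \<Otimes>\<^sub>M path_space)}) {1..}"
    by (rule indep_sets_mono_sets[OF indep_sets_sigma[OF G_indep G_stable] sub])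
qed

lemma cycle_integral:
  assumes i: "1 \<le> i" and f: "case_prod f \<in> borel_measurable (borel \<Otimes>\<^sub>M path_space)"
  shows "(\<integral>\<^sup>+\<omega>. f (S i \<omega>) (cycle_path i \<omega>) \<partial>M) = (\<integral>\<^sup>+s. (\<integral>\<^sup>+\<omega>. f s (cycle_path i \<omega>) \<partial>M) \<partial>distr M borel (S i))"
proof -
  have S [measurable]: "S i \<in> borel_measurable M" and P [measurable]: "cycle_path i \<in> M \<rightarrow>\<^sub>M path_space"
    using S_measurable cycle_path_measurable i by auto
  interpret DS: prob_space "distr M borel (S i)" by (rule prob_space_distr) fact
  interpret DP: prob_space "distr M path_space (cycle_path i)" by (rule prob_space_distr) fact
  have law: "distr M borel (S i) \<Otimes>\<^sub>M distr M path_space (cycle_path i) = distr M (borel \<Otimes>\<^sub>M path_space) (\<lambda>\<omega>. (S i \<omega>, cycle_path i \<omega>))"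
  proof (rule pair_measure_eqI)
    show "sigma_finite_measure (distr M borel (S i))" "sigma_finite_measure (distr M path_space (cycle_path i))" by unfold_locales
    show "sets (distr M borel (S i) \<Otimes>\<^sub>M distr M path_space (cycle_path i)) = sets (distr M (borel \<Otimes>\<^sub>M path_space) (\<lambda>\<omega>. (S i \<omega>, cycle_path i \<omega>)))"
      by (simp cong: sets_pair_measure_cong)
    fix a b assume "a \<in> sets (distr M borel (S i))" "b \<in> sets (distr M path_space (cycle_path i))"
    then have ab: "a \<in> sets borel" "b \<in> sets path_space" by auto
    have "(\<lambda>\<omega>. (S i \<omega>, cycle_path i \<omega>)) -` (a \<times> b) \<inter> space M = (S i -` a \<inter> space M) \<inter> (cycle_path i -` b \<inter> space M)" by auto
    then show "emeasure (distr M borel (S i)) a * emeasure (distr M path_space (cycle_path i)) b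
      = emeasure (distr M (borel \<Otimes>\<^sub>M path_space) (\<lambda>\<omega>. (S i \<omega>, cycle_path i \<omega>))) (a \<times> b)"
      using waiting_brownian_events_indep[of "{i}" "\<lambda>_. a" "\<lambda>_. b"] ab i
      by (subst (1 2 3) emeasure_distr) (auto simp: emeasure_eq_measure ennreal_mult[symmetric])
  qed
  have f': "case_prod f \<in> borel_measurable (distr M borel (S i) \<Otimes>\<^sub>M distr M path_space (cycle_path i))"
    using f by (simp cong: measurable_cong_sets)
  have f2: "f s \<in> borel_measurable path_space" for s
    using measurable_Pair2[OF f, of s] by simp
  have "(\<integral>\<^sup>+\<omega>. f (S i \<omega>) (cycle_path i \<omega>) \<partial>M) = (\<integral>\<^sup>+p. case_prod f p \<partial>distr M (borel \<Otimes>\<^sub>M path_space) (\<lambda>\<omega>. (S i \<omega>, cycle_path i \<omega>)))"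
    by (subst nn_integral_distr) (auto intro: f)
  also have "\<dots> = (\<integral>\<^sup>+s. \<integral>\<^sup>+b. f s b \<partial>distr M path_space (cycle_path i) \<partial>distr M borel (S i))"
    unfolding law[symmetric] by (subst DP.nn_integral_fst[OF f', symmetric]) simp
  also have "\<dots> = (\<integral>\<^sup>+s. (\<integral>\<^sup>+\<omega>. f s (cycle_path i \<omega>) \<partial>M) \<partial>distr M borel (S i))"
    by (intro nn_integral_cong nn_integral_distr P) (simp add: f2 cong: measurable_cong_sets)
  finally show ?thesis .
qed

lemma AE_waiting_nonneg: "1 \<le> i \<Longrightarrow> AE s in distr M borel (S i). 0 \<le> s"
  using waiting_nonneg S_measurable[of i] by (subst AE_distr_iff) auto

text \<open>
  Waiting time and path of a cycle are independent, and the law of the area up to a fixed time is the same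
  for all Brownian motions; hence the right-hand side refers to the first cycle for every \<open>i\<close>.
\<close>

lemma cycle_area_integral:
  assumes i: "1 \<le> i" and g: "case_prod g \<in> borel_measurable (borel \<Otimes>\<^sub>M borel)"
  shows "(\<integral>\<^sup>+\<omega>. g (S i \<omega>) (cycle_area i \<omega>) \<partial>M) = (\<integral>\<^sup>+s. (\<integral>\<^sup>+\<omega>. g s (area 1 s \<omega>) \<partial>M) \<partial>distr M borel (S 1))"
proof -
  have g2 [measurable]: "g s \<in> borel_measurable borel" for s
    using measurable_Pair2[OF g, of s] by simp
  have meas: "(\<lambda>(s, b). g s (riemann_area s b)) \<in> borel_measurable (borel \<Otimes>\<^sub>M path_space)"
    using measurable_compose[OF measurable_Pair[OF measurable_fst riemann_area_measurable] g]
    by (simp add: split_beta')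
  have "(\<integral>\<^sup>+\<omega>. g (S i \<omega>) (cycle_area i \<omega>) \<partial>M) = (\<integral>\<^sup>+\<omega>. g (S i \<omega>) (riemann_area (S i \<omega>) (cycle_path i \<omega>)) \<partial>M)"
    using cycle_area_eq[OF i] by (intro nn_integral_cong) simp
  also have "\<dots> = (\<integral>\<^sup>+s. (\<integral>\<^sup>+\<omega>. g s (riemann_area s (cycle_path i \<omega>)) \<partial>M) \<partial>distr M borel (S i))"
    by (rule cycle_integral[OF i meas])
  also have "\<dots> = (\<integral>\<^sup>+s. (\<integral>\<^sup>+\<omega>. g s (area 1 s \<omega>) \<partial>M) \<partial>distr M borel (S i))"
  proof (rule nn_integral_cong_AE)
    show "AE s in distr M borel (S i). (\<integral>\<^sup>+\<omega>. g s (riemann_area s (cycle_path i \<omega>)) \<partial>M) = (\<integral>\<^sup>+\<omega>. g s (area 1 s \<omega>) \<partial>M)"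
      using AE_waiting_nonneg[OF i]
    proof eventually_elim
      case (elim s)
      have "(\<integral>\<^sup>+\<omega>. g s (riemann_area s (cycle_path i \<omega>)) \<partial>M) = (\<integral>\<^sup>+\<omega>. g s (area i s \<omega>) \<partial>M)"
        using area_eq_riemann_area[OF i elim] by (intro nn_integral_cong) simp
      also have "\<dots> = (\<integral>\<^sup>+x. g s x \<partial>distr M borel (area i s))"
        using area_measurable[OF i elim] by (intro nn_integral_distr[symmetric]) auto
      also have "distr M borel (area i s) = distr M borel (area 1 s)"
        using path_integral_distr_eq[OF B_path[OF i] B_path[of 1] continuous_on_rabs[OF continuous_on_id] elim] i
        by (simp add: area_eq)
      also have "(\<integral>\<^sup>+x. g s x \<partial>distr M borel (area 1 s)) = (\<integral>\<^sup>+\<omega>. g s (area 1 s \<omega>) \<partial>M)"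
        using area_measurable[of 1, OF _ elim] by (intro nn_integral_distr) auto
      finally show ?case .
    qed
  qed
  also have "distr M borel (S i) = distr M borel (S 1)" by (rule waiting_ident[OF i])
  finally show ?thesis .
qed

lemma cycle_area_measurable: "1 \<le> i \<Longrightarrow> cycle_area i \<in> borel_measurable M"
  using measurable_compose[OF measurable_Pair[OF S_measurable cycle_path_measurable] riemann_area_measurable, of i i]
  by (simp add: cycle_area_eq cong: measurable_cong)

lemma pair_indep:
  "indep_vars (\<lambda>_. borel \<Otimes>\<^sub>M borel) (\<lambda>i \<omega>. (S i \<omega>, cycle_area i \<omega>)) {1..}"
proof -
  have "(\<lambda>p. (fst p, case_prod riemann_area p)) \<in> borel \<Otimes>\<^sub>M path_space \<rightarrow>\<^sub>M borel \<Otimes>\<^sub>M borel"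
    by (intro measurable_Pair measurable_fst riemann_area_measurable)
  from indep_vars_compose2[OF cycle_indep this]
  have ind: "indep_vars (\<lambda>_. borel \<Otimes>\<^sub>M borel) (\<lambda>i \<omega>. (S i \<omega>, riemann_area (S i \<omega>) (cycle_path i \<omega>))) {1..}" by simp
  have rv: "(\<lambda>\<omega>. (S i \<omega>, cycle_area i \<omega>)) \<in> M \<rightarrow>\<^sub>M borel \<Otimes>\<^sub>M borel" if "i \<in> {1..}" for i
    using that S_measurable cycle_area_measurable by (intro measurable_Pair) auto
  have "{(\<lambda>\<omega>. (S i \<omega>, cycle_area i \<omega>)) -` A \<inter> space M | A. A \<in> sets (borel \<Otimes>\<^sub>M borel)}
     = {(\<lambda>\<omega>. (S i \<omega>, riemann_area (S i \<omega>) (cycle_path i \<omega>))) -` A \<inter> space M | A. A \<in> sets (borel \<Otimes>\<^sub>M borel)}" if "i \<in> {1::nat..}" for i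
  proof -
    have "(\<lambda>\<omega>. (S i \<omega>, cycle_area i \<omega>)) -` A \<inter> space M = (\<lambda>\<omega>. (S i \<omega>, riemann_area (S i \<omega>) (cycle_path i \<omega>))) -` A \<inter> space M" for A
      using that cycle_area_eq[of i] by auto
    then show ?thesis by simp
  qed
  note sets_eq = this
  show ?thesis unfolding indep_vars_def2
  proof (intro conjI ballI rv)
    show "indep_sets (\<lambda>i. {(\<lambda>\<omega>. (S i \<omega>, cycle_area i \<omega>)) -` A \<inter> space M | A. A \<in> sets (borel \<Otimes>\<^sub>M borel)}) {1..}"
      by (rule indep_sets_cong[OF refl sets_eq, THEN iffD2, OF _ conjunct2[OF ind[unfolded indep_vars_def2]]])
  qed
qed

lemma pair_ident:
  assumes i: "1 \<le> i"
  shows "distr M (borel \<Otimes>\<^sub>M borel) (\<lambda>\<omega>. (S i \<omega>, cycle_area i \<omega>)) = distr M (borel \<Otimes>\<^sub>M borel) (\<lambda>\<omega>. (S 1 \<omega>, cycle_area 1 \<omega>))"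
proof (rule measure_eqI)
  fix A assume "A \<in> sets (distr M (borel \<Otimes>\<^sub>M borel) (\<lambda>\<omega>. (S i \<omega>, cycle_area i \<omega>)))"
  then have A: "A \<in> sets (borel \<Otimes>\<^sub>M borel)" by simp
  have *: "emeasure (distr M (borel \<Otimes>\<^sub>M borel) (\<lambda>\<omega>. (S j \<omega>, cycle_area j \<omega>))) A
      = (\<integral>\<^sup>+s. (\<integral>\<^sup>+\<omega>. indicator A (s, area 1 s \<omega>) \<partial>M) \<partial>distr M borel (S 1))" if "1 \<le> j" for j
  proof -
    have [measurable]: "(\<lambda>\<omega>. (S j \<omega>, cycle_area j \<omega>)) \<in> M \<rightarrow>\<^sub>M borel \<Otimes>\<^sub>M borel"
      using that S_measurable cycle_area_measurable by (intro measurable_Pair) auto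
    have "emeasure (distr M (borel \<Otimes>\<^sub>M borel) (\<lambda>\<omega>. (S j \<omega>, cycle_area j \<omega>))) A
      = (\<integral>\<^sup>+p. indicator A p \<partial>distr M (borel \<Otimes>\<^sub>M borel) (\<lambda>\<omega>. (S j \<omega>, cycle_area j \<omega>)))"
      using A by simp
    also have "\<dots> = (\<integral>\<^sup>+\<omega>. indicator A (S j \<omega>, cycle_area j \<omega>) \<partial>M)"
      using A by (intro nn_integral_distr) auto
    also have "\<dots> = (\<integral>\<^sup>+s. (\<integral>\<^sup>+\<omega>. indicator A (s, area 1 s \<omega>) \<partial>M) \<partial>distr M borel (S 1))"
      using A by (intro cycle_area_integral[OF that, of "\<lambda>s x. indicator A (s, x)"]) (simp add: split_beta')
    finally show ?thesis .
  qed
  show "emeasure (distr M (borel \<Otimes>\<^sub>M borel) (\<lambda>\<omega>. (S i \<omega>, cycle_area i \<omega>))) A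
     = emeasure (distr M (borel \<Otimes>\<^sub>M borel) (\<lambda>\<omega>. (S 1 \<omega>, cycle_area 1 \<omega>))) A"
    unfolding *[OF i] by (rule *[symmetric]) simp
qed simp

section \<open>The interrupted cycle\<close>

definition mgf :: "real \<Rightarrow> real \<Rightarrow> ennreal" where
  "mgf k s = (\<integral>\<^sup>+\<omega>. ennreal (exp (k * area 1 s \<omega>)) \<partial>M)"

lemma mgf_eq: "mgf k s = brownian_path.area_mgf M (B 1) k s"
proof -
  interpret W: brownian_path M "B 1" by (rule B_path) simp
  show ?thesis by (simp add: mgf_def W.area_mgf_def area_eq)
qed

lemma mgf_submult: "k \<le> 0 \<Longrightarrow> 0 \<le> u \<Longrightarrow> 0 \<le> v \<Longrightarrow> mgf k (u + v) \<le> mgf k u * mgf k v"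
  unfolding mgf_eq by (rule brownian_path.area_mgf_submult[OF B_path[OF order_refl]])

lemma mgf_supermult: "0 \<le> k \<Longrightarrow> 0 \<le> u \<Longrightarrow> 0 \<le> v \<Longrightarrow> mgf k u * mgf k v \<le> mgf k (u + v)"
  unfolding mgf_eq by (rule brownian_path.area_mgf_supermult[OF B_path[OF order_refl]])

lemma mgf_le_one: "k \<le> 0 \<Longrightarrow> mgf k s \<le> 1"
  unfolding mgf_eq by (rule brownian_path.area_mgf_le_one[OF B_path[OF order_refl]])

lemma mgf_ge_one: "0 \<le> k \<Longrightarrow> 1 \<le> mgf k s"
  unfolding mgf_eq by (rule brownian_path.area_mgf_ge_one[OF B_path[OF order_refl]])

lemma mgf_superexponential: "0 < k \<Longrightarrow> \<exists>v>0. ennreal (exp (a * v)) \<le> mgf k v"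
  unfolding mgf_eq by (rule brownian_path.area_mgf_superexponential[OF B_path[OF order_refl]])

lemma mgf_power_le:
  assumes k: "k \<le> 0" and v: "0 \<le> v" "0 \<le> r"
  shows "mgf k (real n * v + r) \<le> mgf k v ^ n"
proof (induction n)
  case 0 show ?case using mgf_le_one[OF k] by simp
next
  case (Suc n)
  have "mgf k (real (Suc n) * v + r) = mgf k (v + (real n * v + r))" by (simp add: algebra_simps)
  also have "\<dots> \<le> mgf k v * mgf k (real n * v + r)" using v by (intro mgf_submult k) auto
  also have "\<dots> \<le> mgf k v * mgf k v ^ n" by (intro mult_left_mono Suc.IH) simp
  finally show ?case by simp
qed

lemma mgf_power_ge:
  assumes k: "0 \<le> k" and v: "0 \<le> v" "0 \<le> r"
  shows "mgf k v ^ n \<le> mgf k (real n * v + r)"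
proof (induction n)
  case 0 show ?case using mgf_ge_one[OF k] by simp
next
  case (Suc n)
  have "mgf k v ^ Suc n \<le> mgf k v * mgf k (real n * v + r)" by (simp add: mult_left_mono Suc.IH)
  also have "\<dots> \<le> mgf k (v + (real n * v + r))" using v by (intro mgf_supermult k) auto
  finally show ?case by (simp add: algebra_simps)
qed

text \<open>
  Submultiplicativity propagates a rate observed at a single time \<open>v\<close> to all times, at the cost of a
  constant for the last incomplete block of length \<open>v\<close>.
\<close>

lemma mgf_exponential_decay:
  assumes k: "k \<le> 0" and a: "0 \<le> a" and v: "0 < v" "mgf k v \<le> ennreal (exp (- a * v))" and u: "0 \<le> u"
  shows "mgf k u \<le> ennreal (exp (a * v) * exp (- a * u))"
proof -
  define n where "n = nat \<lfloor>u / v\<rfloor>"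
  have "0 \<le> u / v" using u v by simp
  then have "real n \<le> u / v" "u / v \<le> real n + 1" unfolding n_def by linarith+
  then have n: "real n * v \<le> u" "u \<le> (real n + 1) * v" using v by (simp_all add: field_simps)
  have "mgf k u = mgf k (real n * v + (u - real n * v))" by simp
  also have "\<dots> \<le> mgf k v ^ n" using n v by (intro mgf_power_le k) auto
  also have "\<dots> \<le> ennreal (exp (- a * v)) ^ n" using v(2) by (rule power_mono) simp
  also have "\<dots> = ennreal (exp (- (a * (real n * v))))"
    by (simp add: ennreal_power exp_of_nat_mult[symmetric] mult_ac)
  also have "\<dots> \<le> ennreal (exp (a * v) * exp (- a * u))"
  proof -
    have "a * u \<le> a * ((real n + 1) * v)" using n a by (intro mult_left_mono) auto
    then show ?thesis by (intro ennreal_leI) (simp add: exp_add[symmetric] algebra_simps)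
  qed
  finally show ?thesis .
qed

lemma mgf_exponential_growth:
  assumes k: "0 \<le> k" and a: "0 \<le> a" and v: "0 < v" "ennreal (exp (a * v)) \<le> mgf k v" and u: "0 \<le> u"
  shows "ennreal (exp (a * u - a * v)) \<le> mgf k u"
proof -
  define n where "n = nat \<lfloor>u / v\<rfloor>"
  have "0 \<le> u / v" using u v by simp
  then have "real n \<le> u / v" "u / v \<le> real n + 1" unfolding n_def by linarith+
  then have n: "real n * v \<le> u" "u \<le> (real n + 1) * v" using v by (simp_all add: field_simps)
  have "a * u \<le> a * ((real n + 1) * v)" using n a by (intro mult_left_mono) auto
  then have "ennreal (exp (a * u - a * v)) \<le> ennreal (exp (a * (real n * v)))"
    by (intro ennreal_leI) (simp add: algebra_simps)
  also have "\<dots> = ennreal (exp (a * v)) ^ n"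
    by (simp add: ennreal_power exp_of_nat_mult[symmetric] mult_ac)
  also have "\<dots> \<le> mgf k v ^ n" using v(2) by (rule power_mono) simp
  also have "\<dots> \<le> mgf k (real n * v + (u - real n * v))" using n v by (intro mgf_power_ge k) auto
  finally show ?thesis by simp
qed

abbreviation cycle_mgf :: "real \<Rightarrow> real \<Rightarrow> ennreal" where
  "cycle_mgf \<zeta> k \<equiv> (\<integral>\<^sup>+\<omega>. ennreal (exp (\<zeta> * S 1 \<omega> + k * cycle_area 1 \<omega>)) \<partial>M)"

abbreviation tail_prob :: "real \<Rightarrow> ennreal" where
  "tail_prob u \<equiv> emeasure M {\<omega> \<in> space M. u < S 1 \<omega>}"

lemma cycle_mgf_eq:
  "cycle_mgf \<zeta> k
    = (\<integral>\<^sup>+s. ennreal (exp (\<zeta> * s)) * mgf k s \<partial>distr M borel (S 1))"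
proof -
  have "cycle_mgf \<zeta> k
     = (\<integral>\<^sup>+s. (\<integral>\<^sup>+\<omega>. ennreal (exp (\<zeta> * s + k * area 1 s \<omega>)) \<partial>M) \<partial>distr M borel (S 1))"
    by (rule cycle_area_integral[of 1 "\<lambda>s x. ennreal (exp (\<zeta> * s + k * x))"]) (auto simp: split_beta')
  also have "\<dots> = (\<integral>\<^sup>+s. ennreal (exp (\<zeta> * s)) * mgf k s \<partial>distr M borel (S 1))"
  proof (rule nn_integral_cong_AE)
    show "AE s in distr M borel (S 1). (\<integral>\<^sup>+\<omega>. ennreal (exp (\<zeta> * s + k * area 1 s \<omega>)) \<partial>M) = ennreal (exp (\<zeta> * s)) * mgf k s"
      using AE_waiting_nonneg[of 1, simplified]
    proof eventually_elim
      case (elim s)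
      note [measurable] = area_measurable[of 1 s, OF _ elim, simplified]
      show ?case unfolding mgf_def
        by (subst nn_integral_cmult[symmetric]) (auto simp: exp_add ennreal_mult)
    qed
  qed
  finally show ?thesis .
qed

text \<open>
  Markov's inequality for the law of the waiting time, in a form that admits \<open>a = \<infinity>\<close>.
\<close>

lemma waiting_tail_markov:
  assumes feas: "cycle_mgf \<zeta> k \<le> 1"
    and a: "\<And>s. u < s \<Longrightarrow> a \<le> ennreal (exp (\<zeta> * s)) * mgf k s"
  shows "a * tail_prob u \<le> 1"
proof -
  have [measurable]: "S 1 \<in> borel_measurable M" by (rule S_measurable) simp
  have "tail_prob u = emeasure (distr M borel (S 1)) {u<..}"
    by (subst emeasure_distr) (auto intro!: arg_cong[where f = "emeasure M"])
  then have "a * tail_prob u = (\<integral>\<^sup>+s. a * indicator {u<..} s \<partial>distr M borel (S 1))"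
    by (simp add: nn_integral_cmult_indicator)
  also have "\<dots> \<le> (\<integral>\<^sup>+s. ennreal (exp (\<zeta> * s)) * mgf k s \<partial>distr M borel (S 1))"
    using a by (intro nn_integral_mono) (auto simp: indicator_def)
  also have "\<dots> \<le> 1" using feas by (simp add: cycle_mgf_eq)
  finally show ?thesis .
qed

text \<open>
  Say that \<open>a\<close> is a decay rate if \<open>mgf k v \<le> exp (- a v)\<close> at some time \<open>v > 0\<close>. If all multiples of \<open>\<eta>\<close> are
  decay rates, the moment generating function alone is small enough. Otherwise some multiple \<open>a\<close> is a
  decay rate while \<open>a + \<eta>\<close> is not: then \<open>mgf k u\<close> is at most of order \<open>exp (- a u)\<close>, but at least
  \<open>exp (- (a + \<eta>) u)\<close> at all times, and the latter makes feasibility a bound on the tail of \<open>S\<close>.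
\<close>

lemma interrupted_cycle_bound_nonpos:
  assumes feas: "cycle_mgf \<zeta> k \<le> 1"
    and k: "k \<le> 0" and \<eta>: "0 < \<eta>"
  shows "\<exists>C>0. \<forall>u\<ge>0. mgf k u * tail_prob u \<le> ennreal (C * exp ((\<eta> - \<zeta>) * u))"
proof -
  define decays where "decays a \<longleftrightarrow> (\<exists>v>0. mgf k v \<le> ennreal (exp (- a * v)))" for a
  have P1: "tail_prob u \<le> 1" for u by (simp add: emeasure_eq_measure)
  show ?thesis
  proof (cases "\<forall>n. decays (real n * \<eta>)")
    case True
    obtain n where n: "\<zeta> < real n * \<eta>" using \<eta> ex_less_of_nat_mult by blast
    from True obtain v where v: "0 < v" "mgf k v \<le> ennreal (exp (- (real n * \<eta>) * v))" unfolding decays_def by blast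
    have "mgf k u * tail_prob u \<le> ennreal (exp (real n * \<eta> * v) * exp ((\<eta> - \<zeta>) * u))" if u: "0 \<le> u" for u
    proof -
      have "mgf k u * tail_prob u \<le> mgf k u * 1" by (intro mult_left_mono P1) simp
      also have "\<dots> \<le> ennreal (exp (real n * \<eta> * v) * exp (- (real n * \<eta>) * u))"
        using mgf_exponential_decay[OF k _ v u] \<eta> by simp
      also have "\<dots> \<le> ennreal (exp (real n * \<eta> * v) * exp ((\<eta> - \<zeta>) * u))"
      proof -
        have "- (real n * \<eta>) * u \<le> (\<eta> - \<zeta>) * u" using n \<eta> u by (intro mult_right_mono) auto
        then show ?thesis by (intro ennreal_leI mult_left_mono) auto
      qed
      finally show ?thesis .
    qed
    then show ?thesis by (intro exI[of _ "exp (real n * \<eta> * v)"]) auto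
  next
    case False
    have zero: "decays (real 0 * \<eta>)" unfolding decays_def using mgf_le_one[OF k, of 1] by (intro exI[of _ 1]) simp
    have "\<exists>n. decays (real n * \<eta>) \<and> \<not> decays (real (Suc n) * \<eta>)"
    proof (rule ccontr)
      assume step: "\<not> ?thesis"
      have "decays (real n * \<eta>)" for n
      proof (induction n)
        case (Suc n) then show ?case using step by blast
      qed (rule zero)
      with False show False by blast
    qed
    then obtain n where n: "decays (real n * \<eta>)" "\<not> decays (real (Suc n) * \<eta>)" by blast
    define a where "a = real n * \<eta>"
    have a: "0 \<le> a" "real (Suc n) * \<eta> = a + \<eta>" using \<eta> by (auto simp: a_def algebra_simps)
    from n(1) obtain v where v: "0 < v" "mgf k v \<le> ennreal (exp (- a * v))" unfolding decays_def a_def by blast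
    have slow: "ennreal (exp (- (a + \<eta>) * s)) \<le> mgf k s" if "0 < s" for s
      using n(2) that unfolding decays_def a(2) by (meson linear)
    have tail: "tail_prob u \<le> ennreal (exp ((a + \<eta> - \<zeta>) * u))" if u: "0 \<le> u" for u
    proof (cases "\<zeta> \<le> a + \<eta>")
      case True
      have "1 \<le> ennreal (exp ((a + \<eta> - \<zeta>) * u))" using True u by simp
      then show ?thesis using P1[of u] by (rule order_trans[rotated])
    next
      case False
      have "ennreal (exp ((\<zeta> - (a + \<eta>)) * u)) * tail_prob u \<le> 1"
      proof (rule waiting_tail_markov[OF feas])
        fix s assume s: "u < s"
        have "(\<zeta> - (a + \<eta>)) * u \<le> (\<zeta> - (a + \<eta>)) * s" using False s by (intro mult_left_mono) auto
        then have "ennreal (exp ((\<zeta> - (a + \<eta>)) * u)) \<le> ennreal (exp (\<zeta> * s) * exp (- (a + \<eta>) * s))"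
          by (intro ennreal_leI) (simp add: exp_add[symmetric] algebra_simps)
        also have "\<dots> = ennreal (exp (\<zeta> * s)) * ennreal (exp (- (a + \<eta>) * s))" by (simp add: ennreal_mult)
        also have "\<dots> \<le> ennreal (exp (\<zeta> * s)) * mgf k s" using slow s u by (intro mult_left_mono) auto
        finally show "ennreal (exp ((\<zeta> - (a + \<eta>)) * u)) \<le> ennreal (exp (\<zeta> * s)) * mgf k s" .
      qed
      then have "exp ((\<zeta> - (a + \<eta>)) * u) * prob {\<omega> \<in> space M. u < S 1 \<omega>} \<le> 1"
        by (simp add: emeasure_eq_measure ennreal_mult[symmetric])
      then have "prob {\<omega> \<in> space M. u < S 1 \<omega>} \<le> 1 / exp ((\<zeta> - (a + \<eta>)) * u)" by (simp add: field_simps)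
      also have "\<dots> = exp ((a + \<eta> - \<zeta>) * u)" by (simp add: exp_minus[symmetric] inverse_eq_divide[symmetric] algebra_simps)
      finally show ?thesis by (simp add: emeasure_eq_measure ennreal_leI)
    qed
    have "mgf k u * tail_prob u \<le> ennreal (exp (a * v) * exp ((\<eta> - \<zeta>) * u))" if u: "0 \<le> u" for u
    proof -
      have "mgf k u * tail_prob u \<le> ennreal (exp (a * v) * exp (- a * u)) * ennreal (exp ((a + \<eta> - \<zeta>) * u))"
        by (intro mult_mono mgf_exponential_decay[OF k a(1) v u] tail[OF u]) auto
      also have "\<dots> = ennreal (exp (a * v) * exp ((\<eta> - \<zeta>) * u))"
        by (simp add: ennreal_mult[symmetric] exp_add[symmetric] algebra_simps)
      finally show ?thesis .
    qed
    then show ?thesis by (intro exI[of _ "exp (a * v)"]) auto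
  qed
qed

text \<open>
  A cycle interrupted at \<open>u\<close> is compared with its completion at \<open>s > u\<close>: the factor \<open>mgf k (s - u)\<close> gained
  by supermultiplicativity outweighs \<open>exp (\<zeta> (s - u))\<close> up to a constant, whatever the sign of \<open>\<zeta>\<close>.
\<close>

lemma interrupted_cycle_bound_pos:
  assumes feas: "cycle_mgf \<zeta> k \<le> 1"
    and k: "0 < k"
  shows "\<exists>C>0. \<forall>u\<ge>0. mgf k u * tail_prob u \<le> ennreal (C * exp (- \<zeta> * u))"
proof -
  obtain v where v: "0 < v" "ennreal (exp (\<bar>\<zeta>\<bar> * v)) \<le> mgf k v" using mgf_superexponential[OF k] by blast
  have k0: "0 \<le> k" using k by simp
  define c where "c = exp (\<bar>\<zeta>\<bar> * v)"
  have "mgf k u * tail_prob u \<le> ennreal (c * exp (- \<zeta> * u))" if u: "0 \<le> u" for u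
  proof -
    let ?P = "tail_prob u" and ?e = "exp (\<zeta> * u - \<bar>\<zeta>\<bar> * v)"
    have "(mgf k u * ennreal ?e) * ?P \<le> 1"
    proof (rule waiting_tail_markov[OF feas])
      fix s assume s: "u < s"
      have "0 \<le> (\<bar>\<zeta>\<bar> + \<zeta>) * (s - u)" using s by (intro mult_nonneg_nonneg) auto
      then have "?e \<le> exp (\<zeta> * s) * exp (\<bar>\<zeta>\<bar> * (s - u) - \<bar>\<zeta>\<bar> * v)"
        by (simp add: exp_add[symmetric] algebra_simps)
      then have "ennreal ?e \<le> ennreal (exp (\<zeta> * s)) * ennreal (exp (\<bar>\<zeta>\<bar> * (s - u) - \<bar>\<zeta>\<bar> * v))"
        by (simp add: ennreal_mult[symmetric] ennreal_leI)
      also have "\<dots> \<le> ennreal (exp (\<zeta> * s)) * mgf k (s - u)"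
        using s by (intro mult_left_mono mgf_exponential_growth[OF k0 _ v]) auto
      finally have "mgf k u * ennreal ?e \<le> mgf k u * (ennreal (exp (\<zeta> * s)) * mgf k (s - u))" by (rule mult_left_mono) simp
      also have "\<dots> = ennreal (exp (\<zeta> * s)) * (mgf k u * mgf k (s - u))" by (simp add: mult_ac)
      also have "\<dots> \<le> ennreal (exp (\<zeta> * s)) * mgf k (u + (s - u))"
        using u s by (intro mult_left_mono mgf_supermult k0) auto
      finally show "mgf k u * ennreal ?e \<le> ennreal (exp (\<zeta> * s)) * mgf k s" by simp
    qed
    then have "(mgf k u * ennreal ?e) * ?P * ennreal (c * exp (- \<zeta> * u)) \<le> 1 * ennreal (c * exp (- \<zeta> * u))"
      by (rule mult_right_mono) simp
    moreover have "(mgf k u * ennreal ?e) * ?P * ennreal (c * exp (- \<zeta> * u)) = mgf k u * ?P * (ennreal ?e * ennreal (c * exp (- \<zeta> * u)))"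
      by (simp only: mult_ac)
    moreover have "ennreal ?e * ennreal (c * exp (- \<zeta> * u)) = 1"
      by (simp add: c_def ennreal_mult[symmetric] exp_add[symmetric])
    ultimately show ?thesis by simp
  qed
  then show ?thesis by (intro exI[of _ c]) (auto simp: c_def)
qed

lemma interrupted_cycle_bound:
  assumes feas: "cycle_mgf \<zeta> k \<le> 1" and \<eta>: "0 < \<eta>"
  shows "\<exists>C>0. \<forall>u\<ge>0. mgf k u * tail_prob u \<le> ennreal (C * exp ((\<eta> - \<zeta>) * u))"
proof (cases "k \<le> 0")
  case True then show ?thesis by (rule interrupted_cycle_bound_nonpos[OF feas _ \<eta>])
next
  case False
  then have "0 < k" by simp
  from interrupted_cycle_bound_pos[OF feas this] obtain C where C: "0 < C"
    "\<And>u. 0 \<le> u \<Longrightarrow> mgf k u * tail_prob u \<le> ennreal (C * exp (- \<zeta> * u))"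
    by blast
  have "mgf k u * tail_prob u \<le> ennreal (C * exp ((\<eta> - \<zeta>) * u))" if u: "0 \<le> u" for u
  proof -
    have "C * exp (- \<zeta> * u) \<le> C * exp ((\<eta> - \<zeta>) * u)"
      using C(1) u \<eta> by (auto intro!: mult_left_mono simp: algebra_simps)
    with C(2)[OF u] show ?thesis by (meson ennreal_leI order_trans)
  qed
  with C(1) show ?thesis by blast
qed

section \<open>The absolute area of the reset Brownian motion\<close>

lemma reset_time_0: "reset_time S 0 \<omega> = 0"
  by (simp add: reset_time_def)

lemma reset_time_Suc: "reset_time S (Suc n) \<omega> = reset_time S n \<omega> + S (Suc n) \<omega>"
  by (simp add: reset_time_def)

lemma reset_time_mono:
  assumes "\<omega> \<in> space M" "m \<le> n" shows "reset_time S m \<omega> \<le> reset_time S n \<omega>"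
  using assms(2)
proof (induction n rule: dec_induct)
  case (step n)
  then show ?case using waiting_nonneg[of "Suc n" \<omega>] assms(1) by (simp add: reset_time_Suc)
qed simp

lemma reset_time_nonneg: "\<omega> \<in> space M \<Longrightarrow> 0 \<le> reset_time S n \<omega>"
  using reset_time_mono[of \<omega> 0 n] by (simp add: reset_time_0)

lemma reset_count_eq:
  assumes om: "\<omega> \<in> space M" and t: "reset_time S n \<omega> \<le> t" "t < reset_time S (Suc n) \<omega>"
  shows "reset_count S t \<omega> = n"
proof -
  have "{m. reset_time S m \<omega> \<le> t} = {..n}"
  proof (intro set_eqI iffI)
    fix m assume "m \<in> {m. reset_time S m \<omega> \<le> t}"
    then have "\<not> Suc n \<le> m" using reset_time_mono[OF om, of "Suc n" m] t(2) by auto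
    then show "m \<in> {..n}" by simp
  next
    fix m assume "m \<in> {..n}"
    then show "m \<in> {m. reset_time S m \<omega> \<le> t}" using reset_time_mono[OF om, of m n] t(1) by auto
  qed
  then show ?thesis by (simp add: reset_count_def cSup_eq_maximum)
qed

lemma path_abs_integrable:
  assumes "1 \<le> i" "\<omega> \<in> space M" shows "set_integrable lborel {0..s} (\<lambda>\<tau>. \<bar>B i \<tau> \<omega>\<bar>)"
  by (rule brownian_path.path_set_integrable[OF B_path brownian_path.abs_continuous]) (use assms B_path in auto)

lemma area_mono:
  assumes i: "1 \<le> i" and om: "\<omega> \<in> space M" and st: "s \<le> t"
  shows "area i s \<omega> \<le> area i t \<omega>"
  unfolding area_def set_lebesgue_integral_def
  using path_abs_integrable[OF i om] st
  by (intro integral_mono) (auto simp: set_integrable_def indicator_def)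

text \<open>
  Half-open intervals are used because the reset process follows path \<open>n + 1\<close> exactly on
  \<open>[T\<^sub>n, T\<^sub>n\<^sub>+\<^sub>1)\<close>; consecutive segments are then disjoint.
\<close>

lemma segment_integral:
  assumes om: "\<omega> \<in> space M" and t: "reset_time S n \<omega> \<le> t" "t \<le> reset_time S (Suc n) \<omega>"
  shows "set_integrable lborel {reset_time S n \<omega>..<t} (\<lambda>\<tau>. \<bar>reset_brownian_motion S B \<tau> \<omega>\<bar>)"
    and "(LINT \<tau>:{reset_time S n \<omega>..<t}|lborel. \<bar>reset_brownian_motion S B \<tau> \<omega>\<bar>)
      = area (Suc n) (t - reset_time S n \<omega>) \<omega>"
proof -
  let ?T = "reset_time S n \<omega>"
  define f where "f x = indicator {0..<t - ?T} x *\<^sub>R \<bar>B (Suc n) x \<omega>\<bar>" for x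
  have eq: "(\<lambda>\<tau>. indicator {?T..<t} \<tau> *\<^sub>R \<bar>reset_brownian_motion S B \<tau> \<omega>\<bar>) = (\<lambda>\<tau>. f (- ?T + 1 * \<tau>))"
  proof
    fix \<tau>
    show "indicator {?T..<t} \<tau> *\<^sub>R \<bar>reset_brownian_motion S B \<tau> \<omega>\<bar> = f (- ?T + 1 * \<tau>)"
    proof (cases "\<tau> \<in> {?T..<t}")
      case True
      then have "reset_count S \<tau> \<omega> = n" using t by (intro reset_count_eq om) auto
      then show ?thesis using True by (simp add: f_def reset_brownian_motion_def Suc_eq_plus1)
    qed (auto simp: f_def indicator_def)
  qed
  have "set_integrable lborel {0..<t - ?T} (\<lambda>\<tau>. \<bar>B (Suc n) \<tau> \<omega>\<bar>)"
    by (rule set_integrable_subset[OF path_abs_integrable[of "Suc n" \<omega> "t - ?T"]]) (use om in auto)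
  then have f: "integrable lborel f" by (simp add: set_integrable_def f_def[abs_def])
  show "set_integrable lborel {?T..<t} (\<lambda>\<tau>. \<bar>reset_brownian_motion S B \<tau> \<omega>\<bar>)"
    unfolding set_integrable_def eq by (rule lborel_integrable_real_affine[OF f]) simp
  have "(LINT \<tau>:{?T..<t}|lborel. \<bar>reset_brownian_motion S B \<tau> \<omega>\<bar>) = (\<integral>x. f x \<partial>lborel)"
    unfolding set_lebesgue_integral_def eq by (subst lborel_integral_real_affine[of 1 f "- ?T"]) auto
  also have "\<dots> = area (Suc n) (t - ?T) \<omega>"
    unfolding area_def set_lebesgue_integral_def
  proof (rule integral_cong_AE)
    have "AE x in lborel. x \<noteq> t - ?T" by (rule AE_lborel_singleton)
    then show "AE x in lborel. f x = indicator {0..t - ?T} x *\<^sub>R \<bar>B (Suc n) x \<omega>\<bar>"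
      by eventually_elim (auto simp: f_def indicator_def)
    show "f \<in> borel_measurable lborel" using f by simp
    show "(\<lambda>x. indicator {0..t - ?T} x *\<^sub>R \<bar>B (Suc n) x \<omega>\<bar>) \<in> borel_measurable lborel"
      using path_abs_integrable[of "Suc n" \<omega> "t - ?T"] om by (simp add: set_integrable_def borel_measurable_integrable)
  qed
  finally show "(LINT \<tau>:{?T..<t}|lborel. \<bar>reset_brownian_motion S B \<tau> \<omega>\<bar>) = area (Suc n) (t - ?T) \<omega>" .
qed

lemma completed_cycles_integral:
  assumes om: "\<omega> \<in> space M"
  shows "set_integrable lborel {0..<reset_time S n \<omega>} (\<lambda>\<tau>. \<bar>reset_brownian_motion S B \<tau> \<omega>\<bar>) \<and>
    (LINT \<tau>:{0..<reset_time S n \<omega>}|lborel. \<bar>reset_brownian_motion S B \<tau> \<omega>\<bar>) = (\<Sum>i=1..n. cycle_area i \<omega>)"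
proof (induction n)
  case 0 show ?case by (simp add: reset_time_0 set_integrable_def set_lebesgue_integral_def)
next
  case (Suc n)
  let ?Z = "\<lambda>\<tau>. \<bar>reset_brownian_motion S B \<tau> \<omega>\<bar>"
  have le: "reset_time S n \<omega> \<le> reset_time S (Suc n) \<omega>" by (rule reset_time_mono[OF om]) simp
  have split: "{0..<reset_time S (Suc n) \<omega>} = {0..<reset_time S n \<omega>} \<union> {reset_time S n \<omega>..<reset_time S (Suc n) \<omega>}"
    using le reset_time_nonneg[OF om, of n] by auto
  note seg = segment_integral[OF om le order_refl]
  have "area (Suc n) (reset_time S (Suc n) \<omega> - reset_time S n \<omega>) \<omega> = cycle_area (Suc n) \<omega>"
    by (simp add: cycle_area_def reset_time_Suc)
  then show ?case unfolding split
    using Suc.IH seg by (subst set_integral_Un) (auto intro!: set_integrable_Un)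
qed

lemma absolute_area_decomposition:
  assumes om: "\<omega> \<in> space M" and t: "reset_time S n \<omega> \<le> t" "t < reset_time S (Suc n) \<omega>"
  shows "absolute_area S B t \<omega> = (\<Sum>i=1..n. cycle_area i \<omega>) + area (Suc n) (t - reset_time S n \<omega>) \<omega>"
proof -
  let ?Z = "\<lambda>\<tau>. \<bar>reset_brownian_motion S B \<tau> \<omega>\<bar>"
  note seg = segment_integral[OF om t(1) less_imp_le[OF t(2)]]
  note cyc = completed_cycles_integral[OF om, of n]
  have split: "{0..<t} = {0..<reset_time S n \<omega>} \<union> {reset_time S n \<omega>..<t}"
    using t reset_time_nonneg[OF om, of n] by auto
  have int: "set_integrable lborel {0..<t} ?Z" unfolding split using cyc seg by (intro set_integrable_Un) auto
  have at_t: "(\<lambda>\<tau>. indicator {t} \<tau> *\<^sub>R ?Z \<tau>) = (\<lambda>\<tau>. indicator {t} \<tau> *\<^sub>R ?Z t)"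
    by (auto simp: indicator_def)
  have point: "set_integrable lborel {t} ?Z" unfolding set_integrable_def at_t by simp
  have "{0..t} = {0..<t} \<union> {t}" using t reset_time_nonneg[OF om, of n] by auto
  then have "absolute_area S B t \<omega> = (LINT \<tau>:{0..<t} \<union> {t}|lborel. ?Z \<tau>)" by (simp add: absolute_area_def)
  also have "\<dots> = (LINT \<tau>:{0..<t}|lborel. ?Z \<tau>) + (LINT \<tau>:{t}|lborel. ?Z \<tau>)"
    by (rule set_integral_Un[OF _ int point]) auto
  also have "(LINT \<tau>:{t}|lborel. ?Z \<tau>) = 0" unfolding set_lebesgue_integral_def at_t by simp
  also have "(LINT \<tau>:{0..<t}|lborel. ?Z \<tau>) = (\<Sum>i=1..n. cycle_area i \<omega>) + area (Suc n) (t - reset_time S n \<omega>) \<omega>"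
    unfolding split using cyc seg by (subst set_integral_Un) auto
  finally show ?thesis by simp
qed

lemma absolute_area_bounds:
  assumes om: "\<omega> \<in> space M" and n: "reset_time S n \<omega> \<le> t" and N: "t < reset_time S N \<omega>"
  shows "(\<Sum>i=1..n. cycle_area i \<omega>) \<le> absolute_area S B t \<omega>" "absolute_area S B t \<omega> \<le> (\<Sum>i=1..N. cycle_area i \<omega>)"
proof -
  define p where "p = (LEAST p. t < reset_time S p \<omega>)"
  have p: "t < reset_time S p \<omega>" "p \<le> N" unfolding p_def using N by (auto intro: LeastI Least_le)
  have "n < p"
  proof (rule ccontr)
    assume "\<not> n < p"
    then have "reset_time S p \<omega> \<le> reset_time S n \<omega>" by (intro reset_time_mono om) auto
    with n p(1) show False by simp
  qed
  then obtain m where m: "p = Suc m" "n \<le> m" by (cases p) auto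
  have "\<not> t < reset_time S m \<omega>" using not_less_Least[of m "\<lambda>p. t < reset_time S p \<omega>"] m(1) by (simp add: p_def)
  then have tm: "reset_time S m \<omega> \<le> t" "t < reset_time S (Suc m) \<omega>" using p m by auto
  note dec = absolute_area_decomposition[OF om tm]
  have cyc: "0 \<le> cycle_area i \<omega>" for i by (simp add: cycle_area_def area_nonneg)
  have "(\<Sum>i=1..n. cycle_area i \<omega>) \<le> (\<Sum>i=1..m. cycle_area i \<omega>)"
    using m cyc by (intro sum_mono2) auto
  then show "(\<Sum>i=1..n. cycle_area i \<omega>) \<le> absolute_area S B t \<omega>"
    unfolding dec using area_nonneg[of "Suc m" "t - reset_time S m \<omega>" \<omega>] by linarith
  have "area (Suc m) (t - reset_time S m \<omega>) \<omega> \<le> cycle_area (Suc m) \<omega>"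
    unfolding cycle_area_def using tm by (intro area_mono om) (auto simp: reset_time_Suc)
  then have "absolute_area S B t \<omega> \<le> (\<Sum>i=1..Suc m. cycle_area i \<omega>)" unfolding dec by simp
  also have "\<dots> \<le> (\<Sum>i=1..N. cycle_area i \<omega>)"
    using m p cyc by (intro sum_mono2) auto
  finally show "absolute_area S B t \<omega> \<le> (\<Sum>i=1..N. cycle_area i \<omega>)" .
qed

lemma reset_time_measurable: "reset_time S n \<in> borel_measurable M"
  unfolding reset_time_def[abs_def] by (intro borel_measurable_sum S_measurable) auto

text \<open>
  A manifestly measurable form of the reset count. It follows the convention of the latter also on the
  null event of infinitely many resets, so that the area is measurable on the whole space and not only
  up to a null set.
\<close>

definition reset_index :: "'a \<Rightarrow> real \<Rightarrow> nat" where
  "reset_index \<omega> t = (if \<forall>m. reset_time S m \<omega> \<le> t then Sup UNIV else (LEAST n. t < reset_time S (Suc n) \<omega>))"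

lemma reset_count_eq_index:
  assumes om: "\<omega> \<in> space M" and t: "0 \<le> t"
  shows "reset_count S t \<omega> = reset_index \<omega> t" and "reset_time S (reset_index \<omega> t) \<omega> \<le> t"
proof -
  have "reset_count S t \<omega> = reset_index \<omega> t \<and> reset_time S (reset_index \<omega> t) \<omega> \<le> t"
  proof (cases "\<forall>m. reset_time S m \<omega> \<le> t")
    case True
    then have "{n. reset_time S n \<omega> \<le> t} = UNIV" by auto
    then show ?thesis using True by (simp add: reset_count_def reset_index_def)
  next
    case False
    then obtain m where m: "t < reset_time S m \<omega>" by (auto simp: not_le)
    then obtain q where "m = Suc q" using t by (cases m) (auto simp: reset_time_0)
    then have ex: "t < reset_time S (Suc q) \<omega>" using m by simp
    let ?n = "LEAST n. t < reset_time S (Suc n) \<omega>"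
    have up: "t < reset_time S (Suc ?n) \<omega>" by (rule LeastI[of "\<lambda>n. t < reset_time S (Suc n) \<omega>", OF ex])
    have low: "reset_time S ?n \<omega> \<le> t"
    proof (cases ?n)
      case 0 then show ?thesis using t by (simp add: reset_time_0)
    next
      case (Suc j)
      then have "\<not> t < reset_time S (Suc j) \<omega>" by (intro not_less_Least) simp
      then show ?thesis unfolding Suc by simp
    qed
    show ?thesis using False reset_count_eq[OF om low up] low by (auto simp: reset_index_def)
  qed
  then show "reset_count S t \<omega> = reset_index \<omega> t" "reset_time S (reset_index \<omega> t) \<omega> \<le> t" by auto
qed

lemma absolute_area_measurable: "absolute_area S B t \<in> borel_measurable M"
proof -
  have T [measurable]: "(\<lambda>p. reset_time S n (fst p)) \<in> borel_measurable (M \<Otimes>\<^sub>M lborel)" for n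
    by (rule measurable_compose[OF measurable_fst reset_time_measurable])
  have index: "(\<lambda>p. reset_index (fst p) (snd p)) \<in> (M \<Otimes>\<^sub>M lborel) \<rightarrow>\<^sub>M count_space UNIV"
    unfolding reset_index_def by measurable
  define Z where "Z p = B (reset_index (fst p) (snd p) + 1)
    (max 0 (snd p - reset_time S (reset_index (fst p) (snd p)) (fst p))) (fst p)" for p
  have Z_meas: "Z \<in> borel_measurable (M \<Otimes>\<^sub>M lborel)"
    unfolding Z_def[abs_def]
  proof (rule measurable_compose_countable[OF _ index, where f = "\<lambda>n p. B (n + 1) (max 0 (snd p - reset_time S n (fst p))) (fst p)"])
    fix n :: nat
    have "(\<lambda>p. (snd p - reset_time S n (fst p), fst p)) \<in> M \<Otimes>\<^sub>M lborel \<rightarrow>\<^sub>M borel \<Otimes>\<^sub>M M" by measurable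
    from measurable_compose[OF this brownian_path.W_jointly_measurable[OF B_path[of "n + 1"]]]
    show "(\<lambda>p. B (n + 1) (max 0 (snd p - reset_time S n (fst p))) (fst p)) \<in> borel_measurable (M \<Otimes>\<^sub>M lborel)" by simp
  qed
  have "(\<lambda>\<omega>. \<integral>\<tau>. indicator {0..t} \<tau> *\<^sub>R \<bar>Z (\<omega>, \<tau>)\<bar> \<partial>lborel) \<in> borel_measurable M"
    using Z_meas by (intro lborel.borel_measurable_lebesgue_integral) (simp add: split_beta')
  moreover have "absolute_area S B t \<omega> = (\<integral>\<tau>. indicator {0..t} \<tau> *\<^sub>R \<bar>Z (\<omega>, \<tau>)\<bar> \<partial>lborel)" if om: "\<omega> \<in> space M" for \<omega>
    unfolding absolute_area_def set_lebesgue_integral_def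
  proof (rule Bochner_Integration.integral_cong)
    fix \<tau>
    show "indicator {0..t} \<tau> *\<^sub>R \<bar>reset_brownian_motion S B \<tau> \<omega>\<bar> = indicator {0..t} \<tau> *\<^sub>R \<bar>Z (\<omega>, \<tau>)\<bar>"
    proof (cases "0 \<le> \<tau>")
      case True
      then show ?thesis using reset_count_eq_index[OF om True]
        by (simp add: reset_brownian_motion_def Z_def max_def)
    qed simp
  qed simp
  ultimately show ?thesis by (simp cong: measurable_cong)
qed

lemma cycle_power:
  "(\<integral>\<^sup>+\<omega>. ennreal (exp (\<zeta> * reset_time S n \<omega> + k * (\<Sum>i=1..n. cycle_area i \<omega>))) \<partial>M)
    = cycle_mgf \<zeta> k ^ n"
proof -
  let ?g = "\<lambda>s x. ennreal (exp (\<zeta> * s + k * x))"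
  have g: "case_prod ?g \<in> borel_measurable (borel \<Otimes>\<^sub>M borel)" by (simp add: split_beta')
  have ind: "indep_vars (\<lambda>_. borel) (\<lambda>i \<omega>. ?g (S i \<omega>) (cycle_area i \<omega>)) {1..n}"
    using indep_vars_compose2[OF indep_vars_subset[OF pair_indep, of "{1..n}"] g] by auto
  have "(\<integral>\<^sup>+\<omega>. ennreal (exp (\<zeta> * reset_time S n \<omega> + k * (\<Sum>i=1..n. cycle_area i \<omega>))) \<partial>M)
      = (\<integral>\<^sup>+\<omega>. (\<Prod>i=1..n. ?g (S i \<omega>) (cycle_area i \<omega>)) \<partial>M)"
    by (intro nn_integral_cong)
      (simp add: reset_time_def prod_ennreal exp_sum[symmetric] sum_distrib_left sum.distrib[symmetric])
  also have "\<dots> = (\<Prod>i=1..n. \<integral>\<^sup>+\<omega>. ?g (S i \<omega>) (cycle_area i \<omega>) \<partial>M)"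
    by (rule indep_vars_nn_integral[OF _ ind]) auto
  also have "\<dots> = (\<Prod>i=1..n. \<integral>\<^sup>+\<omega>. ?g (S 1 \<omega>) (cycle_area 1 \<omega>) \<partial>M)"
    by (intro prod.cong) (auto simp: cycle_area_integral[OF _ g])
  finally show ?thesis by simp
qed

text \<open>
  Lowering \<open>\<zeta>\<close> decreases the integrand wherever \<open>S > 0\<close>, an event of positive probability, and the integral
  is finite.
\<close>

lemma cycle_mgf_strict:
  assumes feas: "cycle_mgf \<zeta> k \<le> 1" and \<eta>: "0 < \<eta>"
  shows "cycle_mgf (\<zeta> - \<eta>) k < 1"
proof -
  have [measurable]: "S 1 \<in> borel_measurable M" "cycle_area 1 \<in> borel_measurable M"
    using S_measurable[of 1] cycle_area_measurable[of 1] by auto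
  have nn: "\<omega> \<in> space M \<Longrightarrow> 0 \<le> S 1 \<omega>" for \<omega> using waiting_nonneg[of 1] by simp
  let ?f = "\<lambda>\<omega>. exp (\<zeta> * S 1 \<omega> + k * cycle_area 1 \<omega>)" and ?g = "\<lambda>\<omega>. exp ((\<zeta> - \<eta>) * S 1 \<omega> + k * cycle_area 1 \<omega>)"
  have gf: "?g \<omega> \<le> ?f \<omega>" if "\<omega> \<in> space M" for \<omega> using nn[OF that] \<eta> by (simp add: algebra_simps)
  have int_f: "integrable M ?f"
  proof (rule integrableI_nonneg)
    show "(\<integral>\<^sup>+\<omega>. ennreal (?f \<omega>) \<partial>M) < \<infinity>" using feas by (rule le_less_trans) simp
  qed auto
  have int_g: "integrable M ?g"
    by (rule Bochner_Integration.integrable_bound[OF int_f]) (use gf in \<open>auto intro!: AE_I2\<close>)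
  have Ef: "expectation ?f \<le> 1" using feas int_f by (subst (asm) nn_integral_eq_integral) auto
  have "expectation ?g \<noteq> expectation ?f"
  proof
    assume "expectation ?g = expectation ?f"
    then have "expectation (\<lambda>\<omega>. ?f \<omega> - ?g \<omega>) = 0" using int_f int_g by simp
    moreover have "AE \<omega> in M. 0 \<le> ?f \<omega> - ?g \<omega>" using gf by (intro AE_I2) simp
    ultimately have "AE \<omega> in M. ?f \<omega> - ?g \<omega> = 0"
      using int_f int_g by (subst (asm) integral_nonneg_eq_0_iff_AE) auto
    then have "AE \<omega> in M. S 1 \<omega> = 0" by eventually_elim (use \<eta> in \<open>simp add: algebra_simps\<close>)
    then have "prob {\<omega> \<in> space M. S 1 \<omega> = 0} = 1" by (subst prob_Collect_eq_1) auto
    with waiting_nonzero show False by simp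
  qed
  moreover have "expectation ?g \<le> expectation ?f" by (intro integral_mono int_f int_g gf)
  ultimately have "expectation ?g < 1" using Ef by simp
  moreover have "(\<integral>\<^sup>+\<omega>. ennreal (?g \<omega>) \<partial>M) = ennreal (expectation ?g)"
    using int_g by (intro nn_integral_eq_integral) auto
  ultimately show ?thesis by (simp add: ennreal_less_one_iff)
qed

text \<open>
  By Markov's inequality \<open>P (T\<^sub>n \<le> t) \<le> exp t * q ^ n\<close> with \<open>q = E exp (- S) < 1\<close>.
\<close>

lemma AE_finitely_many_resets:
  assumes t: "0 \<le> t"
  shows "AE \<omega> in M. \<exists>n. reset_time S n \<omega> \<le> t \<and> t < reset_time S (Suc n) \<omega>"
proof -
  note [measurable] = reset_time_measurable
  define q where "q = cycle_mgf (0 - 1) 0"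
  have q1: "q < 1" unfolding q_def by (rule cycle_mgf_strict) (auto simp: emeasure_space_1)
  have bound: "emeasure M {\<omega> \<in> space M. \<forall>n. reset_time S n \<omega> \<le> t} \<le> ennreal (exp t) * q ^ n" for n
  proof -
    have "emeasure M {\<omega> \<in> space M. \<forall>n. reset_time S n \<omega> \<le> t} = (\<integral>\<^sup>+\<omega>. indicator {\<omega> \<in> space M. \<forall>n. reset_time S n \<omega> \<le> t} \<omega> \<partial>M)"
      by simp
    also have "\<dots> \<le> (\<integral>\<^sup>+\<omega>. ennreal (exp t) * ennreal (exp ((0 - 1) * reset_time S n \<omega> + 0 * (\<Sum>i=1..n. cycle_area i \<omega>))) \<partial>M)"
    proof (rule nn_integral_mono)
      fix \<omega>
      have "1 \<le> ennreal (exp t * exp (- reset_time S n \<omega>))" if "reset_time S n \<omega> \<le> t"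
        using that by (simp add: exp_add[symmetric])
      then show "indicator {\<omega> \<in> space M. \<forall>n. reset_time S n \<omega> \<le> t} \<omega>
        \<le> ennreal (exp t) * ennreal (exp ((0 - 1) * reset_time S n \<omega> + 0 * (\<Sum>i=1..n. cycle_area i \<omega>)))"
        by (auto simp: indicator_def ennreal_mult)
    qed
    also have "\<dots> = ennreal (exp t) * (\<integral>\<^sup>+\<omega>. ennreal (exp ((0 - 1) * reset_time S n \<omega> + 0 * (\<Sum>i=1..n. cycle_area i \<omega>))) \<partial>M)"
      by (intro nn_integral_cmult) simp
    also have "\<dots> = ennreal (exp t) * q ^ n" unfolding cycle_power q_def ..
    finally show ?thesis .
  qed
  obtain r where r: "q = ennreal r" "0 \<le> r" using q1 by (cases q) auto
  have "r < 1" using q1 r by (simp add: ennreal_less_one_iff)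
  then have "(\<lambda>n. exp t * r ^ n) \<longlonglongrightarrow> exp t * 0" using r by (intro tendsto_intros LIMSEQ_power_zero) auto
  then have "(\<lambda>n. ennreal (exp t * r ^ n)) \<longlonglongrightarrow> ennreal 0" by (intro tendsto_ennrealI) simp
  then have "(\<lambda>n. ennreal (exp t) * q ^ n) \<longlonglongrightarrow> 0" using r by (simp add: ennreal_power ennreal_mult)
  then have "emeasure M {\<omega> \<in> space M. \<forall>n. reset_time S n \<omega> \<le> t} \<le> 0"
    by (rule LIMSEQ_le_const) (use bound in auto)
  then have "AE \<omega> in M. \<not> (\<forall>n. reset_time S n \<omega> \<le> t)"
    by (subst AE_iff_measurable[OF _ refl]) auto
  then show ?thesis using AE_space
  proof eventually_elim
    case (elim \<omega>)
    have idx: "reset_time S (reset_index \<omega> t) \<omega> \<le> t" by (rule reset_count_eq_index(2)[OF elim(2) t])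
    from elim(1) obtain m where m: "t < reset_time S m \<omega>" by (auto simp: not_le)
    then obtain j where "m = Suc j" using t by (cases m) (auto simp: reset_time_0)
    then have "t < reset_time S (Suc (LEAST n. t < reset_time S (Suc n) \<omega>)) \<omega>"
      using m by (intro LeastI[of "\<lambda>n. t < reset_time S (Suc n) \<omega>" j]) simp
    moreover have "reset_index \<omega> t = (LEAST n. t < reset_time S (Suc n) \<omega>)"
      unfolding reset_index_def using elim(1) by (rule if_not_P)
    ultimately have "t < reset_time S (Suc (reset_index \<omega> t)) \<omega>" by simp
    with idx show ?case by blast
  qed
qed

lemma area_mgf_ident:
  assumes i: "1 \<le> i" and u: "0 \<le> u"
  shows "(\<integral>\<^sup>+\<omega>. ennreal (exp (k * area i u \<omega>)) \<partial>M) = mgf k u"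
proof -
  have "(\<integral>\<^sup>+\<omega>. ennreal (exp (k * area j u \<omega>)) \<partial>M) = (\<integral>\<^sup>+x. ennreal (exp (k * x)) \<partial>distr M borel (area j u))" if "1 \<le> j" for j
    using area_measurable[OF that u] by (intro nn_integral_distr[symmetric]) auto
  moreover have "distr M borel (area i u) = distr M borel (area 1 u)"
    using path_integral_distr_eq[OF B_path[OF i] B_path[of 1] continuous_on_rabs[OF continuous_on_id] u] i
    by (simp add: area_eq)
  ultimately show ?thesis using i unfolding mgf_def by simp
qed

lemma interrupted_cycle_integral:
  assumes i: "1 \<le> i" and u: "0 \<le> u"
  shows "(\<integral>\<^sup>+\<omega>. of_bool (u < S i \<omega>) * ennreal (exp (k * riemann_area u (cycle_path i \<omega>))) \<partial>M)
    = mgf k u * tail_prob u"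
proof -
  have [measurable]: "S i \<in> borel_measurable M" "S 1 \<in> borel_measurable M" using S_measurable i by auto
  have ra [measurable]: "riemann_area u \<in> borel_measurable path_space"
    using measurable_Pair2[OF riemann_area_measurable, of u] by simp
  have "(\<lambda>(s, b). of_bool (u < s) * ennreal (exp (k * riemann_area u b))) \<in> borel_measurable (borel \<Otimes>\<^sub>M path_space)"
    unfolding split_beta' by measurable
  from cycle_integral[OF i this]
  have "(\<integral>\<^sup>+\<omega>. of_bool (u < S i \<omega>) * ennreal (exp (k * riemann_area u (cycle_path i \<omega>))) \<partial>M)
    = (\<integral>\<^sup>+s. (\<integral>\<^sup>+\<omega>. of_bool (u < s) * ennreal (exp (k * riemann_area u (cycle_path i \<omega>))) \<partial>M) \<partial>distr M borel (S i))" .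
  also have "\<dots> = (\<integral>\<^sup>+s. mgf k u * indicator {u<..} s \<partial>distr M borel (S i))"
  proof (rule nn_integral_cong)
    fix s
    have "(\<integral>\<^sup>+\<omega>. ennreal (exp (k * riemann_area u (cycle_path i \<omega>))) \<partial>M) = mgf k u"
      using area_eq_riemann_area[OF i u] area_mgf_ident[OF i u, of k] by (simp cong: nn_integral_cong)
    then show "(\<integral>\<^sup>+\<omega>. of_bool (u < s) * ennreal (exp (k * riemann_area u (cycle_path i \<omega>))) \<partial>M) = mgf k u * indicator {u<..} s"
      by (cases "u < s") auto
  qed
  also have "\<dots> = mgf k u * emeasure (distr M borel (S 1)) {u<..}"
    unfolding waiting_ident[OF i] by (simp add: nn_integral_cmult_indicator)
  also have "emeasure (distr M borel (S 1)) {u<..} = tail_prob u"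
    by (subst emeasure_distr) (auto intro!: arg_cong[where f = "emeasure M"])
  finally show ?thesis .
qed

text \<open>
  The first \<open>n\<close> cycles are independent of the next one. Given the reset time \<open>T \<le> t\<close>, the next cycle is
  interrupted after \<open>t - T\<close>, and the bound on interrupted cycles replaces it by \<open>C exp (- z (t - T))\<close>; the
  factor \<open>exp (z T)\<close> then joins the completed cycles.
\<close>

lemma moment_term_bound:
  assumes C: "0 \<le> C" "\<And>u. 0 \<le> u \<Longrightarrow> mgf k u * tail_prob u \<le> ennreal (C * exp (- z * u))"
  shows "(\<integral>\<^sup>+\<omega>. of_bool (reset_time S n \<omega> \<le> t \<and> t < reset_time S (Suc n) \<omega>) * ennreal (exp (k * absolute_area S B t \<omega>)) \<partial>M)
    \<le> ennreal (C * exp (- z * t)) * cycle_mgf z k ^ n"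
proof -
  let ?N = "borel \<Otimes>\<^sub>M path_space"
  let ?cyc = "\<lambda>i \<omega>. (S i \<omega>, cycle_path i \<omega>)"
  let ?past = "\<lambda>\<omega>. \<lambda>i\<in>{1..n}. ?cyc i \<omega>" and ?next = "\<lambda>\<omega>. \<lambda>i\<in>{Suc n}. ?cyc i \<omega>"
  define T where "T v = (\<Sum>i=1..n. fst (v i))" for v :: "nat \<Rightarrow> real \<times> (real \<Rightarrow> real)"
  define X where "X v = (\<Sum>i=1..n. case_prod riemann_area (v i))" for v :: "nat \<Rightarrow> real \<times> (real \<Rightarrow> real)"
  define f where "f v w = (of_bool (T v \<le> t) * ennreal (exp (k * X v))) *
     (of_bool (t - T v < fst (w (Suc n))) * ennreal (exp (k * riemann_area (t - T v) (snd (w (Suc n))))))"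
    for v w :: "nat \<Rightarrow> real \<times> (real \<Rightarrow> real)"
  have comp: "(\<lambda>v. v i) \<in> PiM {1..n} (\<lambda>_. ?N) \<rightarrow>\<^sub>M ?N" if "i \<in> {1..n}" for i
    using that by (rule measurable_component_singleton)
  have T_meas [measurable]: "T \<in> borel_measurable (PiM {1..n} (\<lambda>_. ?N))"
    unfolding T_def[abs_def] by (intro borel_measurable_sum measurable_compose[OF comp measurable_fst])
  have X_meas [measurable]: "X \<in> borel_measurable (PiM {1..n} (\<lambda>_. ?N))"
    unfolding X_def[abs_def] by (intro borel_measurable_sum measurable_compose[OF comp riemann_area_measurable])
  have next_meas [measurable]: "(\<lambda>w. w (Suc n)) \<in> PiM {Suc n} (\<lambda>_. ?N) \<rightarrow>\<^sub>M ?N"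
    by (rule measurable_component_singleton) simp
  have f_meas: "case_prod f \<in> borel_measurable (PiM {1..n} (\<lambda>_. ?N) \<Otimes>\<^sub>M PiM {Suc n} (\<lambda>_. ?N))"
  proof -
    have ra: "(\<lambda>p. riemann_area (t - T (fst p)) (snd (snd p (Suc n)))) \<in> borel_measurable (PiM {1..n} (\<lambda>_. ?N) \<Otimes>\<^sub>M PiM {Suc n} (\<lambda>_. ?N))"
    proof -
      have "(\<lambda>p. (t - T (fst p), snd (snd p (Suc n)))) \<in> PiM {1..n} (\<lambda>_. ?N) \<Otimes>\<^sub>M PiM {Suc n} (\<lambda>_. ?N) \<rightarrow>\<^sub>M ?N"
        by measurable
      from measurable_compose[OF this riemann_area_measurable] show ?thesis by simp
    qed
    show ?thesis unfolding f_def split_beta' using ra by measurable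
  qed
  have T_past: "T (?past \<omega>) = reset_time S n \<omega>" for \<omega>
    unfolding T_def reset_time_def by (intro sum.cong) auto
  have X_past: "X (?past \<omega>) = (\<Sum>i=1..n. cycle_area i \<omega>)" if "\<omega> \<in> space M" for \<omega>
    unfolding X_def using that by (intro sum.cong) (auto simp: cycle_area_eq)
  have ind: "indep_var (PiM {1..n} (\<lambda>_. ?N)) ?past (PiM {Suc n} (\<lambda>_. ?N)) ?next"
    by (rule indep_var_restrict[OF cycle_indep]) auto
  have "(\<integral>\<^sup>+\<omega>. of_bool (reset_time S n \<omega> \<le> t \<and> t < reset_time S (Suc n) \<omega>) * ennreal (exp (k * absolute_area S B t \<omega>)) \<partial>M)
     = (\<integral>\<^sup>+\<omega>. f (?past \<omega>) (?next \<omega>) \<partial>M)"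
  proof (rule nn_integral_cong)
    fix \<omega> assume om: "\<omega> \<in> space M"
    show "of_bool (reset_time S n \<omega> \<le> t \<and> t < reset_time S (Suc n) \<omega>) * ennreal (exp (k * absolute_area S B t \<omega>)) = f (?past \<omega>) (?next \<omega>)"
    proof (cases "reset_time S n \<omega> \<le> t \<and> t < reset_time S (Suc n) \<omega>")
      case True
      then have "absolute_area S B t \<omega> = (\<Sum>i=1..n. cycle_area i \<omega>) + riemann_area (t - reset_time S n \<omega>) (cycle_path (Suc n) \<omega>)"
        using absolute_area_decomposition[OF om, of n t] area_eq_riemann_area[of "Suc n" "t - reset_time S n \<omega>" \<omega>] om by simp
      then show ?thesis using True
        by (simp add: f_def T_past X_past[OF om] reset_time_Suc ennreal_mult[symmetric] exp_add[symmetric] distrib_left algebra_simps)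
    next
      case False
      then show ?thesis by (auto simp: f_def T_past reset_time_Suc)
    qed
  qed
  also have "\<dots> = (\<integral>\<^sup>+\<omega>. (\<integral>\<^sup>+\<omega>'. f (?past \<omega>) (?next \<omega>') \<partial>M) \<partial>M)"
    by (rule nn_integral_indep_pair[OF ind f_meas])
  also have "\<dots> \<le> (\<integral>\<^sup>+\<omega>. ennreal (C * exp (- z * t)) * ennreal (exp (z * reset_time S n \<omega> + k * (\<Sum>i=1..n. cycle_area i \<omega>))) \<partial>M)"
  proof (rule nn_integral_mono)
    fix \<omega> assume om: "\<omega> \<in> space M"
    let ?T = "reset_time S n \<omega>" and ?X = "\<Sum>i=1..n. cycle_area i \<omega>"
    show "(\<integral>\<^sup>+\<omega>'. f (?past \<omega>) (?next \<omega>') \<partial>M) \<le> ennreal (C * exp (- z * t)) * ennreal (exp (z * ?T + k * ?X))"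
    proof (cases "?T \<le> t")
      case False then show ?thesis by (simp add: f_def T_past)
    next
      case True
      have [measurable]: "S (Suc n) \<in> borel_measurable M" "cycle_path (Suc n) \<in> M \<rightarrow>\<^sub>M path_space"
        using S_measurable[of "Suc n"] cycle_path_measurable[of "Suc n"] by auto
      have [measurable]: "riemann_area u \<in> borel_measurable path_space" for u
        using measurable_Pair2[OF riemann_area_measurable, of u] by simp
      have "(\<integral>\<^sup>+\<omega>'. f (?past \<omega>) (?next \<omega>') \<partial>M)
        = (\<integral>\<^sup>+\<omega>'. ennreal (exp (k * ?X)) * (of_bool (t - ?T < S (Suc n) \<omega>') * ennreal (exp (k * riemann_area (t - ?T) (cycle_path (Suc n) \<omega>')))) \<partial>M)"
        using True by (intro nn_integral_cong) (simp add: f_def T_past X_past[OF om])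
      also have "\<dots> = ennreal (exp (k * ?X)) * (\<integral>\<^sup>+\<omega>'. of_bool (t - ?T < S (Suc n) \<omega>') * ennreal (exp (k * riemann_area (t - ?T) (cycle_path (Suc n) \<omega>'))) \<partial>M)"
        by (intro nn_integral_cmult) measurable
      also have "\<dots> = ennreal (exp (k * ?X)) * (mgf k (t - ?T) * emeasure M {\<omega> \<in> space M. t - ?T < S 1 \<omega>})"
        using True by (subst interrupted_cycle_integral) auto
      also have "\<dots> \<le> ennreal (exp (k * ?X)) * ennreal (C * exp (- z * (t - ?T)))"
        using True by (intro mult_left_mono C) auto
      also have "\<dots> = ennreal (C * exp (- z * t)) * ennreal (exp (z * ?T + k * ?X))"
        using C(1) by (simp add: ennreal_mult[symmetric] exp_add[symmetric] algebra_simps)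
      finally show ?thesis .
    qed
  qed
  also have "\<dots> = ennreal (C * exp (- z * t)) * (\<integral>\<^sup>+\<omega>. ennreal (exp (z * reset_time S n \<omega> + k * (\<Sum>i=1..n. cycle_area i \<omega>))) \<partial>M)"
    using reset_time_measurable cycle_area_measurable
    by (intro nn_integral_cmult) (auto intro!: measurable_compose[OF _ measurable_ennreal] borel_measurable_exp borel_measurable_sum borel_measurable_add borel_measurable_times)
  also have "\<dots> = ennreal (C * exp (- z * t)) * cycle_mgf z k ^ n"
    unfolding cycle_power ..
  finally show ?thesis .
qed

lemma moment_upper_bound:
  assumes feas: "cycle_mgf \<zeta> k \<le> 1" and \<eta>: "0 < \<eta>"
  shows "\<exists>C>0. \<forall>\<^sub>F t in at_top. (\<integral>\<^sup>+\<omega>. ennreal (exp (k * absolute_area S B t \<omega>)) \<partial>M) \<le> ennreal (C * exp ((\<eta> - \<zeta>) * t))"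
proof -
  obtain C where C: "0 < C" "\<And>u. 0 \<le> u \<Longrightarrow> mgf k u * tail_prob u \<le> ennreal (C * exp ((\<eta> - \<zeta>) * u))"
    using interrupted_cycle_bound[OF feas \<eta>] by blast
  define q where "q = cycle_mgf (\<zeta> - \<eta>) k"
  have q1: "q < 1" unfolding q_def by (rule cycle_mgf_strict[OF feas \<eta>])
  obtain r where r: "q = ennreal r" "0 \<le> r" using q1 by (cases q) auto
  have r1: "r < 1" using q1 r by (simp add: ennreal_less_one_iff)
  have "(\<lambda>n. r ^ n) sums (1 / (1 - r))" using r r1 by (intro geometric_sums) simp
  then have "(\<Sum>n. ennreal (r ^ n)) = ennreal (1 / (1 - r))" using r by (intro suminf_ennreal_eq) auto
  then have geom: "(\<Sum>n. q ^ n) = ennreal (1 / (1 - r))" using r by (simp add: ennreal_power)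
  have "(\<integral>\<^sup>+\<omega>. ennreal (exp (k * absolute_area S B t \<omega>)) \<partial>M) \<le> ennreal (C / (1 - r) * exp ((\<eta> - \<zeta>) * t))" if t: "0 \<le> t" for t
  proof -
    note [measurable] = reset_time_measurable absolute_area_measurable
    let ?E = "\<lambda>n \<omega>. of_bool (reset_time S n \<omega> \<le> t \<and> t < reset_time S (Suc n) \<omega>) * ennreal (exp (k * absolute_area S B t \<omega>))"
    have "(\<integral>\<^sup>+\<omega>. ennreal (exp (k * absolute_area S B t \<omega>)) \<partial>M) \<le> (\<integral>\<^sup>+\<omega>. (\<Sum>n. ?E n \<omega>) \<partial>M)"
    proof (rule nn_integral_mono_AE)
      show "AE \<omega> in M. ennreal (exp (k * absolute_area S B t \<omega>)) \<le> (\<Sum>n. ?E n \<omega>)"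
        using AE_finitely_many_resets[OF t]
      proof eventually_elim
        case (elim \<omega>)
        then obtain n where n: "reset_time S n \<omega> \<le> t \<and> t < reset_time S (Suc n) \<omega>" by blast
        then have "ennreal (exp (k * absolute_area S B t \<omega>)) = (\<Sum>j\<in>{n}. ?E j \<omega>)" by simp
        also have "\<dots> \<le> (\<Sum>n. ?E n \<omega>)" by (rule sum_le_suminf) auto
        finally show ?case .
      qed
    qed
    also have "\<dots> = (\<Sum>n. \<integral>\<^sup>+\<omega>. ?E n \<omega> \<partial>M)"
      by (rule nn_integral_suminf) measurable
    also have "\<dots> \<le> (\<Sum>n. ennreal (C * exp ((\<eta> - \<zeta>) * t)) * q ^ n)"
    proof (rule suminf_le)
      fix n
      show "(\<integral>\<^sup>+\<omega>. ?E n \<omega> \<partial>M) \<le> ennreal (C * exp ((\<eta> - \<zeta>) * t)) * q ^ n"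
        using moment_term_bound[of C k "\<zeta> - \<eta>" n t] C by (simp add: q_def)
    qed auto
    also have "\<dots> = ennreal (C * exp ((\<eta> - \<zeta>) * t)) * ennreal (1 / (1 - r))" by (simp add: geom)
    also have "\<dots> = ennreal (C / (1 - r) * exp ((\<eta> - \<zeta>) * t))"
      using C(1) r1 by (simp add: ennreal_mult[symmetric])
    finally show ?thesis .
  qed
  then have "\<forall>\<^sub>F t in at_top. (\<integral>\<^sup>+\<omega>. ennreal (exp (k * absolute_area S B t \<omega>)) \<partial>M) \<le> ennreal (C / (1 - r) * exp ((\<eta> - \<zeta>) * t))"
    using eventually_ge_at_top[of 0] by (rule eventually_mono[rotated])
  then show ?thesis using C(1) r1 by (intro exI[of _ "C / (1 - r)"]) auto
qed

text \<open>
  A cycle of length zero has no area because the integrand vanishes at the single time \<open>0\<close>.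
\<close>

lemma renewal_reward_absolute_area: "renewal_reward_bounded M S cycle_area (absolute_area S B)"
proof -
  interpret R: renewal_reward M S cycle_area "absolute_area S B"
  proof (unfold_locales, goal_cases)
    case 1 show ?case by (rule pair_indep)
  next
    case (2 i) then show ?case by (rule pair_ident)
  next
    case (3 i \<omega>) then show ?case by (rule waiting_nonneg)
  next
    case (4 i \<omega>) show ?case by (simp add: cycle_area_def area_nonneg)
  next
    case (5 \<omega>)
    then have "B 1 0 \<omega> = 0" using brownian_path.W_zero[OF B_path[OF order_refl]] by simp
    then have "(\<lambda>\<tau>. indicator {0..0} \<tau> *\<^sub>R \<bar>B 1 \<tau> \<omega>\<bar>) = (\<lambda>\<tau>. 0)" by (auto simp: indicator_def)
    then show ?case using 5 by (simp add: cycle_area_def area_def set_lebesgue_integral_def)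
  next
    case 6 show ?case by (rule waiting_nonzero)
  next
    case (7 t) show ?case by (rule absolute_area_measurable)
  next
    case (8 \<omega> t n N) then show ?case
      using absolute_area_bounds[of \<omega> n t N] by (simp add: reset_time_def)
  qed
  show ?thesis
    by unfold_locales (use moment_upper_bound in \<open>simp add: R.feasible_def\<close>)
qed

end

theorem proposition4p3:
  fixes M :: "'a measure"
    and S :: "nat \<Rightarrow> 'a \<Rightarrow> real"
    and B :: "nat \<Rightarrow> real \<Rightarrow> 'a \<Rightarrow> real"
    and l :: ereal
  assumes resetting: "brownian_resetting M S B"
    and l_nonneg: "0 \<le> l"
    and tail: "((\<lambda>s :: real. - (ereal (1 / s) * eln (emeasure M {\<omega> \<in> space M. S 1 \<omega> > s})))
                 \<longlongrightarrow> l) at_top"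
  shows "full_LDP M (absolute_area S B) (area_rate M S B) \<and>
         (\<forall>k :: real.
           ((\<lambda>t :: real. ereal (1 / t) *
                eln (\<integral>\<^sup>+\<omega>. ennreal (exp (k * absolute_area S B t \<omega>)) \<partial>M))
              \<longlongrightarrow> - cycle_exponent M S B k) at_top)"
proof -
  interpret brownian_resetting M S B by (rule resetting)
  interpret R: renewal_reward_bounded M S cycle_area "absolute_area S B"
    by (rule renewal_reward_absolute_area)
  have "first_cycle_area S B = cycle_area 1"
    by (simp add: fun_eq_iff first_cycle_area_def cycle_area_def area_def)
  then have exponent: "R.exponent = cycle_exponent M S B"
    by (simp add: fun_eq_iff R.exponent_def cycle_exponent_def R.feasible_def)
  then have "R.rate = area_rate M S B"
    by (simp add: fun_eq_iff R.rate_def area_rate_def)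
  with exponent show ?thesis
    using R.renewal_reward_LDP R.moment_limit by simp
qed

end
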